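(* For every kneading sequence $\nu$, the critical path $C_\nu$ is homeomorphic to $[0,1]$, with a homeomorphism given by $\tilde\varphi$ on $P_\infty\cup L_\nu$, extended to all Fatou intervals.
   Context: **Symbols and itineraries.** Fix $d\in\{2,3,4,\dots\}\cup\{\infty\}$; $A_d=\{0,1,\dots,d-1\}$ for $d<\infty$, $A_\infty=\mathbb Z$, $A_d^\star=A_d\cup\{\star\}$; $A_d^\infty$ is the set of infinite sequences over $A_d$; $\sigma$ is the left shift; an overline denotes infinite repetition. A kneading sequence $\nu$ is either a non-periodic sequence in $A_d^\infty$, or a periodic infinite sequence over $A_d^\star$ in which $\star$ occurs exactly once within the period, at the last position (then $\nu$ is called $\star$-periodic). By convention $\nu$ starts with the symbol $1$; the trivial sequence $\overline\star$ is excluded. The set $X_\nu$ of itineraries consists of: the critical value $\nu$, the critical point $\star\nu$, the postcritical points $\sigma^k(\star\nu)$ ($k\ge1$), the precritical points $w\star\nu$ (concatenation; $w$ a finite, possibly empty word over $A_d$), and all sequences in $A_d^\infty$ not of the form $w\nu$ with $w$ a non-empty word over $A_d$. For $a,b\in X_\nu$, $\operatorname{diff}(a,b)\in\mathbb N\cup\{\infty\}$ is the first position (counted from $1$) at which $a,b$ differ, where an entry $\star$ counts as not different from any symbol. **Precritical points on the critical path and the map $\varphi$.** Finite totally ordered sets $P_n$ ($n\ge1$) and an order-preserving map $\varphi$ into $[0,1]$ are defined recursively: $P_1=\{\star\nu\prec\nu\}$, $\varphi(\star\nu)=0$, $\varphi(\nu)=1$. Given $P_n$, for each adjacent pair $a\prec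 b$ in $P_n$ let $k=\operatorname{diff}(a,b)$. If $k=\infty$, nothing is (ever) inserted between $a$ and $b$. If $k<\infty$, insert between $a$ and $b$ the unique precritical point $w''\star\nu$ where $w''$ is the word over $A_d$ of length $k-1$ not differing from the first $k-1$ entries of $a$ and of $b$ (with $\star$ as wildcard), and set $\varphi(w''\star\nu)=(\varphi(a)+\varphi(b))/2$. $P_{n+1}$ is $P_n$ with all inserted points; $P_\infty=\bigcup_n P_n$. **Critical path.** $L_\nu$ is the set of all $a\in X_\nu\cap A_d^\infty$ for which there is a strictly $\prec$-monotone sequence $(a_n)$ in $P_\infty$ with $\operatorname{diff}(a_n,a)\to\infty$; the order extends to $P_\infty\cup L_\nu$ by placing $a$ as the immediate order limit of $(a_n)$, and $\varphi(a)=\lim\varphi(a_n)$. $M_\nu$ is the set of $a\in L_\nu$ for which there is a precritical point $w\star\nu\in P_\infty$ with $\operatorname{diff}(a,w\star\nu)=\infty$ (empty if $\nu$ is non-periodic). For $\star$-periodic $\nu$, a precritical point $w\star\nu$ (possibly $\nu$ itself) and $w''\in X_\nu\cap A_d^\infty$ with $\operatorname{diff}(w\star\nu,w'')=\infty$, the Fatou interval $[w'',w\star\nu]$ is an abstract interval homeomorphic to $[0,1]$ with endpoints $w''$ and $w\star\nu$ and otherwise disjoint from $X_\nu$. Whenever adjacent points $w\star\nu\prec w'\star\nu$ of some $P_n$ have $\operatorname{diff}=\infty$ (a gap), let $w''\in X_\nu\cap A_d^\infty$ be the unique itinerary with $\operatorname{diff}(w\star\nu,w'')=\operatorname{diff}(w'',w'\star\nu)=\infty$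 and insert the Fatou intervals $[w\star\nu,w'']$ and $[w'',w'\star\nu]$ in that order; extend $\varphi$ to them monotonically, interpolating, with $\varphi(w'')=(\varphi(w\star\nu)+\varphi(w'\star\nu))/2$. For every $a\in M_\nu$, insert a Fatou interval between $a$ and its adjacent point $w\star\nu\in P_\infty$ with $\operatorname{diff}(a,w\star\nu)=\infty$. The critical path $C_\nu$ is $P_\infty\cup L_\nu$ together with all these Fatou intervals, with the order topology. **The map $\tilde\varphi$.** If $M_\nu=\emptyset$, then $\tilde\varphi=\varphi$ (extended to $L_\nu$ and to the Fatou intervals as described). If $M_\nu\neq\emptyset$, each of the at most countably many Fatou intervals inserted at points of $M_\nu$ is assigned a positive length, with finite total sum; the values of $\varphi$ on either side are shifted to make room for an interval of that length, on which the map is an order-preserving homeomorphism; and the result is rescaled so that the range is $[0,1]$. The resulting order-preserving map is $\tilde\varphi$. *)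

theory Defs
  imports "HOL-Analysis.Analysis" "HOL-Library.Omega_Words_Fun"
begin

section \<open>Symbols, kneading sequences and itineraries\<close>

datatype symbol = Star | Sym int

type_synonym itin = "symbol word"

definition alphabet :: "enat \<Rightarrow> symbol set" where
  "alphabet d = (case d of enat n \<Rightarrow> Sym ` {0..<int n} | \<infinity> \<Rightarrow> range Sym)"

definition full_seqs :: "enat \<Rightarrow> itin set" where
  "full_seqs d = {x. range x \<subseteq> alphabet d}"

definition star_periodic :: "enat \<Rightarrow> itin \<Rightarrow> bool" where
  "star_periodic d \<nu> \<longleftrightarrow> (\<exists>u. set u \<subseteq> alphabet d \<and> \<nu> = (u @ [Star])\<^sup>\<omega>)"

text \<open>Periodic means purely periodic: preperiodic sequences count as non-periodic.  The
  requirement that the sequence starts with 1 excludes the constant sequence of stars.\<close>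

definition kneading_sequence :: "enat \<Rightarrow> itin \<Rightarrow> bool" where
  "kneading_sequence d \<nu> \<longleftrightarrow>
     \<nu> 0 = Sym 1 \<and>
     (\<nu> \<in> full_seqs d \<and> (\<forall>k\<ge>1. suffix k \<nu> \<noteq> \<nu>) \<or> star_periodic d \<nu>)"

abbreviation critical_point :: "itin \<Rightarrow> itin" where
  "critical_point \<nu> \<equiv> [Star] \<frown> \<nu>"

definition precritical :: "enat \<Rightarrow> itin \<Rightarrow> itin \<Rightarrow> bool" where
  "precritical d \<nu> x \<longleftrightarrow> (\<exists>w. set w \<subseteq> alphabet d \<and> x = w \<frown> critical_point \<nu>)"

definition itineraries :: "enat \<Rightarrow> itin \<Rightarrow> itin set" where
  "itineraries d \<nu> =
     {\<nu>, critical_point \<nu>}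
     \<union> {suffix k (critical_point \<nu>) | k. k \<ge> 1}
     \<union> {x. precritical d \<nu> x}
     \<union> {x \<in> full_seqs d. \<not> (\<exists>w. w \<noteq> [] \<and> set w \<subseteq> alphabet d \<and> x = w \<frown> \<nu>)}"

definition differ :: "symbol \<Rightarrow> symbol \<Rightarrow> bool" where
  "differ s t \<longleftrightarrow> s \<noteq> Star \<and> t \<noteq> Star \<and> s \<noteq> t"

text \<open>Words are indexed from 0, positions are counted from 1.\<close>

definition diff :: "itin \<Rightarrow> itin \<Rightarrow> enat" where
  "diff a b = (if \<exists>i. differ (a i) (b i) then enat (Suc (LEAST i. differ (a i) (b i))) else \<infinity>)"

section \<open>Precritical points on the critical path\<close>

definition inserted_point :: "enat \<Rightarrow> itin \<Rightarrow> itin \<Rightarrow> itin \<Rightarrow> itin" where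
  "inserted_point d \<nu> a b =
     (THE x. \<exists>w. set w \<subseteq> alphabet d \<and> enat (Suc (length w)) = diff a b \<and>
                 (\<forall>i < length w. \<not> differ (w ! i) (a i) \<and> \<not> differ (w ! i) (b i)) \<and>
                 x = w \<frown> critical_point \<nu>)"

text \<open>A finite totally ordered set is represented by the list of its elements in increasing
  order, each element being paired with its value under the map into the unit interval.\<close>

fun refine :: "enat \<Rightarrow> itin \<Rightarrow> (itin \<times> real) list \<Rightarrow> (itin \<times> real) list" where
  "refine d \<nu> ((a, s) # (b, t) # ps) =
     (a, s) # (if diff a b = \<infinity> then [] else [(inserted_point d \<nu> a b, (s + t) / 2)])
            @ refine d \<nu> ((b, t) # ps)"
| "refine d \<nu> ps = ps"

text \<open>\<open>P_list d \<nu> n\<close> is the set $P_{n+1}$.\<close>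

definition P_list :: "enat \<Rightarrow> itin \<Rightarrow> nat \<Rightarrow> (itin \<times> real) list" where
  "P_list d \<nu> n = (refine d \<nu> ^^ n) [(critical_point \<nu>, 0), (\<nu>, 1)]"

definition P_inf :: "enat \<Rightarrow> itin \<Rightarrow> itin set" where
  "P_inf d \<nu> = (\<Union>n. fst ` set (P_list d \<nu> n))"

definition P_less :: "enat \<Rightarrow> itin \<Rightarrow> itin \<Rightarrow> itin \<Rightarrow> bool" where
  "P_less d \<nu> a b \<longleftrightarrow>
     (\<exists>n i j. i < j \<and> j < length (P_list d \<nu> n) \<and>
              fst (P_list d \<nu> n ! i) = a \<and> fst (P_list d \<nu> n ! j) = b)"

definition phi_P :: "enat \<Rightarrow> itin \<Rightarrow> itin \<Rightarrow> real" where
  "phi_P d \<nu> a = (THE t. \<exists>n. (a, t) \<in> set (P_list d \<nu> n))"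

definition gap :: "enat \<Rightarrow> itin \<Rightarrow> itin \<Rightarrow> itin \<Rightarrow> bool" where
  "gap d \<nu> l r \<longleftrightarrow>
     (\<exists>n i. Suc i < length (P_list d \<nu> n) \<and>
            fst (P_list d \<nu> n ! i) = l \<and> fst (P_list d \<nu> n ! Suc i) = r) \<and>
     diff l r = \<infinity>"

definition gap_mid :: "enat \<Rightarrow> itin \<Rightarrow> itin \<Rightarrow> itin \<Rightarrow> itin" where
  "gap_mid d \<nu> l r =
     (THE w. w \<in> itineraries d \<nu> \<inter> full_seqs d \<and> diff l w = \<infinity> \<and> diff w r = \<infinity>)"

definition gap_mids :: "enat \<Rightarrow> itin \<Rightarrow> itin set" where
  "gap_mids d \<nu> = {gap_mid d \<nu> l r | l r. gap d \<nu> l r}"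

section \<open>Limit points\<close>

definition increasing_to :: "enat \<Rightarrow> itin \<Rightarrow> (nat \<Rightarrow> itin) \<Rightarrow> itin \<Rightarrow> bool" where
  "increasing_to d \<nu> s a \<longleftrightarrow>
     (\<forall>n. s n \<in> P_inf d \<nu>) \<and> (\<forall>n. P_less d \<nu> (s n) (s (Suc n))) \<and>
     (\<lambda>n. diff (s n) a) \<longlonglongrightarrow> \<infinity>"

definition decreasing_to :: "enat \<Rightarrow> itin \<Rightarrow> (nat \<Rightarrow> itin) \<Rightarrow> itin \<Rightarrow> bool" where
  "decreasing_to d \<nu> s a \<longleftrightarrow>
     (\<forall>n. s n \<in> P_inf d \<nu>) \<and> (\<forall>n. P_less d \<nu> (s (Suc n)) (s n)) \<and>
     (\<lambda>n. diff (s n) a) \<longlonglongrightarrow> \<infinity>"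

definition L_set :: "enat \<Rightarrow> itin \<Rightarrow> itin set" where
  "L_set d \<nu> = {a \<in> itineraries d \<nu> \<inter> full_seqs d.
                  \<exists>s. increasing_to d \<nu> s a \<or> decreasing_to d \<nu> s a}"

text \<open>The condition cannot hold for non-periodic \<open>\<nu>\<close>: there a sequence without stars at infinite
  difference from \<open>w\<star>\<nu>\<close> has the form \<open>w'\<nu>\<close> with \<open>w'\<close> non-empty and is not an itinerary.\<close>

definition M_set :: "enat \<Rightarrow> itin \<Rightarrow> itin set" where
  "M_set d \<nu> = {a \<in> L_set d \<nu>. \<exists>x \<in> P_inf d \<nu>. precritical d \<nu> x \<and> diff a x = \<infinity>}"

section \<open>Order and map on the points that are itineraries\<close>

definition vertices :: "enat \<Rightarrow> itin \<Rightarrow> itin set" where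
  "vertices d \<nu> = P_inf d \<nu> \<union> L_set d \<nu> \<union> gap_mids d \<nu>"

text \<open>\<open>P_below d \<nu> p x\<close>: the point \<open>p\<close> of \<open>P_inf\<close> precedes the vertex \<open>x\<close>.  If \<open>\<nu>\<close> is
  non-periodic, then \<open>\<nu>\<close> is both the last point of \<open>P_inf\<close> and an increasing limit; this and
  the next definitions treat it as a point of \<open>P_inf\<close>, which is consistent.\<close>

definition P_below :: "enat \<Rightarrow> itin \<Rightarrow> itin \<Rightarrow> itin \<Rightarrow> bool" where
  "P_below d \<nu> p x \<longleftrightarrow>
     (if x \<in> P_inf d \<nu> then P_less d \<nu> p x
      else if x \<in> L_set d \<nu> then
        (\<exists>s. increasing_to d \<nu> s x \<and> (\<exists>n. P_less d \<nu> p (s n))) \<or>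
        (\<exists>s. decreasing_to d \<nu> s x \<and> (\<forall>n. P_less d \<nu> p (s n)))
      else (\<exists>l r. gap d \<nu> l r \<and> x = gap_mid d \<nu> l r \<and> (p = l \<or> P_less d \<nu> p l)))"

text \<open>Two distinct vertices outside \<open>P_inf\<close> are separated by a point of \<open>P_inf\<close>.\<close>

definition V_less :: "enat \<Rightarrow> itin \<Rightarrow> itin \<Rightarrow> itin \<Rightarrow> bool" where
  "V_less d \<nu> x y \<longleftrightarrow>
     (if x \<in> P_inf d \<nu> then P_below d \<nu> x y
      else if y \<in> P_inf d \<nu> then \<not> P_below d \<nu> y x
      else (\<exists>p \<in> P_inf d \<nu>. \<not> P_below d \<nu> p x \<and> P_below d \<nu> p y))"

abbreviation V_le :: "enat \<Rightarrow> itin \<Rightarrow> itin \<Rightarrow> itin \<Rightarrow> bool" where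
  "V_le d \<nu> x y \<equiv> x = y \<or> V_less d \<nu> x y"

definition phi :: "enat \<Rightarrow> itin \<Rightarrow> itin \<Rightarrow> real" where
  "phi d \<nu> x =
     (if x \<in> P_inf d \<nu> then phi_P d \<nu> x
      else if x \<in> L_set d \<nu> then
        (THE t. \<exists>s. (increasing_to d \<nu> s x \<or> decreasing_to d \<nu> s x) \<and>
                    (\<lambda>n. phi_P d \<nu> (s n)) \<longlonglongrightarrow> t)
      else (THE t. \<exists>l r. gap d \<nu> l r \<and> x = gap_mid d \<nu> l r \<and>
                         t = (phi_P d \<nu> l + phi_P d \<nu> r) / 2))"

section \<open>Fatou intervals and the critical path\<close>

text \<open>In the next three definitions \<open>p\<close> and \<open>q\<close> are the lower and the upper endpoint of a Fatou
  interval.\<close>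

definition gap_interval :: "enat \<Rightarrow> itin \<Rightarrow> itin \<Rightarrow> itin \<Rightarrow> bool" where
  "gap_interval d \<nu> p q \<longleftrightarrow>
     (\<exists>l r. gap d \<nu> l r \<and>
        (p = l \<and> q = gap_mid d \<nu> l r \<or> p = gap_mid d \<nu> l r \<and> q = r))"

definition M_interval :: "enat \<Rightarrow> itin \<Rightarrow> itin \<Rightarrow> itin \<Rightarrow> itin \<Rightarrow> bool" where
  "M_interval d \<nu> a p q \<longleftrightarrow>
     a \<in> M_set d \<nu> \<and>
     (\<exists>x \<in> P_inf d \<nu>. precritical d \<nu> x \<and> diff a x = \<infinity> \<and> (p = a \<and> q = x \<or> p = x \<and> q = a)) \<and>
     V_less d \<nu> p q \<and> \<not> (\<exists>y \<in> vertices d \<nu>. V_less d \<nu> p y \<and> V_less d \<nu> y q)"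

definition fatou_interval :: "enat \<Rightarrow> itin \<Rightarrow> itin \<Rightarrow> itin \<Rightarrow> bool" where
  "fatou_interval d \<nu> p q \<longleftrightarrow> gap_interval d \<nu> p q \<or> (\<exists>a. M_interval d \<nu> a p q)"

text \<open>\<open>Fatou p q t\<close> with \<open>0 < t < 1\<close> is the point with parameter \<open>t\<close> in the interior of the Fatou
  interval from \<open>p\<close> to \<open>q\<close>; its endpoints are \<open>Vertex p\<close> and \<open>Vertex q\<close>.\<close>

datatype path_point = Vertex itin | Fatou itin itin real

definition path_points :: "enat \<Rightarrow> itin \<Rightarrow> path_point set" where
  "path_points d \<nu> =
     Vertex ` vertices d \<nu> \<union> {Fatou p q t | p q t. fatou_interval d \<nu> p q \<and> 0 < t \<and> t < 1}"

fun path_less :: "enat \<Rightarrow> itin \<Rightarrow> path_point \<Rightarrow> path_point \<Rightarrow> bool" where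
  "path_less d \<nu> (Vertex x) (Vertex y) \<longleftrightarrow> V_less d \<nu> x y"
| "path_less d \<nu> (Vertex x) (Fatou p q t) \<longleftrightarrow> V_le d \<nu> x p"
| "path_less d \<nu> (Fatou p q t) (Vertex y) \<longleftrightarrow> V_le d \<nu> q y"
| "path_less d \<nu> (Fatou p q t) (Fatou p' q' t') \<longleftrightarrow>
     p = p' \<and> q = q' \<and> t < t' \<or> V_le d \<nu> q p'"

definition order_topology_on :: "'a set \<Rightarrow> ('a \<Rightarrow> 'a \<Rightarrow> bool) \<Rightarrow> 'a topology" where
  "order_topology_on S lt =
     topology_generated_by
       ({S} \<union> {{x \<in> S. lt x a} | a. a \<in> S} \<union> {{x \<in> S. lt a x} | a. a \<in> S})"

definition critical_path :: "enat \<Rightarrow> itin \<Rightarrow> path_point topology" where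
  "critical_path d \<nu> = order_topology_on (path_points d \<nu>) (path_less d \<nu>)"

section \<open>The modified map\<close>

definition interval_lengths :: "enat \<Rightarrow> itin \<Rightarrow> (itin \<Rightarrow> real) \<Rightarrow> bool" where
  "interval_lengths d \<nu> len \<longleftrightarrow> (\<forall>a \<in> M_set d \<nu>. len a > 0) \<and> len summable_on M_set d \<nu>"

definition interval_maps :: "enat \<Rightarrow> itin \<Rightarrow> (itin \<Rightarrow> itin \<Rightarrow> real \<Rightarrow> real) \<Rightarrow> bool" where
  "interval_maps d \<nu> h \<longleftrightarrow>
     (\<forall>p q. fatou_interval d \<nu> p q \<longrightarrow>
        continuous_on {0..1} (h p q) \<and> strict_mono_on {0..1} (h p q) \<and>
        h p q ` {0..1} = {0..1})"

text \<open>Every value of \<open>phi\<close> is shifted by the total length of the intervals that lie to its left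
  and then divided by the new total length.  For empty \<open>M_set\<close> this is \<open>phi\<close>.\<close>

definition phi_tilde_vertex :: "enat \<Rightarrow> itin \<Rightarrow> (itin \<Rightarrow> real) \<Rightarrow> itin \<Rightarrow> real" where
  "phi_tilde_vertex d \<nu> len x =
     (phi d \<nu> x + infsum len {a. \<exists>p q. M_interval d \<nu> a p q \<and> V_le d \<nu> q x})
       / (1 + infsum len (M_set d \<nu>))"

text \<open>\<open>h\<close> supplies the arbitrary order-preserving homeomorphisms on the Fatou intervals.\<close>

fun phi_tilde ::
  "enat \<Rightarrow> itin \<Rightarrow> (itin \<Rightarrow> real) \<Rightarrow> (itin \<Rightarrow> itin \<Rightarrow> real \<Rightarrow> real) \<Rightarrow> path_point \<Rightarrow> real" where
  "phi_tilde d \<nu> len h (Vertex x) = phi_tilde_vertex d \<nu> len x"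
| "phi_tilde d \<nu> len h (Fatou p q t) =
     phi_tilde_vertex d \<nu> len p +
       (phi_tilde_vertex d \<nu> len q - phi_tilde_vertex d \<nu> len p) * h p q t"

end

theory Submission
  imports Defs
begin

text \<open>
  The critical path carries an order topology, and a bijection onto the unit interval that preserves
  and reflects the order is a homeomorphism (\<open>homeomorphic_map_order_topology_on\<close>).  So the theorem
  is a statement about order: the shifted map is strictly increasing and onto.

  The first ingredient is a dictionary between positions and symbols.  Call two adjacent points of
  some \<open>P_list d \<nu> n\<close>, with their values, a cell of level \<open>n\<close>.  A cell that is not a gap has length
  \<open>1/2 ^ n\<close>, its ends agree on their first \<open>n\<close> symbols up to stars, and all points of \<open>P_inf\<close> inside it
  follow one common word (\<open>cell_not_gap\<close>, \<open>cell_interior\<close>).  Since only finitely many cells are longer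
  than a given length, points whose distance is bounded below differ at a bounded index unless they
  bound a gap (\<open>finite_diff_bounded\<close>); therefore a limit itinerary has only one position on the path.
  Conversely, limits trapped by the same cells have the same symbols (\<open>same_cells_same_limit\<close>).  It
  follows that a vertex is determined by its value under \<open>phi\<close> together with a side that separates a
  point of \<open>P_inf\<close> from the limits adjacent to it, and that \<open>V_less\<close> is the lexicographic order on
  these keys (\<open>key_inj\<close>, \<open>V_less_iff\<close>).

  The second ingredient is that no position is missing.  A value that is neither taken on \<open>P_inf\<close> nor
  inside a gap lies strictly inside a cell of every level, and the symbols of these cells form a
  sequence \<open>a\<close> (\<open>interior_limit_exists\<close>).  The point that needs the dynamics is that \<open>a\<close> is an itinerary,
  that is, for non-periodic \<open>\<nu>\<close>, not a preimage of \<open>\<nu>\<close>.  If it were one, then the ends of the cells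
  would approach \<open>a\<close> along two different arms, and the shift would carry them to two different arms
  at \<open>\<nu>\<close>, so that \<open>\<nu>\<close> would lie strictly between two points of its orbit.  But the critical
  value is an endpoint of the tree spanned by its orbit (\<open>critical_value_endpoint\<close>): otherwise the
  separation is inherited by all later points of the orbit, each of which eventually lies strictly
  between two points of smaller index, and then the finite tree spanned by an initial piece of the
  orbit would have no endpoint at all.

  The third ingredient is elementary.  Making room for intervals of finite total length turns \<open>phi\<close>
  into a function that jumps, by the length of the interval, exactly where an interval is inserted;
  \<open>shifted_value_exists\<close> is the intermediate value theorem for such functions with the jumps filled in.
\<close>

section \<open>Words up to wildcards\<close>

lemma differ_commute: "differ s t \<longleftrightarrow> differ t s"
  by (auto simp: differ_def)

lemma not_differ_refl [simp]: "\<not> differ s s"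
  by (simp add: differ_def)

lemma not_differ_Star [simp]: "\<not> differ Star s" "\<not> differ s Star"
  by (simp_all add: differ_def)

lemma less_diff_iff: "enat n < diff a b \<longleftrightarrow> (\<forall>i<n. \<not> differ (a i) (b i))"
proof (cases "\<exists>i. differ (a i) (b i)")
  case True
  define L where "L = (LEAST i. differ (a i) (b i))"
  have L: "differ (a L) (b L)" "\<And>i. i < L \<Longrightarrow> \<not> differ (a i) (b i)"
    using LeastI_ex[OF True] not_less_Least by (auto simp: L_def)
  have "diff a b = enat (Suc L)"
    using True by (simp add: diff_def L_def)
  then show ?thesis
    using L by (auto simp: less_Suc_eq_le) (metis not_le_imp_less)
qed (auto simp: diff_def)

lemma diff_eq_infinity_iff: "diff a b = \<infinity> \<longleftrightarrow> (\<forall>i. \<not> differ (a i) (b i))"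
  by (auto simp: diff_def)

lemma finite_diffE:
  assumes "diff a b \<noteq> \<infinity>"
  obtains K where "diff a b = enat (Suc K)" "differ (a K) (b K)"
    "\<And>i. i < K \<Longrightarrow> \<not> differ (a i) (b i)"
proof -
  have ex: "\<exists>i. differ (a i) (b i)"
    by (rule ccontr) (use assms in \<open>simp add: diff_def\<close>)
  show ?thesis
    by (rule that[of "LEAST i. differ (a i) (b i)"])
      (use ex LeastI_ex[OF ex] not_less_Least in \<open>auto simp: diff_def\<close>)
qed

lemma diff_commute: "diff a b = diff b a"
  by (simp add: diff_def differ_commute)

lemma Star_notin_alphabet [simp]: "Star \<notin> alphabet d"
  by (auto simp: alphabet_def split: enat.splits)

lemma full_seqs_not_Star: "a \<in> full_seqs d \<Longrightarrow> a i \<noteq> Star"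
  by (auto simp: full_seqs_def) (metis Star_notin_alphabet rangeI subsetD)

lemma word_not_Star: "set w \<subseteq> alphabet d \<Longrightarrow> i < length w \<Longrightarrow> w ! i \<noteq> Star"
  by (metis Star_notin_alphabet nth_mem subsetD)

text \<open>Wildcards make non-difference intransitive; it can be chained through a letter only.\<close>

lemma not_differ_trans: "\<lbrakk>\<not> differ s t; \<not> differ t u; t \<noteq> Star\<rbrakk> \<Longrightarrow> \<not> differ s u"
  by (auto simp: differ_def)

section \<open>Refining a sorted list\<close>

definition consecutive :: "'a list \<Rightarrow> ('a \<times> 'a) set" where
  "consecutive xs = set (zip xs (tl xs))"

lemma consecutive_simps [simp]:
  "consecutive [] = {}" "consecutive [x] = {}"
  "consecutive (x # y # xs) = insert (x, y) (consecutive (y # xs))"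
  by (simp_all add: consecutive_def)

lemma consecutive_iff_nth:
  "(x, y) \<in> consecutive xs \<longleftrightarrow> (\<exists>i. Suc i < length xs \<and> xs ! i = x \<and> xs ! Suc i = y)"
  by (auto simp: consecutive_def set_zip nth_tl less_diff_conv)

lemma consecutive_set: "(x, y) \<in> consecutive xs \<Longrightarrow> x \<in> set xs \<and> y \<in> set xs"
  by (auto simp: consecutive_iff_nth)

definition inserted_entry :: "enat \<Rightarrow> itin \<Rightarrow> itin \<times> real \<Rightarrow> itin \<times> real \<Rightarrow> itin \<times> real" where
  "inserted_entry d \<nu> p q = (inserted_point d \<nu> (fst p) (fst q), (snd p + snd q) / 2)"

lemma refine_Cons2:
  "refine d \<nu> (p # q # ps) =
     p # (if diff (fst p) (fst q) = \<infinity> then [] else [inserted_entry d \<nu> p q]) @ refine d \<nu> (q # ps)"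
  by (cases p; cases q) (simp add: inserted_entry_def)

lemma refine_Nil_iff [simp]: "refine d \<nu> ps = [] \<longleftrightarrow> ps = []"
  by (induction d \<nu> ps rule: refine.induct) auto

lemma hd_refine [simp]: "hd (refine d \<nu> ps) = hd ps"
  by (induction d \<nu> ps rule: refine.induct) auto

lemma consecutive_Cons:
  "ps \<noteq> [] \<Longrightarrow> consecutive (p # ps) = insert (p, hd ps) (consecutive ps)"
  by (cases ps) auto

lemma list_induct_pairs [case_names Nil Single Cons2]:
  assumes "P []" "\<And>x. P [x]" "\<And>x y xs. P (y # xs) \<Longrightarrow> P (x # y # xs)"
  shows "P xs"
  using assms by (rule induct_list012) 

lemma consecutive_refine:
  "consecutive (refine d \<nu> ps) =
     (\<Union>(p, q) \<in> consecutive ps.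
        if diff (fst p) (fst q) = \<infinity> then {(p, q)}
        else {(p, inserted_entry d \<nu> p q), (inserted_entry d \<nu> p q, q)})"
proof (induction ps rule: list_induct_pairs)
  case (Cons2 p q ps)
  then show ?case
    by (auto simp: refine_Cons2 consecutive_Cons)
qed auto

lemma set_refine:
  "set (refine d \<nu> ps) = set ps \<union>
     (\<Union>(p, q) \<in> consecutive ps.
        if diff (fst p) (fst q) = \<infinity> then {} else {inserted_entry d \<nu> p q})"
proof (induction ps rule: list_induct_pairs)
  case (Cons2 p q ps)
  have "set (refine d \<nu> (p # q # ps)) =
      insert p ((if diff (fst p) (fst q) = \<infinity> then {} else {inserted_entry d \<nu> p q}) \<union> set (refine d \<nu> (q # ps)))"
    by (simp add: refine_Cons2)
  then show ?case
    unfolding Cons2.IH by (simp add: Un_left_commute Un_assoc)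
qed auto

abbreviation value_sorted :: "(itin \<times> real) list \<Rightarrow> bool" where
  "value_sorted ps \<equiv> sorted_wrt (\<lambda>p q. snd p < snd q) ps"

lemma value_sorted_iff:
  "value_sorted ps \<longleftrightarrow> (\<forall>(p, q) \<in> consecutive ps. snd p < snd q)"
proof -
  have "value_sorted ps \<longleftrightarrow> successively (\<lambda>p q. snd p < snd q) ps"
    by (rule successively_conv_sorted_wrt[symmetric]) (auto simp: transp_def)
  also have "\<dots> \<longleftrightarrow> (\<forall>(p, q) \<in> consecutive ps. snd p < snd q)"
    by (induction ps rule: list_induct_pairs) auto
  finally show ?thesis .
qed

lemma value_sorted_refine: "value_sorted ps \<Longrightarrow> value_sorted (refine d \<nu> ps)"
  unfolding value_sorted_iff consecutive_refine
  by (fastforce simp: inserted_entry_def split: if_splits)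

lemma value_sorted_inj:
  "\<lbrakk>value_sorted ps; p \<in> set ps; q \<in> set ps; snd p = snd q\<rbrakk> \<Longrightarrow> p = q"
  by (induction ps) auto

lemma value_sorted_less_iff:
  assumes "value_sorted ps" "i < length ps" "j < length ps"
  shows "snd (ps ! i) < snd (ps ! j) \<longleftrightarrow> i < j"
  using assms sorted_wrt_nth_less[OF assms(1)]
  by (metis less_irrefl linorder_neqE_nat less_trans)

lemma consecutive_no_between:
  assumes "value_sorted ps" "(p, q) \<in> consecutive ps" "r \<in> set ps"
  shows "snd r \<le> snd p \<or> snd q \<le> snd r"
proof -
  obtain i where i: "Suc i < length ps" "ps ! i = p" "ps ! Suc i = q"
    using assms(2) by (auto simp: consecutive_iff_nth)
  obtain j where j: "j < length ps" "ps ! j = r"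
    using assms(3) by (auto simp: in_set_conv_nth)
  have "\<not> (i < j \<and> j < Suc i)" by simp
  then show ?thesis
    using value_sorted_less_iff[OF assms(1), of i j] value_sorted_less_iff[OF assms(1), of j "Suc i"]
      i j by auto
qed

lemma consecutiveI_no_between:
  assumes "value_sorted ps" "p \<in> set ps" "q \<in> set ps" "snd p < snd q"
    and nb: "\<And>r. r \<in> set ps \<Longrightarrow> \<not> (snd p < snd r \<and> snd r < snd q)"
  shows "(p, q) \<in> consecutive ps"
proof -
  obtain i where i: "i < length ps" "ps ! i = p"
    using assms(2) by (auto simp: in_set_conv_nth)
  obtain j where j: "j < length ps" "ps ! j = q"
    using assms(3) by (auto simp: in_set_conv_nth)
  have "i < j"
    using value_sorted_less_iff[OF assms(1), of i j] i j assms(4) by auto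
  moreover have "\<not> Suc i < j"
    using nb[of "ps ! Suc i"] value_sorted_less_iff[OF assms(1), of i "Suc i"]
      value_sorted_less_iff[OF assms(1), of "Suc i" j] i j by auto
  ultimately have "j = Suc i" by simp
  then show ?thesis
    using i j by (auto simp: consecutive_iff_nth)
qed

lemma consecutive_cover:
  fixes ps :: "('a \<times> real) list"
  assumes "ps \<noteq> []" "snd (hd ps) \<le> t" "t < snd (last ps)"
  shows "\<exists>(p, q) \<in> consecutive ps. snd p \<le> t \<and> t < snd q"
  using assms
proof (induction ps rule: list_induct_pairs)
  case (Cons2 p q ps)
  show ?case
  proof (cases "t < snd q")
    case False
    then have "\<exists>(p, q) \<in> consecutive (q # ps). snd p \<le> t \<and> t < snd q"
      using Cons2 by (intro Cons2.IH) (auto split: if_splits)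
    then show ?thesis by auto
  qed (use Cons2.prems in auto)
qed auto

lemma consecutive_cover':
  fixes ps :: "('a \<times> real) list"
  assumes "ps \<noteq> []" "snd (hd ps) < t" "t \<le> snd (last ps)"
  shows "\<exists>(p, q) \<in> consecutive ps. snd p < t \<and> t \<le> snd q"
  using assms
proof (induction ps rule: list_induct_pairs)
  case (Cons2 p q ps)
  show ?case
  proof (cases "t \<le> snd q")
    case False
    then have "\<exists>(p, q) \<in> consecutive (q # ps). snd p < t \<and> t \<le> snd q"
      using Cons2 by (intro Cons2.IH) (auto split: if_splits)
    then show ?thesis by auto
  qed (use Cons2.prems in auto)
qed auto

lemma last_refine [simp]: "last (refine d \<nu> ps) = last ps"
  by (induction d \<nu> ps rule: refine.induct) auto

section \<open>Order topologies and making room for intervals\<close>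

lemma topspace_order_topology_on [simp]: "topspace (order_topology_on S lt) = S"
  by (auto simp: order_topology_on_def)

lemma homeomorphic_map_order_topology_on:
  fixes f :: "'a \<Rightarrow> real"
  assumes bij: "bij_betw f S {0..1}"
    and iso: "\<And>x y. \<lbrakk>x \<in> S; y \<in> S\<rbrakk> \<Longrightarrow> lt x y \<longleftrightarrow> f x < f y"
  shows "homeomorphic_map (order_topology_on S lt) (top_of_set {0..1}) f"
proof -
  let ?X = "order_topology_on S lt"
  define g where "g = inv_into S f"
  have fS: "f x \<in> {0..1}" if "x \<in> S" for x
    using bij that by (auto simp: bij_betw_def)
  have gf: "g (f x) = x" if "x \<in> S" for x
    using bij that by (simp add: bij_betw_def g_def)
  have fg: "f (g t) = t" and gS: "g t \<in> S" if "t \<in> {0..1}" for t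
    using bij that by (auto simp: bij_betw_def g_def f_inv_into_f intro: inv_into_into)
  have S_open: "openin ?X S"
    by (simp add: order_topology_on_def topology_generated_by_Basis)
  have less_open: "openin ?X {x \<in> S. lt x a}" if "a \<in> S" for a
    unfolding order_topology_on_def by (rule topology_generated_by_Basis) (use that in auto)
  have greater_open: "openin ?X {x \<in> S. lt a x}" if "a \<in> S" for a
    unfolding order_topology_on_def by (rule topology_generated_by_Basis) (use that in auto)
  have "openin ?X {x \<in> S. c < f x}" for c
  proof -
    consider "c < 0" | "c \<in> {0..1}" | "c > 1" by fastforce
    then show ?thesis
    proof cases
      case 1
      then have "{x \<in> S. c < f x} = S" using fS by fastforce
      then show ?thesis using S_open by simp
    next
      case 2
      then have "{x \<in> S. c < f x} = {x \<in> S. lt (g c) x}" using fg gS iso by auto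
      then show ?thesis using greater_open gS 2 by simp
    next
      case 3
      then have "{x \<in> S. c < f x} = {}" using fS by fastforce
      then show ?thesis by (simp only: openin_empty)
    qed
  qed
  moreover have "openin ?X {x \<in> S. f x < c}" for c
  proof -
    consider "c < 0" | "c \<in> {0..1}" | "c > 1" by fastforce
    then show ?thesis
    proof cases
      case 3
      then have "{x \<in> S. f x < c} = S" using fS by fastforce
      then show ?thesis using S_open by simp
    next
      case 2
      then have "{x \<in> S. f x < c} = {x \<in> S. lt x (g c)}" using fg gS iso by auto
      then show ?thesis using less_open gS 2 by simp
    next
      case 1
      then have "{x \<in> S. f x < c} = {}" using fS by fastforce
      then show ?thesis by (simp only: openin_empty)
    qed
  qed
  ultimately have cont_f: "continuous_map ?X (top_of_set {0..1}) f"
    using fS by (auto simp: continuous_map_upper_lower_semicontinuous_lt_gen)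
  have cont_g: "continuous_map (top_of_set {0..1}) ?X g"
    unfolding order_topology_on_def
  proof (rule continuous_on_generated_topo)
    fix U
    assume "U \<in> {S} \<union> {{x \<in> S. lt x a} |a. a \<in> S} \<union> {{x \<in> S. lt a x} |a. a \<in> S}"
    then consider "U = S" | a where "a \<in> S" "U = {x \<in> S. lt x a}"
      | a where "a \<in> S" "U = {x \<in> S. lt a x}" by auto
    then show "openin (top_of_set {0..1}) (g -` U \<inter> topspace (top_of_set {0..1}))"
    proof cases
      case 1
      then have "g -` U \<inter> topspace (top_of_set {0..1}) = {0..1}" using gS by auto
      then show ?thesis by (metis openin_topspace topspace_euclidean_subtopology)
    next
      case 2
      then have "g -` U \<inter> topspace (top_of_set {0..1}) = {0..1} \<inter> {..<f a}"
        using gS fg iso by auto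
      then show ?thesis by (simp add: openin_open_Int)
    next
      case 3
      then have "g -` U \<inter> topspace (top_of_set {0..1}) = {0..1} \<inter> {f a<..}"
        using gS fg iso by auto
      then show ?thesis by (simp add: openin_open_Int)
    qed
  qed (use gS in auto)
  have "homeomorphic_maps ?X (top_of_set {0..1}) f g"
    unfolding homeomorphic_maps_def using cont_f cont_g gf fg by simp
  then show ?thesis
    by (rule homeomorphic_maps_imp_map)
qed

text \<open>A variant of the usual limit argument in which only small increments are at hand.\<close>

lemma le_of_le_add_pos:
  fixes x y :: real
  assumes "0 < e" "\<And>\<delta>. \<lbrakk>0 < \<delta>; \<delta> < e\<rbrakk> \<Longrightarrow> x \<le> y + \<delta>"
  shows "x \<le> y"
proof (rule field_le_epsilon)
  fix \<epsilon> :: real assume "0 < \<epsilon>"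
  then have "x \<le> y + min (\<epsilon>/2) (e/2)" using assms(1) by (intro assms(2)) auto
  then show "x \<le> y + \<epsilon>" using \<open>0 < \<epsilon>\<close> by linarith
qed

text \<open>The function \<open>t + infsum len {a \<in> M. \<phi> a < t}\<close> is increasing and continuous from the left,
  and its limit from the right at \<open>t\<close> is obtained by admitting equality in the index set.  So the
  supremum of the \<open>t\<close> at which it does not exceed \<open>T\<close> is the point sought.  Infinite sums are
  reached through their finite partial sums, for which a small change of \<open>t\<close> changes nothing.\<close>

lemma shifted_value_exists:
  fixes len \<phi> :: "'a \<Rightarrow> real"
  assumes nonneg: "\<And>a. a \<in> M \<Longrightarrow> 0 \<le> len a" and summable: "len summable_on M"
    and range: "\<And>a. a \<in> M \<Longrightarrow> \<phi> a \<in> {0..1}"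
    and T: "0 \<le> T" "T \<le> 1 + infsum len M"
  shows "\<exists>t \<in> {0..1}. t + infsum len {a \<in> M. \<phi> a < t} \<le> T \<and>
                      T \<le> t + infsum len {a \<in> M. \<phi> a \<le> t}"
proof -
  have summ: "len summable_on A" if "A \<subseteq> M" for A
    using summable that by (rule summable_on_subset_banach)
  have mono: "infsum len A \<le> infsum len B" if "A \<subseteq> B" "B \<subseteq> M" for A B
    using that nonneg by (intro infsum_mono2 summ) auto
  have fin: "sum len F \<le> infsum len A" if "finite F" "F \<subseteq> A" "A \<subseteq> M" for F A
    using mono[of F A] that by simp
  define G where "G t = t + infsum len {a \<in> M. \<phi> a < t}" for t
  define X where "X = {t \<in> {0..1}. G t \<le> T}"
  have "{a \<in> M. \<phi> a < 0} = {}" using range by fastforce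
  then have G0: "G 0 = 0" unfolding G_def by (simp only: infsum_empty add_0)
  have "0 \<in> X" using G0 T by (simp add: X_def)
  define t0 where "t0 = Sup X"
  have bdd: "bdd_above X" by (auto simp: X_def)
  have X01: "0 \<le> t \<and> t \<le> 1" if "t \<in> X" for t
    using that by (simp add: X_def)
  have "X \<noteq> {}" using \<open>0 \<in> X\<close> by blast
  then have "t0 \<le> 1" unfolding t0_def using X01 by (meson cSup_least)
  moreover have "0 \<le> t0" unfolding t0_def by (rule cSup_upper[OF \<open>0 \<in> X\<close> bdd])
  ultimately have t0: "t0 \<in> {0..1}" by simp
  have Gmono: "G s \<le> G t" if "s \<le> t" for s t
    unfolding G_def using that by (intro add_mono mono) auto
  have below: "G t \<le> T" if "t < t0" for t
  proof -
    have "t < Sup X" using that by (simp only: t0_def)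
    then obtain s where "s \<in> X" "t < s"
      using less_cSup_iff[OF \<open>X \<noteq> {}\<close> bdd, of t] by auto
    then show ?thesis using Gmono[of t s] by (auto simp: X_def)
  qed
  have above: "T < G t" if "t0 < t" "t \<le> 1" for t
  proof (rule ccontr)
    assume "\<not> T < G t"
    then have "t \<in> X" using that t0 by (auto simp: X_def)
    then have "t \<le> t0" unfolding t0_def by (rule cSup_upper[OF _ bdd])
    then show False using that by simp
  qed
  have "infsum len {a \<in> M. \<phi> a < t0} \<le> T - t0"
  proof (rule infsum_le_finite_sums)
    fix F assume F: "finite F" "F \<subseteq> {a \<in> M. \<phi> a < t0}"
    define e where "e = Min (insert 1 ((\<lambda>a. t0 - \<phi> a) ` F))"
    have e: "0 < e" "\<And>a. a \<in> F \<Longrightarrow> e \<le> t0 - \<phi> a"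
      using F by (auto simp: e_def)
    show "sum len F \<le> T - t0"
    proof (rule le_of_le_add_pos[OF e(1)])
      fix \<delta> assume \<delta>: "0 < \<delta>" "\<delta> < e"
      have "F \<subseteq> {a \<in> M. \<phi> a < t0 - \<delta>}" using F e(2) \<delta> by fastforce
      then have "sum len F \<le> infsum len {a \<in> M. \<phi> a < t0 - \<delta>}" using F by (intro fin) auto
      also have "\<dots> \<le> T - (t0 - \<delta>)" using below[of "t0 - \<delta>"] \<delta> by (simp add: G_def)
      finally show "sum len F \<le> T - t0 + \<delta>" by simp
    qed
  qed (auto intro: summ)
  moreover have "T \<le> t0 + infsum len {a \<in> M. \<phi> a \<le> t0}"
  proof -
    have split: "infsum len M = infsum len {a \<in> M. P a} + infsum len {a \<in> M. \<not> P a}" for P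
    proof -
      have "infsum len ({a \<in> M. P a} \<union> {a \<in> M. \<not> P a}) =
          infsum len {a \<in> M. P a} + infsum len {a \<in> M. \<not> P a}"
        by (rule infsum_Un_disjoint) (auto intro: summ)
      moreover have "{a \<in> M. P a} \<union> {a \<in> M. \<not> P a} = M" by blast
      ultimately show ?thesis by (simp only:)
    qed
    have "infsum len {a \<in> M. \<not> \<phi> a \<le> t0} \<le> t0 + infsum len M - T"
    proof (cases "t0 = 1")
      case True
      then have "{a \<in> M. \<not> \<phi> a \<le> t0} = {}" using range by fastforce
      then have "infsum len {a \<in> M. \<not> \<phi> a \<le> t0} = 0" by (simp only: infsum_empty)
      then show ?thesis using True T by simp
    next
      case False
      show ?thesis
      proof (rule infsum_le_finite_sums)
        fix F assume F: "finite F" "F \<subseteq> {a \<in> M. \<not> \<phi> a \<le> t0}"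
        define e where "e = Min (insert (1 - t0) ((\<lambda>a. \<phi> a - t0) ` F))"
        have e: "0 < e" "e \<le> 1 - t0" "\<And>a. a \<in> F \<Longrightarrow> e \<le> \<phi> a - t0"
          using F False t0 by (auto simp: e_def)
        show "sum len F \<le> t0 + infsum len M - T"
        proof (rule le_of_le_add_pos[OF e(1)])
          fix \<delta> assume \<delta>: "0 < \<delta>" "\<delta> < e"
          have "F \<subseteq> {a \<in> M. \<not> \<phi> a < t0 + \<delta>}" using F e(3) \<delta> by fastforce
          then have "sum len F \<le> infsum len {a \<in> M. \<not> \<phi> a < t0 + \<delta>}" using F by (intro fin) auto
          also have "\<dots> = infsum len M - infsum len {a \<in> M. \<phi> a < t0 + \<delta>}"
            using split[of "\<lambda>a. \<phi> a < t0 + \<delta>"] by simp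
          also have "\<dots> \<le> infsum len M - (T - (t0 + \<delta>))"
            using above[of "t0 + \<delta>"] \<delta> e(2) by (simp add: G_def)
          finally show "sum len F \<le> t0 + infsum len M - T + \<delta>" by simp
        qed
      qed (auto intro: summ)
    qed
    then show ?thesis using split[of "\<lambda>a. \<phi> a \<le> t0"] by simp
  qed
  ultimately show ?thesis
    using t0 by (intro bexI[of _ t0]) auto
qed

section \<open>The critical value is an endpoint\<close>

text \<open>The arm at \<open>y\<close> in the direction of \<open>x\<close> is followed by shifting both.  Whenever the current
  symbols differ, the critical point separates the two, and the far end of the arm may be cut off
  there; after the shift it is the critical value.  The times at which this happens are the hits.
  They encode the precritical points that separate \<open>y\<close> from \<open>x\<close>.\<close>

primrec arm :: "itin \<Rightarrow> itin \<Rightarrow> itin \<Rightarrow> nat \<Rightarrow> itin" where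
  "arm \<nu> y x 0 = x"
| "arm \<nu> y x (Suc n) = (if differ (arm \<nu> y x n 0) (y n) then \<nu> else suffix 1 (arm \<nu> y x n))"

definition hits :: "itin \<Rightarrow> itin \<Rightarrow> itin \<Rightarrow> nat set" where
  "hits \<nu> y x = {n. differ (arm \<nu> y x n 0) (y n)}"

lemma arm_add: "arm \<nu> y x (m + n) = arm \<nu> (suffix m y) (arm \<nu> y x m) n"
  by (induction n) (simp_all add: suffix_def)

lemma hits_add: "m + n \<in> hits \<nu> y x \<longleftrightarrow> n \<in> hits \<nu> (suffix m y) (arm \<nu> y x m)"
  by (simp add: hits_def arm_add)

text \<open>A hit resets the arm, so two arms with one common hit have all later hits in common.\<close>

lemma arm_eq_after_common_hit:
  assumes "k \<in> hits \<nu> y x" "k \<in> hits \<nu> y z"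
  shows "arm \<nu> y x (Suc (k + n)) = arm \<nu> y z (Suc (k + n))"
  using assms by (induction n) (auto simp: hits_def)

lemma arm_no_hits:
  assumes "\<And>i. i < n \<Longrightarrow> m + i \<notin> hits \<nu> y x"
  shows "arm \<nu> y x (m + n) = suffix n (arm \<nu> y x m)"
  using assms
proof (induction n)
  case (Suc n)
  have "\<not> differ (arm \<nu> y x (m + n) 0) (y (m + n))"
    using Suc.prems[of n] by (simp add: hits_def)
  then have "arm \<nu> y x (m + Suc n) = suffix 1 (arm \<nu> y x (m + n))"
    by (simp only: arm.simps add_Suc_right if_False)
  also have "arm \<nu> y x (m + n) = suffix n (arm \<nu> y x m)"
    by (rule Suc.IH) (rule Suc.prems, simp)
  finally show ?case by (simp only: suffix_suffix Suc_eq_plus1)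
qed simp

text \<open>Two points lie in the same direction from \<open>y\<close> if the paths from \<open>y\<close> to them leave \<open>y\<close> together.\<close>

definition same_arm :: "itin \<Rightarrow> itin \<Rightarrow> itin \<Rightarrow> itin \<Rightarrow> bool" where
  "same_arm \<nu> y x z \<longleftrightarrow> hits \<nu> y x \<inter> hits \<nu> y z \<noteq> {}"

definition strictly_between :: "itin \<Rightarrow> itin \<Rightarrow> itin \<Rightarrow> itin \<Rightarrow> bool" where
  "strictly_between \<nu> y x z \<longleftrightarrow> x \<noteq> y \<and> z \<noteq> y \<and> \<not> same_arm \<nu> y x z"

lemma same_arm_commute: "same_arm \<nu> y x z \<longleftrightarrow> same_arm \<nu> y z x"
  by (auto simp: same_arm_def)

locale nonperiodic_word =
  fixes \<nu> :: itin
  assumes no_Star: "\<nu> i \<noteq> Star"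
    and nonperiodic: "0 < k \<Longrightarrow> suffix k \<nu> \<noteq> \<nu>"
begin

abbreviation c :: "nat \<Rightarrow> itin" where "c n \<equiv> suffix n \<nu>"

lemma arm_c: "\<exists>j. arm \<nu> y (c i) n = c j"
proof (induction n)
  case (Suc n)
  then obtain j where "arm \<nu> y (c i) n = c j" by blast
  then have "arm \<nu> y (c i) (Suc n) = c 0 \<or> arm \<nu> y (c i) (Suc n) = c (Suc j)"
    by (simp add: suffix_def)
  then show ?case by blast
qed auto

text \<open>An arm never catches up with its base point: at a hit it becomes \<open>\<nu>\<close>, while the base point has
  moved to a later point of the orbit, which is not \<open>\<nu>\<close> because \<open>\<nu>\<close> is not periodic.  This is what
  makes the set of hits infinite below.\<close>

lemma arm_ne:
  assumes "x \<noteq> c n" "\<And>i. x i \<noteq> Star"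
  shows "arm \<nu> (c n) x m \<noteq> c (n + m) \<and> (\<forall>i. arm \<nu> (c n) x m i \<noteq> Star)"
proof (induction m)
  case 0
  show ?case unfolding arm.simps add_0_right using assms by blast
next
  case (Suc m)
  define a where "a = arm \<nu> (c n) x m"
  have step: "arm \<nu> (c n) x (Suc m) = (if differ (a 0) (\<nu> (n + m)) then \<nu> else suffix 1 a)"
    by (simp only: a_def arm.simps suffix_nth)
  have ne: "a \<noteq> c (n + m)" and a_no_Star: "\<And>i. a i \<noteq> Star"
    using Suc unfolding a_def by blast+
  obtain i where i: "a i \<noteq> \<nu> (n + m + i)"
    using ne by (auto simp only: fun_eq_iff suffix_nth)
  show ?case
  proof (cases "differ (a 0) (\<nu> (n + m))")
    case True
    have "c (n + Suc m) \<noteq> \<nu>" by (rule nonperiodic) simp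
    then show ?thesis unfolding step if_P[OF True] using no_Star by metis
  next
    case False
    then have "a 0 = \<nu> (n + m)"
      using a_no_Star no_Star unfolding differ_def by blast
    then obtain i' where i': "i = Suc i'" using i by (cases i) auto
    have "suffix 1 a i' \<noteq> c (n + Suc m) i'" using i unfolding i' by simp
    then have "suffix 1 a \<noteq> c (n + Suc m)" by (rule contrapos_nn) (rule fun_cong)
    then show ?thesis using False a_no_Star unfolding step by (simp add: suffix_def)
  qed
qed

lemma hit_exists:
  assumes "x \<noteq> c n" "\<And>i. x i \<noteq> Star"
  shows "\<exists>k\<ge>m. k \<in> hits \<nu> (c n) x"
proof (rule ccontr)
  assume "\<not> ?thesis"
  then have no: "m + i \<notin> hits \<nu> (c n) x" for i by (meson le_add1)
  have "arm \<nu> (c n) x m i = c (n + m) i" for i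
  proof -
    have "\<not> differ (arm \<nu> (c n) x (m + i) 0) (c n (m + i))"
      using no[of i] by (simp add: hits_def)
    moreover have "arm \<nu> (c n) x (m + i) 0 = arm \<nu> (c n) x m i"
      using arm_no_hits[of i m \<nu> "c n" x] no by simp
    ultimately show ?thesis
      using arm_ne[OF assms, of m] no_Star by (auto simp: differ_def add_ac)
  qed
  then show False
    using arm_ne[OF assms, of m] by auto
qed

lemma same_arm_refl: "\<lbrakk>x \<noteq> c n; \<And>i. x i \<noteq> Star\<rbrakk> \<Longrightarrow> same_arm \<nu> (c n) x x"
  using hit_exists[of x n 0] by (auto simp: same_arm_def)

lemma same_arm_trans:
  assumes "same_arm \<nu> (c n) x y" "same_arm \<nu> (c n) y z" "\<And>i. x i \<noteq> Star"
  shows "same_arm \<nu> (c n) x z"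
proof -
  obtain k l where k: "k \<in> hits \<nu> (c n) x" "k \<in> hits \<nu> (c n) y"
    and l: "l \<in> hits \<nu> (c n) y" "l \<in> hits \<nu> (c n) z"
    using assms(1,2) by (auto simp: same_arm_def)
  let ?m = "Suc (max k l)"
  have "x \<noteq> c n"
  proof
    assume "x = c n"
    moreover have "arm \<nu> (c n) (c n) m = c (n + m)" for m by (induction m) auto
    ultimately show False using k(1) by (simp add: hits_def)
  qed
  then obtain h where h: "h \<ge> ?m" "h \<in> hits \<nu> (c n) x"
    using hit_exists[of x n ?m] assms(3) by blast
  have "arm \<nu> (c n) x h = arm \<nu> (c n) y h"
    using arm_eq_after_common_hit[OF k, of "h - Suc k"] h(1) by simp
  moreover have "arm \<nu> (c n) y h = arm \<nu> (c n) z h"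
    using arm_eq_after_common_hit[OF l, of "h - Suc l"] h(1) by simp
  ultimately have "h \<in> hits \<nu> (c n) z"
    using h(2) by (simp add: hits_def)
  then show ?thesis using h(2) by (auto simp: same_arm_def)
qed

text \<open>The first index at which \<open>c i\<close> and \<open>c j\<close> differ is a hit of \<open>c i\<close> seen from \<open>c j\<close>.  If \<open>r\<close> lies in
  another direction from \<open>c i\<close> than \<open>c j\<close>, then the arm of \<open>r\<close> agrees with \<open>c i\<close> at this index and has
  the same hit.\<close>

lemma separates_imp_same_arm:
  assumes "\<not> same_arm \<nu> (c i) r (c j)" "c i \<noteq> c j" "\<And>i. r i \<noteq> Star"
  shows "same_arm \<nu> (c j) r (c i)"
proof -
  define n where "n = (LEAST n. c i n \<noteq> c j n)"
  have ex: "\<exists>n. c i n \<noteq> c j n" using assms(2) by auto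
  have n: "c i n \<noteq> c j n" "\<And>m. m < n \<Longrightarrow> c i m = c j m"
    using LeastI_ex[OF ex] not_less_Least unfolding n_def by blast+
  have nh: "m \<notin> hits \<nu> (c j) (c i)" "m \<notin> hits \<nu> (c i) (c j)" if "m < n" for m
  proof -
    have "arm \<nu> (c j) (c i) m = suffix m (c i)" "arm \<nu> (c i) (c j) m = suffix m (c j)"
      if "m \<le> n" for m using that
      by (induction m) (use n(2) in \<open>auto simp: differ_def\<close>)
    then show "m \<notin> hits \<nu> (c j) (c i)" "m \<notin> hits \<nu> (c i) (c j)"
      using n(2) that by (auto simp: hits_def)
  qed
  have hit: "n \<in> hits \<nu> (c j) (c i)" "n \<in> hits \<nu> (c i) (c j)"
    using n(1) nh arm_no_hits[of n 0 \<nu> "c j" "c i"] arm_no_hits[of n 0 \<nu> "c i" "c j"] no_Star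
    by (auto simp: hits_def differ_def)
  have "arm \<nu> (c i) r m = arm \<nu> (c j) r m" if "m \<le> n" for m
    using that n(2) by (induction m) auto
  moreover have "n \<notin> hits \<nu> (c i) r"
    using assms(1) hit(2) by (auto simp: same_arm_def)
  ultimately have "\<not> differ (arm \<nu> (c j) r n 0) (c i n)"
    by (simp add: hits_def)
  moreover have "arm \<nu> (c j) r n m \<noteq> Star" for m
    by (induction n arbitrary: m) (use assms(3) no_Star in auto)
  ultimately have "n \<in> hits \<nu> (c j) r"
    using n(1) no_Star by (auto simp: hits_def differ_def)
  then show ?thesis using hit(1) by (auto simp: same_arm_def)
qed

text \<open>Seen from the root \<open>\<nu>\<close>, being strictly between is a strict order, as in a tree: if \<open>c j\<close> is
  between the root and \<open>c k\<close>, then everything between the root and \<open>c j\<close> has \<open>c k\<close> on the same side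
  as \<open>c j\<close>.\<close>

lemma strictly_between_trans:
  assumes "strictly_between \<nu> (c i) \<nu> (c j)" "strictly_between \<nu> (c j) \<nu> (c k)"
  shows "strictly_between \<nu> (c i) \<nu> (c k)"
proof -
  have ne: "\<nu> \<noteq> c i" "c j \<noteq> c i" "\<nu> \<noteq> c j" "c k \<noteq> c j"
    and sep: "\<not> same_arm \<nu> (c i) \<nu> (c j)" "\<not> same_arm \<nu> (c j) \<nu> (c k)"
    using assms by (auto simp: strictly_between_def)
  have "same_arm \<nu> (c j) \<nu> (c i)"
    using separates_imp_same_arm[OF sep(1)] ne(2) no_Star by auto
  then have "\<not> same_arm \<nu> (c j) (c k) (c i)"
    using sep(2) same_arm_trans[of j \<nu> "c i" "c k"] no_Star by (auto simp: same_arm_commute)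
  then have "same_arm \<nu> (c i) (c k) (c j)"
    using separates_imp_same_arm[of j "c k" i] ne(2) no_Star by auto
  moreover have "c k \<noteq> c i"
    using \<open>\<not> same_arm \<nu> (c j) (c k) (c i)\<close> same_arm_refl[of "c i" j] ne(2) no_Star by auto
  ultimately show ?thesis
    using ne sep(1) same_arm_trans[of i \<nu> "c k" "c j"] no_Star
    by (auto simp: strictly_between_def)
qed

text \<open>Lying in the same direction is transitive, so the root cannot lie in the same direction as each of
  two points that lie in different directions.\<close>

lemma strictly_between_root:
  assumes "strictly_between \<nu> (c n) (c i) (c j)" "0 < n"
  shows "strictly_between \<nu> (c n) \<nu> (c i) \<or> strictly_between \<nu> (c n) \<nu> (c j)"
  using assms nonperiodic[of n] same_arm_trans[of n "c i" \<nu> "c j"] no_Star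
  by (auto simp: strictly_between_def same_arm_commute)

lemma strictly_between_step:
  assumes "strictly_between \<nu> (c n) (c i) (c j)"
  shows "\<exists>i' j'. strictly_between \<nu> (c (n + m)) (c i') (c j') \<and>
           arm \<nu> (c n) (c i) m = c i' \<and> arm \<nu> (c n) (c j) m = c j'"
proof -
  obtain i' j' where a: "arm \<nu> (c n) (c i) m = c i'" "arm \<nu> (c n) (c j) m = c j'"
    using arm_c by blast
  have "c i' \<noteq> c (n + m)" "c j' \<noteq> c (n + m)"
    using assms arm_ne[of "c i" n m] arm_ne[of "c j" n m] a no_Star by (auto simp: strictly_between_def)
  moreover have "\<not> same_arm \<nu> (c (n + m)) (c i') (c j')"
    using assms hits_add[of m _ \<nu> "c n" "c i"] hits_add[of m _ \<nu> "c n" "c j"] a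
    by (auto simp: strictly_between_def same_arm_def)
  ultimately show ?thesis using a by (auto simp: strictly_between_def)
qed

text \<open>Suppose that \<open>\<nu>\<close> is strictly between \<open>c i\<close> and \<open>c j\<close>.  Shifting, every \<open>c n\<close> is strictly between
  two points of the orbit, and once both arms have had a hit at a time before \<open>N\<close>, these two points
  have indices smaller than \<open>n\<close>.  So every \<open>c n\<close> other than the root lies strictly between the root
  and some \<open>c m\<close>, and if \<open>m > N\<close>, then \<open>m\<close> can be lowered.  This yields a strict order on the
  finite set of the \<open>c m\<close> with \<open>1 \<le> m \<le> N\<close> without a maximal element.\<close>

theorem critical_value_endpoint: "\<not> strictly_between \<nu> \<nu> (c i) (c j)"
proof
  assume bet: "strictly_between \<nu> \<nu> (c i) (c j)"
  have small: "\<exists>i'<m. arm \<nu> \<nu> (c i) m = c i'" if "k < m" "k \<in> hits \<nu> \<nu> (c i)" for i k m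
    using that(1)
  proof (induction m)
    case (Suc m)
    show ?case
    proof (cases "k = m")
      case True
      then have "arm \<nu> \<nu> (c i) (Suc m) = c 0"
        using that(2) by (simp add: hits_def suffix_def)
      then show ?thesis using zero_less_Suc by blast
    next
      case False
      then have "k < m" using Suc.prems by simp
      then obtain i' where i': "i' < m" "arm \<nu> \<nu> (c i) m = c i'" using Suc.IH by blast
      then have "arm \<nu> \<nu> (c i) (Suc m) = c 0 \<or> arm \<nu> \<nu> (c i) (Suc m) = c (Suc i')"
        by (simp add: suffix_def)
      then show ?thesis using i'(1) by (meson Suc_mono zero_less_Suc)
    qed
  qed simp
  obtain k l where k: "k \<in> hits \<nu> \<nu> (c i)" and l: "l \<in> hits \<nu> \<nu> (c j)"
    using bet hit_exists[of "c i" 0 0] hit_exists[of "c j" 0 0] no_Star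
    by (auto simp: strictly_between_def)
  define N where "N = Suc (max k l)"
  have all: "\<exists>i' j'. strictly_between \<nu> (c n) (c i') (c j') \<and> (N \<le> n \<longrightarrow> i' < n \<and> j' < n)" for n
  proof -
    obtain i' j' where ij: "strictly_between \<nu> (c n) (c i') (c j')"
      "arm \<nu> \<nu> (c i) n = c i'" "arm \<nu> \<nu> (c j) n = c j'"
      using strictly_between_step[of 0 i j n] bet by auto
    show ?thesis
    proof (cases "N \<le> n")
      case True
      then have "k < n" "l < n" by (simp_all add: N_def)
      then obtain i'' j'' where "i'' < n" "arm \<nu> \<nu> (c i) n = c i''" "j'' < n" "arm \<nu> \<nu> (c j) n = c j''"
        using small[OF _ k] small[OF _ l] by metis
      then show ?thesis using ij by metis
    qed (use ij in auto)
  qed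
  have descend: "\<exists>m'\<le>N. strictly_between \<nu> (c n) \<nu> (c m')" if "strictly_between \<nu> (c n) \<nu> (c m)" for n m
    using that
  proof (induction m rule: less_induct)
    case (less m)
    show ?case
    proof (cases "m \<le> N")
      case False
      then obtain i' j' where "strictly_between \<nu> (c m) (c i') (c j')" "i' < m" "j' < m"
        using all[of m] by auto
      then obtain m' where "strictly_between \<nu> (c m) \<nu> (c m')" "m' < m"
        using strictly_between_root[of m i' j'] False by auto
      then show ?thesis using less strictly_between_trans by blast
    qed (use less in auto)
  qed
  have up: "\<exists>m'\<in>{1..N}. strictly_between \<nu> (c n) \<nu> (c m')" if "0 < n" for n
  proof -
    obtain i' j' where "strictly_between \<nu> (c n) (c i') (c j')" using all by blast
    then have "strictly_between \<nu> (c n) \<nu> (c i') \<or> strictly_between \<nu> (c n) \<nu> (c j')"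
      using \<open>0 < n\<close> by (rule strictly_between_root)
    then obtain m where "m \<le> N" "strictly_between \<nu> (c n) \<nu> (c m)" using descend by blast
    moreover have "m \<noteq> 0"
    proof
      assume "m = 0"
      then show False using \<open>strictly_between \<nu> (c n) \<nu> (c m)\<close> same_arm_refl[of \<nu> n] no_Star
        by (auto simp: strictly_between_def)
    qed
    ultimately show ?thesis by (auto intro!: bexI[of _ m])
  qed
  define R where "R = {(m', n). m' \<in> {1..N} \<and> n \<in> {1..N} \<and> strictly_between \<nu> (c n) \<nu> (c m')}"
  have "finite R" by (rule finite_subset[of _ "{1..N} \<times> {1..N}"]) (auto simp: R_def)
  moreover have "trans R" 
    unfolding R_def trans_def using strictly_between_trans by blast
  then have "acyclic R"
    by (auto simp: acyclic_def trancl_id R_def strictly_between_def)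
  ultimately have "wf R" by (rule finite_acyclic_wf)
  moreover have "1 \<in> {1..N}" by (simp add: N_def)
  ultimately obtain n where "n \<in> {1..N}" "\<And>m. (m, n) \<in> R \<Longrightarrow> m \<notin> {1..N}"
    by (metis wfE_min)
  moreover have "0 < n" using \<open>n \<in> {1..N}\<close> by simp
  then obtain m where "m \<in> {1..N}" "strictly_between \<nu> (c n) \<nu> (c m)" using up by blast
  ultimately show False unfolding R_def by blast
qed

end

lemma diffI:
  assumes "differ (a K) (b K)" "\<And>i. i < K \<Longrightarrow> \<not> differ (a i) (b i)"
  shows "diff a b = enat (Suc K)"
proof -
  have "(LEAST i. differ (a i) (b i)) = K"
    using assms by (intro Least_equality) (auto simp: not_less[symmetric])
  then show ?thesis using assms(1) by (auto simp: diff_def)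
qed

section \<open>Cells of the refinement\<close>

locale kneading_path =
  fixes d :: enat and \<nu> :: itin
  assumes kneading: "kneading_sequence d \<nu>"
begin

abbreviation crit :: itin where "crit \<equiv> critical_point \<nu>"
abbreviation ins :: "itin \<Rightarrow> itin \<Rightarrow> itin" where "ins \<equiv> inserted_point d \<nu>"

definition pre :: "symbol list \<Rightarrow> itin" where
  "pre w = w \<frown> crit"

lemma pre_nth:
  "i < length w \<Longrightarrow> pre w i = w ! i" "pre w (length w) = Star"
  "pre w (Suc (length w + i)) = \<nu> i"
  by (simp_all add: pre_def)

lemma pre_Nil: "pre [] = crit"
  by (simp add: pre_def)

lemma precritical_iff: "precritical d \<nu> x \<longleftrightarrow> (\<exists>w. set w \<subseteq> alphabet d \<and> x = pre w)"
  by (simp add: precritical_def pre_def)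

lemma \<nu>_0: "\<nu> 0 = Sym 1"
  using kneading by (simp add: kneading_sequence_def)

lemma kneading_cases:
  obtains (nonperiodic) "\<nu> \<in> full_seqs d" "\<And>k. 0 < k \<Longrightarrow> suffix k \<nu> \<noteq> \<nu>"
  | (star_periodic) u where "set u \<subseteq> alphabet d" "\<nu> = (u @ [Star])\<^sup>\<omega>"
  using kneading by (auto simp: kneading_sequence_def star_periodic_def)

lemma \<nu>_letter: "\<nu> i = Star \<or> \<nu> i \<in> alphabet d"
proof (cases rule: kneading_cases)
  case nonperiodic
  then show ?thesis by (auto simp: full_seqs_def)
next
  case (star_periodic u)
  have "(u @ [Star]) ! (i mod Suc (length u)) \<in> set (u @ [Star])"
    by (intro nth_mem) simp
  then show ?thesis using star_periodic by auto
qed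

text \<open>A star of a star-periodic sequence ends a period, and the other kneading sequences have no star.
  The bisection of cells relies on this common property only, so that the two kinds need not be
  distinguished there.\<close>

lemma star_restarts:
  assumes "\<nu> z = Star"
  shows "\<nu> (Suc (z + n)) = \<nu> n"
proof (cases rule: kneading_cases)
  case nonperiodic
  then show ?thesis using assms full_seqs_not_Star by blast
next
  case (star_periodic u)
  let ?p = "Suc (length u)"
  have "z mod ?p = length u"
  proof (rule ccontr)
    assume "z mod ?p \<noteq> length u"
    moreover have "z mod ?p < ?p" by simp
    ultimately have "z mod ?p < length u" by linarith
    then show False
      using assms star_periodic word_not_Star[of u d "z mod ?p"] by (simp add: nth_append)
  qed
  then have "Suc z mod ?p = 0" by (simp add: mod_Suc)
  then have "Suc (z + n) mod ?p = n mod ?p"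
    by (metis add.left_neutral add_Suc mod_add_left_eq)
  then show ?thesis using star_periodic by simp
qed

text \<open>The ends of a cell are precritical points whose first star occurs before the ends differ; only the
  end \<open>\<nu>\<close> of the whole path is exempt, since its first star may come late or not at all.\<close>

definition early :: "itin \<Rightarrow> enat \<Rightarrow> bool" where
  "early x D \<longleftrightarrow> x = \<nu> \<or> (\<exists>w. set w \<subseteq> alphabet d \<and> x = pre w \<and> enat (Suc (length w)) < D)"

lemma early_mono: "early x D \<Longrightarrow> D \<le> E \<Longrightarrow> early x E"
  unfolding early_def using order_less_le_trans by blast

lemma pre_letter:
  assumes "set w \<subseteq> alphabet d"
  shows "pre w i = Star \<or> pre w i \<in> alphabet d"
proof -
  consider "i < length w" | "i = length w" | j where "i = Suc (length w + j)"
    by (metis less_imp_Suc_add linorder_neqE_nat)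
  then show ?thesis
    by cases (use assms \<nu>_letter nth_mem in \<open>fastforce simp: pre_nth\<close>)+
qed

lemma early_letter: "early x D \<Longrightarrow> x i = Star \<or> x i \<in> alphabet d"
  using \<nu>_letter pre_letter by (auto simp: early_def)

text \<open>The conditions on early stars carry the induction over the levels: because the first stars come
  early, a common star of an old end and a newly inserted point would force a star of the old
  end where the two old ends differ.\<close>

definition cell_inv :: "itin \<Rightarrow> itin \<Rightarrow> bool" where
  "cell_inv a b \<longleftrightarrow> a \<noteq> b \<and> (\<forall>i. \<not> (a i = Star \<and> b i = Star)) \<and>
     early a (diff a b) \<and> early b (diff a b)"

lemma cell_inv_commute: "cell_inv a b \<longleftrightarrow> cell_inv b a"
  by (auto simp: cell_inv_def diff_commute)

lemma cell_inv_half: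
  assumes "early a (diff a b)" "diff a b = enat (Suc K)" "differ (a K) (b K)"
    and w: "set w \<subseteq> alphabet d" "length w = K" "\<And>i. i < K \<Longrightarrow> \<not> differ (w ! i) (a i)"
  shows "cell_inv a (pre w) \<and> diff a b < diff a (pre w)"
proof -
  have aK: "a K \<noteq> Star" using assms(3) by (auto simp: differ_def)
  have wK: "pre w K = Star" using pre_nth(2)[of w] w(2) by simp
  have gt: "diff a b < diff a (pre w)"
    unfolding assms(2) less_diff_iff using w wK
    by (auto simp: less_Suc_eq pre_nth differ_commute)
  have "early a (diff a (pre w))"
    using assms(1) gt by (meson early_mono less_imp_le)
  moreover have "early (pre w) (diff a (pre w))"
    using w gt assms(2) by (auto simp: early_def)
  moreover have "\<not> (a i = Star \<and> pre w i = Star)" for i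
  proof
    assume i: "a i = Star \<and> pre w i = Star"
    then have "\<not> i < K" using w word_not_Star[of w d i] by (auto simp: pre_nth)
    moreover have "i \<noteq> K" using i aK by auto
    ultimately obtain z where z: "i = Suc (K + z)"
      by (metis less_imp_Suc_add linorder_neqE_nat)
    then have "\<nu> z = Star" using i pre_nth(3)[of w z] w(2) by simp
    then have restart: "\<nu> (Suc (z + n)) = \<nu> n" for n by (rule star_restarts)
    show False
    proof (cases "a = \<nu>")
      case True
      then show False using restart[of K] i z aK by (simp add: add.commute)
    next
      case False
      then obtain v where v: "a = pre v" "length v < K"
        using assms(1,2) by (auto simp: early_def)
      then obtain m where m: "K = Suc (length v + m)" using less_imp_Suc_add by blast
      have "a K = \<nu> m" using v m pre_nth(3)[of v m] by simp
      moreover have "a i = \<nu> (Suc (z + m))"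
        using v m z pre_nth(3)[of v "Suc (z + m)"] by (simp add: add_ac)
      ultimately show False using restart[of m] i aK by simp
    qed
  qed
  moreover have "a \<noteq> pre w" using aK wK by auto
  ultimately show ?thesis using gt by (simp add: cell_inv_def)
qed

text \<open>The word before the star of an inserted point is determined letter by letter because its two
  neighbours have no star in common.\<close>

lemma inserted_pointE:
  assumes inv: "cell_inv a b" and K: "diff a b = enat (Suc K)"
  obtains w where "set w \<subseteq> alphabet d" "length w = K"
    "\<And>i. i < K \<Longrightarrow> \<not> differ (w ! i) (a i) \<and> \<not> differ (w ! i) (b i)"
    "ins a b = pre w"
    "cell_inv a (pre w)" "cell_inv (pre w) b" "diff a b < diff a (pre w)" "diff a b < diff (pre w) b"
    "differ (a K) (b K)"
proof -
  obtain K' where "diff a b = enat (Suc K')" "differ (a K') (b K')"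
    "\<And>i. i < K' \<Longrightarrow> \<not> differ (a i) (b i)"
    by (rule finite_diffE[of a b]) (use K in auto)
  then have differ: "differ (a K) (b K)" and nd: "\<And>i. i < K \<Longrightarrow> \<not> differ (a i) (b i)"
    using K by auto
  have letter: "a i = Star \<or> a i \<in> alphabet d" "b i = Star \<or> b i \<in> alphabet d"
    and nc: "\<not> (a i = Star \<and> b i = Star)" for i
    using inv early_letter unfolding cell_inv_def by blast+
  define w where "w = map (\<lambda>i. if a i = Star then b i else a i) [0..<K]"
  have w: "length w = K" "\<And>i. i < K \<Longrightarrow> w ! i = (if a i = Star then b i else a i)"
    by (simp_all add: w_def)
  have w_alph: "set w \<subseteq> alphabet d"
    using letter nc by (fastforce simp: w_def)
  have w_nd: "\<not> differ (w ! i) (a i) \<and> \<not> differ (w ! i) (b i)" if "i < K" for i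
    using that nd[of i] by (auto simp: w)
  have ins: "ins a b = pre w"
    unfolding inserted_point_def
  proof (rule the_equality)
    show "\<exists>w'. set w' \<subseteq> alphabet d \<and> enat (Suc (length w')) = diff a b \<and>
        (\<forall>i<length w'. \<not> differ (w' ! i) (a i) \<and> \<not> differ (w' ! i) (b i)) \<and>
        pre w = w' \<frown> crit"
      using w_alph w_nd w(1) K by (intro exI[of _ w]) (auto simp: pre_def)
  next
    fix x
    assume "\<exists>w'. set w' \<subseteq> alphabet d \<and> enat (Suc (length w')) = diff a b \<and>
        (\<forall>i<length w'. \<not> differ (w' ! i) (a i) \<and> \<not> differ (w' ! i) (b i)) \<and>
        x = w' \<frown> crit"
    then obtain w' where w': "set w' \<subseteq> alphabet d" "length w' = K" "x = pre w'"
      "\<And>i. i < K \<Longrightarrow> \<not> differ (w' ! i) (a i) \<and> \<not> differ (w' ! i) (b i)"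
      using K by (auto simp: pre_def)
    have "w' = w"
    proof (rule nth_equalityI)
      fix i assume "i < length w'"
      then show "w' ! i = w ! i"
        using w'(2) w'(4)[of i] w(2)[of i] nc[of i] word_not_Star[OF w'(1), of i]
        by (auto simp: differ_def)
    qed (use w' w in simp)
    then show "x = pre w" using w' by simp
  qed
  have inv': "early a (diff a b)" "early b (diff b a)"
    using inv by (simp_all add: cell_inv_def diff_commute)
  have "cell_inv a (pre w) \<and> diff a b < diff a (pre w)"
    by (rule cell_inv_half[OF inv'(1) K differ w_alph w(1)]) (use w_nd in blast)
  moreover have "cell_inv b (pre w) \<and> diff b a < diff b (pre w)"
    by (rule cell_inv_half[OF inv'(2) _ _ w_alph w(1)])
      (use w_nd K differ in \<open>auto simp: diff_commute differ_commute\<close>)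
  ultimately show thesis
    using that[of w] w_alph w(1) w_nd ins differ
    by (simp add: diff_commute cell_inv_commute)
qed

definition cell :: "nat \<Rightarrow> itin \<Rightarrow> real \<Rightarrow> itin \<Rightarrow> real \<Rightarrow> bool" where
  "cell n a \<alpha> b \<beta> \<longleftrightarrow> ((a, \<alpha>), (b, \<beta>)) \<in> consecutive (P_list d \<nu> n)"

lemma P_list_0: "P_list d \<nu> 0 = [(crit, 0), (\<nu>, 1)]"
  by (simp add: P_list_def)

lemma P_list_Suc: "P_list d \<nu> (Suc n) = refine d \<nu> (P_list d \<nu> n)"
  by (simp add: P_list_def)

lemma cell_0: "cell 0 a \<alpha> b \<beta> \<longleftrightarrow> a = crit \<and> \<alpha> = 0 \<and> b = \<nu> \<and> \<beta> = 1"
  by (auto simp: cell_def P_list_0)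

lemma cell_Suc:
  "cell (Suc n) a \<alpha> b \<beta> \<longleftrightarrow>
     (\<exists>a' \<alpha>' b' \<beta>'. cell n a' \<alpha>' b' \<beta>' \<and>
        (if diff a' b' = \<infinity> then a = a' \<and> \<alpha> = \<alpha>' \<and> b = b' \<and> \<beta> = \<beta>'
         else a = a' \<and> \<alpha> = \<alpha>' \<and> b = ins a' b' \<and> \<beta> = (\<alpha>' + \<beta>') / 2 \<or>
              a = ins a' b' \<and> \<alpha> = (\<alpha>' + \<beta>') / 2 \<and> b = b' \<and> \<beta> = \<beta>'))"
  (is "?L \<longleftrightarrow> ?R")
proof
  assume ?L
  then obtain p q where "(p, q) \<in> consecutive (P_list d \<nu> n)"
    "((a, \<alpha>), (b, \<beta>)) \<in> (if diff (fst p) (fst q) = \<infinity> then {(p, q)}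
        else {(p, inserted_entry d \<nu> p q), (inserted_entry d \<nu> p q, q)})"
    unfolding cell_def P_list_Suc consecutive_refine by blast
  then show ?R
    unfolding cell_def
    by (intro exI[of _ "fst p"] exI[of _ "snd p"] exI[of _ "fst q"] exI[of _ "snd q"])
      (auto simp: inserted_entry_def split: if_splits)
next
  assume ?R
  then obtain a' \<alpha>' b' \<beta>' where "((a', \<alpha>'), (b', \<beta>')) \<in> consecutive (P_list d \<nu> n)"
    and eq: "if diff a' b' = \<infinity> then a = a' \<and> \<alpha> = \<alpha>' \<and> b = b' \<and> \<beta> = \<beta>'
         else a = a' \<and> \<alpha> = \<alpha>' \<and> b = ins a' b' \<and> \<beta> = (\<alpha>' + \<beta>') / 2 \<or>
              a = ins a' b' \<and> \<alpha> = (\<alpha>' + \<beta>') / 2 \<and> b = b' \<and> \<beta> = \<beta>'"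
    unfolding cell_def by blast
  moreover have "((a, \<alpha>), (b, \<beta>)) \<in> (case ((a', \<alpha>'), (b', \<beta>')) of (p, q) \<Rightarrow>
      if diff (fst p) (fst q) = \<infinity> then {(p, q)}
        else {(p, inserted_entry d \<nu> p q), (inserted_entry d \<nu> p q, q)})"
    using eq by (auto simp: inserted_entry_def split: if_splits)
  ultimately show ?L
    unfolding cell_def P_list_Suc consecutive_refine by blast
qed

lemma cell_SucE:
  assumes "cell (Suc n) a \<alpha> b \<beta>"
  obtains (gap) "cell n a \<alpha> b \<beta>" "diff a b = \<infinity>"
  | (left) b' \<beta>' where "cell n a \<alpha> b' \<beta>'" "diff a b' \<noteq> \<infinity>" "b = ins a b'"
      "\<beta> = (\<alpha> + \<beta>') / 2"
  | (right) a' \<alpha>' where "cell n a' \<alpha>' b \<beta>" "diff a' b \<noteq> \<infinity>" "a = ins a' b"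
      "\<alpha> = (\<alpha>' + \<beta>) / 2"
  using assms unfolding cell_Suc by (metis (full_types))

lemma cell_Suc_gap: "cell n a \<alpha> b \<beta> \<Longrightarrow> diff a b = \<infinity> \<Longrightarrow> cell (Suc n) a \<alpha> b \<beta>"
  unfolding cell_Suc
  by (rule exI[of _ a], rule exI[of _ \<alpha>], rule exI[of _ b], rule exI[of _ \<beta>]) simp

lemma cell_Suc_split:
  assumes "cell n a \<alpha> b \<beta>" "diff a b \<noteq> \<infinity>"
  shows "cell (Suc n) a \<alpha> (ins a b) ((\<alpha> + \<beta>) / 2)"
    "cell (Suc n) (ins a b) ((\<alpha> + \<beta>) / 2) b \<beta>"
proof -
  have eq: "cell n a \<alpha> b \<beta>" "(diff a b = \<infinity>) = False" using assms by simp_all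
  show "cell (Suc n) a \<alpha> (ins a b) ((\<alpha> + \<beta>) / 2)"
    "cell (Suc n) (ins a b) ((\<alpha> + \<beta>) / 2) b \<beta>"
    unfolding cell_Suc
    by (rule exI[of _ a], rule exI[of _ \<alpha>], rule exI[of _ b], rule exI[of _ \<beta>], simp only: eq,
        simp)+
qed

lemma cell_inv: "cell n a \<alpha> b \<beta> \<Longrightarrow> cell_inv a b"
proof (induction n arbitrary: a \<alpha> b \<beta>)
  case 0
  have pre0: "a = pre []" "b = \<nu>" using 0 by (simp_all add: cell_0 pre_Nil)
  have "\<not> (a i = Star \<and> b i = Star)" for i
  proof (cases i)
    case 0
    then show ?thesis using pre0 \<nu>_0 by simp
  next
    case (Suc z)
    then show ?thesis
      using pre0 pre_nth(3)[of "[]" z] star_restarts[of z 0] \<nu>_0 by auto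
  qed
  moreover have "early b (diff a b)" using pre0 by (simp add: early_def)
  moreover have "enat (Suc 0) < diff a b"
    using pre0 pre_nth(2)[of "[]"] by (simp add: less_diff_iff)
  then have "early a (diff a b)"
    using pre0(1) unfolding early_def by (intro disjI2 exI[of _ "[]"]) simp
  moreover have "a \<noteq> b" using pre0 pre_nth(2)[of "[]"] \<nu>_0 by auto
  ultimately show ?case by (simp add: cell_inv_def)
next
  case (Suc n)
  from Suc.prems show ?case
  proof (cases rule: cell_SucE)
    case gap
    then show ?thesis using Suc.IH by blast
  next
    case (left b' \<beta>')
    obtain K where K: "diff a b' = enat (Suc K)" using finite_diffE[OF left(2)] .
    show ?thesis using inserted_pointE[OF Suc.IH[OF left(1)] K] left(3) by metis
  next
    case (right a' \<alpha>')
    obtain K where K: "diff a' b = enat (Suc K)" using finite_diffE[OF right(2)] .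
    show ?thesis using inserted_pointE[OF Suc.IH[OF right(1)] K] right(3) by metis
  qed
qed

lemma cell_midE:
  assumes "cell n a \<alpha> b \<beta>" "diff a b \<noteq> \<infinity>"
  obtains K w where "diff a b = enat (Suc K)" "set w \<subseteq> alphabet d" "length w = K"
    "\<And>i. i < K \<Longrightarrow> \<not> differ (w ! i) (a i) \<and> \<not> differ (w ! i) (b i)"
    "differ (a K) (b K)" "diff a b < diff a (pre w)" "diff a b < diff (pre w) b"
    "ins a b = pre w"
    "cell (Suc n) a \<alpha> (pre w) ((\<alpha> + \<beta>) / 2)" "cell (Suc n) (pre w) ((\<alpha> + \<beta>) / 2) b \<beta>"
proof -
  obtain K where K: "diff a b = enat (Suc K)" using finite_diffE[OF assms(2)] .
  obtain w where "set w \<subseteq> alphabet d" "length w = K"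
    "\<And>i. i < K \<Longrightarrow> \<not> differ (w ! i) (a i) \<and> \<not> differ (w ! i) (b i)"
    "ins a b = pre w"
    "diff a b < diff a (pre w)" "diff a b < diff (pre w) b" "differ (a K) (b K)"
    using inserted_pointE[OF cell_inv[OF assms(1)] K] by metis
  then show thesis
    using that[of K w] K cell_Suc_split[OF assms] by simp
qed

lemma cell_bounds: "cell n a \<alpha> b \<beta> \<Longrightarrow> 0 \<le> \<alpha> \<and> \<beta> \<le> 1 \<and> 1 / 2 ^ n \<le> \<beta> - \<alpha>"
proof (induction n arbitrary: a \<alpha> b \<beta>)
  case 0
  then show ?case by (simp add: cell_0)
next
  case (Suc n)
  define e where "e = 1 / (2::real) ^ n"
  have pos: "0 < e" and half: "1 / (2::real) ^ Suc n = e / 2" by (simp_all add: e_def)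
  from Suc.prems show ?case
  proof (cases rule: cell_SucE)
    case gap
    then show ?thesis unfolding half using Suc.IH[OF gap(1), folded e_def] pos
      by (auto simp: field_simps)
  next
    case (left b' \<beta>')
    then show ?thesis unfolding half using Suc.IH[OF left(1), folded e_def] left(4) pos
      by (auto simp: field_simps)
  next
    case (right a' \<alpha>')
    then show ?thesis unfolding half using Suc.IH[OF right(1), folded e_def] right(4) pos
      by (auto simp: field_simps)
  qed
qed

lemma cell_less: "cell n a \<alpha> b \<beta> \<Longrightarrow> \<alpha> < \<beta>"
  using cell_bounds[of n a \<alpha> b \<beta>] zero_less_power[of "2::real" n]
  by (smt (verit, best) divide_pos_pos)

text \<open>Every bisection halves the length and raises the index at which the ends differ.\<close>

lemma cell_not_gap:
  "cell n a \<alpha> b \<beta> \<Longrightarrow> diff a b \<noteq> \<infinity> \<Longrightarrow> \<beta> - \<alpha> = 1 / 2 ^ n \<and> enat n < diff a b"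
proof (induction n arbitrary: a \<alpha> b \<beta>)
  case 0
  then show ?case by (simp add: cell_0 less_diff_iff)
next
  case (Suc n)
  define e where "e = 1 / (2::real) ^ n"
  have half: "1 / (2::real) ^ Suc n = e / 2" by (simp add: e_def)
  have step: "enat (Suc n) < E" if "enat n < D" "D < E" for D E :: enat
    using that by (meson Suc_ile_eq order_le_less_trans)
  from Suc.prems(1) show ?case
  proof (cases rule: cell_SucE)
    case gap
    then show ?thesis using Suc.prems by simp
  next
    case (left b' \<beta>')
    obtain w where "diff a b' < diff a (pre w)" "ins a b' = pre w"
      using cell_midE[OF left(1,2)] by metis
    then have "enat (Suc n) < diff a b"
      using Suc.IH[OF left(1,2)] left(3) step[of "diff a b'" "diff a b"] by simp
    then show ?thesis unfolding half using Suc.IH[OF left(1,2), folded e_def] left(4)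
      by (auto simp: field_simps)
  next
    case (right a' \<alpha>')
    obtain w where "diff a' b < diff (pre w) b" "ins a' b = pre w"
      using cell_midE[OF right(1,2)] by metis
    then have "enat (Suc n) < diff a b"
      using Suc.IH[OF right(1,2)] right(3) step[of "diff a' b" "diff a b"] by simp
    then show ?thesis unfolding half using Suc.IH[OF right(1,2), folded e_def] right(4)
      by (auto simp: field_simps)
  qed
qed

section \<open>The points of \<open>P_inf\<close> and their order\<close>

abbreviation Q :: "nat \<Rightarrow> (itin \<times> real) set" where
  "Q n \<equiv> set (P_list d \<nu> n)"

lemma value_sorted_P_list: "value_sorted (P_list d \<nu> n)"
  by (induction n) (simp_all add: P_list_0 P_list_Suc value_sorted_refine)

lemma P_list_ends: "P_list d \<nu> n \<noteq> []" "hd (P_list d \<nu> n) = (crit, 0)"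
  "last (P_list d \<nu> n) = (\<nu>, 1)"
  by (induction n) (simp_all add: P_list_0 P_list_Suc)

lemma Q_mono: "m \<le> n \<Longrightarrow> Q m \<subseteq> Q n"
  by (rule lift_Suc_mono_le) (auto simp: P_list_Suc set_refine)

lemma Q_Suc:
  assumes "(x, s) \<in> Q (Suc n)"
  shows "(x, s) \<in> Q n \<or> (\<exists>a \<alpha> b \<beta>. cell n a \<alpha> b \<beta> \<and> diff a b \<noteq> \<infinity> \<and>
           x = ins a b \<and> s = (\<alpha> + \<beta>) / 2)"
proof (cases "(x, s) \<in> Q n")
  case False
  then obtain p q where "(p, q) \<in> consecutive (P_list d \<nu> n)" "diff (fst p) (fst q) \<noteq> \<infinity>"
    "(x, s) = inserted_entry d \<nu> p q"
    using assms by (auto simp: P_list_Suc set_refine split: if_splits)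
  then show ?thesis unfolding cell_def inserted_entry_def by (metis prod.collapse prod.inject)
qed simp

lemma cell_Q: "cell n a \<alpha> b \<beta> \<Longrightarrow> (a, \<alpha>) \<in> Q n \<and> (b, \<beta>) \<in> Q n"
  unfolding cell_def by (rule consecutive_set)

lemma cell_no_between: "cell n a \<alpha> b \<beta> \<Longrightarrow> (x, s) \<in> Q n \<Longrightarrow> s \<le> \<alpha> \<or> \<beta> \<le> s"
  using consecutive_no_between[OF value_sorted_P_list] unfolding cell_def by fastforce

lemma Q_unique: "(x, s) \<in> Q m \<Longrightarrow> (y, s) \<in> Q n \<Longrightarrow> x = y"
  using value_sorted_inj[OF value_sorted_P_list, of "(x, s)" "max m n" "(y, s)"]
    Q_mono[of m "max m n"] Q_mono[of n "max m n"] by auto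

text \<open>An inserted point copies the symbols of its neighbours up to their first difference,
  and everything
  inserted later next to it differs from it only beyond that index.\<close>

lemma cell_interior:
  assumes "cell n a \<alpha> b \<beta>" "(x, s) \<in> Q m" "\<alpha> < s" "s < \<beta>" "enat (Suc i) < diff a b"
  shows "x i \<noteq> Star \<and> \<not> differ (x i) (a i) \<and> \<not> differ (x i) (b i)"
proof -
  have "(x, s) \<in> Q (n + m)" using assms(2) Q_mono[of m "n + m"] by auto
  then show ?thesis
    using assms(1,3-5)
  proof (induction m arbitrary: n a \<alpha> b \<beta>)
    case 0
    then show ?case using cell_no_between[of n a \<alpha> b \<beta> x s] by auto
  next
    case (Suc m)
    show ?case
    proof (cases "diff a b = \<infinity>")
      case True
      then show ?thesis
        using Suc.IH[of "Suc n" a \<alpha> b \<beta>] Suc.prems cell_Suc_gap by simp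
    next
      case False
      obtain K w where K: "diff a b = enat (Suc K)" and w: "set w \<subseteq> alphabet d" "length w = K"
        and nd: "\<And>i. i < K \<Longrightarrow> \<not> differ (w ! i) (a i) \<and> \<not> differ (w ! i) (b i)"
        and gt: "diff a b < diff a (pre w)" "diff a b < diff (pre w) b"
        and cells: "cell (Suc n) a \<alpha> (pre w) ((\<alpha> + \<beta>) / 2)" "cell (Suc n) (pre w) ((\<alpha> + \<beta>) / 2) b \<beta>"
        using cell_midE[OF Suc.prems(2) False] by metis
      have iK: "i < K" using Suc.prems(5) K by simp
      have c: "pre w i \<noteq> Star" "\<not> differ (pre w i) (a i)" "\<not> differ (pre w i) (b i)"
        using iK w nd[OF iK] word_not_Star[OF w(1), of i] by (simp_all add: pre_nth)
      consider "s < (\<alpha> + \<beta>) / 2" | "s = (\<alpha> + \<beta>) / 2" | "(\<alpha> + \<beta>) / 2 < s" by linarith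
      then show ?thesis
      proof cases
        case 1
        have "x i \<noteq> Star \<and> \<not> differ (x i) (a i) \<and> \<not> differ (x i) (pre w i)"
          using Suc.IH[of "Suc n" a \<alpha> "pre w" "(\<alpha> + \<beta>) / 2"] Suc.prems cells(1) 1 gt(1)
          by (auto dest: order_less_trans)
        then show ?thesis using c not_differ_trans[of "x i" "pre w i" "b i"] by blast
      next
        case 2
        then have "x = pre w" using Q_unique Suc.prems(1) cell_Q[OF cells(1)] by blast
        then show ?thesis using c by simp
      next
        case 3
        have "x i \<noteq> Star \<and> \<not> differ (x i) (pre w i) \<and> \<not> differ (x i) (b i)"
          using Suc.IH[of "Suc n" "pre w" "(\<alpha> + \<beta>) / 2" b \<beta>] Suc.prems cells(2) 3 gt(2)
          by (auto dest: order_less_trans)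
        then show ?thesis using c not_differ_trans[of "x i" "pre w i" "a i"] by blast
      qed
    qed
  qed
qed


abbreviation P :: "itin set" where "P \<equiv> P_inf d \<nu>"
abbreviation f :: "itin \<Rightarrow> real" where "f \<equiv> phi_P d \<nu>"
abbreviation val :: "itin \<Rightarrow> real" where "val \<equiv> phi d \<nu>"

text \<open>The inserted point is the only one in its cell with a star at the index \<open>K\<close> where the ends
  differ; to its left all points have the symbol of the left end there, and to its right that of
  the right end.\<close>

lemma cell_halves:
  assumes cell: "cell n a \<alpha> b \<beta>" and fin: "diff a b \<noteq> \<infinity>"
  obtains K c where "diff a b = enat (Suc K)" "c = ins a b"
    "(c, (\<alpha> + \<beta>) / 2) \<in> Q (Suc n)" "differ (a K) (b K)"
    "\<forall>i<K. c i \<noteq> Star"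
    "\<forall>x s m. (x, s) \<in> Q m \<and> \<alpha> \<le> s \<and> s < (\<alpha> + \<beta>) / 2 \<longrightarrow>
       x K = a K \<and> (\<forall>i<K. \<not> differ (x i) (c i))"
    "\<forall>x s m. (x, s) \<in> Q m \<and> (\<alpha> + \<beta>) / 2 < s \<and> s \<le> \<beta> \<longrightarrow>
       x K = b K \<and> (\<forall>i<K. \<not> differ (x i) (c i))"
proof -
  obtain K w where K: "diff a b = enat (Suc K)" and w: "set w \<subseteq> alphabet d" "length w = K"
    and nd: "\<And>i. i < K \<Longrightarrow> \<not> differ (w ! i) (a i) \<and> \<not> differ (w ! i) (b i)"
    and differ: "differ (a K) (b K)"
    and gt: "diff a b < diff a (pre w)" "diff a b < diff (pre w) b"
    and ins: "ins a b = pre w"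
    and cells: "cell (Suc n) a \<alpha> (pre w) ((\<alpha> + \<beta>) / 2)" "cell (Suc n) (pre w) ((\<alpha> + \<beta>) / 2) b \<beta>"
    using cell_midE[OF assms] by metis
  have long: "enat (Suc i) < diff a (pre w)" "enat (Suc i) < diff (pre w) b" if "i \<le> K" for i
    using gt that unfolding K by (auto intro: order_le_less_trans[of _ "enat (Suc K)"])
  show thesis
  proof (rule that[of K "pre w"])
    show "diff a b = enat (Suc K)" "pre w = ins a b" "differ (a K) (b K)"
      using K ins differ by simp_all
    show "(pre w, (\<alpha> + \<beta>) / 2) \<in> Q (Suc n)"
      using cell_Q[OF cells(1)] by simp
    show "\<forall>i<K. pre w i \<noteq> Star"
      using w word_not_Star[OF w(1)] by (simp add: pre_nth)
    have "x K = a K \<and> (\<forall>i<K. \<not> differ (x i) (pre w i))"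
      if x: "(x, s) \<in> Q m" "\<alpha> \<le> s" "s < (\<alpha> + \<beta>) / 2" for x s m
    proof (cases "s = \<alpha>")
      case True
      then have "x = a" using Q_unique x(1) cell_Q[OF cell] by blast
      then show ?thesis using nd w by (auto simp: pre_nth differ_commute)
    next
      case False
      then have *: "x i \<noteq> Star \<and> \<not> differ (x i) (a i) \<and> \<not> differ (x i) (pre w i)" if "i \<le> K" for i
        using cell_interior[OF cells(1) x(1) _ x(3) long(1)[OF that]] x(2) by simp
      have "x K = a K" using *[OF order_refl] differ by (auto simp: differ_def)
      moreover have "\<not> differ (x i) (pre w i)" if "i < K" for i using *[of i] that by simp
      ultimately show ?thesis by blast
    qed
    then show "\<forall>x s m. (x, s) \<in> Q m \<and> \<alpha> \<le> s \<and> s < (\<alpha> + \<beta>) / 2 \<longrightarrow>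
       x K = a K \<and> (\<forall>i<K. \<not> differ (x i) (pre w i))" by blast
    have "x K = b K \<and> (\<forall>i<K. \<not> differ (x i) (pre w i))"
      if x: "(x, s) \<in> Q m" "(\<alpha> + \<beta>) / 2 < s" "s \<le> \<beta>" for x s m
    proof (cases "s = \<beta>")
      case True
      then have "x = b" using Q_unique x(1) cell_Q[OF cell] by blast
      then show ?thesis using nd w by (auto simp: pre_nth differ_commute)
    next
      case False
      then have *: "x i \<noteq> Star \<and> \<not> differ (x i) (pre w i) \<and> \<not> differ (x i) (b i)" if "i \<le> K" for i
        using cell_interior[OF cells(2) x(1) x(2) _ long(2)[OF that]] x(3) by simp
      have "x K = b K" using *[OF order_refl] differ by (auto simp: differ_def)
      moreover have "\<not> differ (x i) (pre w i)" if "i < K" for i using *[of i] that by simp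
      ultimately show ?thesis by blast
    qed
    then show "\<forall>x s m. (x, s) \<in> Q m \<and> (\<alpha> + \<beta>) / 2 < s \<and> s \<le> \<beta> \<longrightarrow>
       x K = b K \<and> (\<forall>i<K. \<not> differ (x i) (pre w i))" by blast
  qed
qed

lemma Q_range: "(x, s) \<in> Q n \<Longrightarrow> 0 \<le> s \<and> s \<le> 1"
proof (induction n arbitrary: x s)
  case (Suc n)
  show ?case
  proof (cases "(x, s) \<in> Q n")
    case True
    then show ?thesis by (rule Suc.IH)
  next
    case False
    then obtain a \<alpha> b \<beta> where "cell n a \<alpha> b \<beta>" "s = (\<alpha> + \<beta>) / 2"
      using Q_Suc[OF Suc.prems] by blast
    then show ?thesis using cell_bounds[of n a \<alpha> b \<beta>] cell_less[of n a \<alpha> b \<beta>] by auto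
  qed
qed (auto simp: P_list_0)

text \<open>If anything lies between two points, the first level at which this happens inserts it as the
  midpoint of a cell that contains both points, one in each half.\<close>

lemma Q_between_or_cell:
  assumes x: "(x, s) \<in> Q m" and y: "(y, t) \<in> Q m" and "s < t"
  shows "(\<exists>n. cell n x s y t \<and> diff x y = \<infinity>) \<or>
    (\<exists>n a \<alpha> b \<beta> z. cell n a \<alpha> b \<beta> \<and> diff a b \<noteq> \<infinity> \<and> diff x y = diff a b \<and> \<alpha> \<le> s \<and> t \<le> \<beta> \<and>
       (z, (\<alpha> + \<beta>) / 2) \<in> Q (Suc n) \<and> s < (\<alpha> + \<beta>) / 2 \<and> (\<alpha> + \<beta>) / 2 < t)"
proof (cases "\<exists>n z r. (z, r) \<in> Q n \<and> s < r \<and> r < t")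
  case False
  have "cell m x s y t"
    unfolding cell_def
    by (rule consecutiveI_no_between[OF value_sorted_P_list]) (use assms False in auto)
  moreover have "diff x y = \<infinity>"
  proof (rule ccontr)
    assume "diff x y \<noteq> \<infinity>"
    then have "(ins x y, (s + t) / 2) \<in> Q (Suc m)"
      using cell_Q[OF cell_Suc_split(1)[OF \<open>cell m x s y t\<close>]] by blast
    moreover have "s < (s + t) / 2" "(s + t) / 2 < t" using \<open>s < t\<close> by simp_all
    ultimately show False using False by blast
  qed
  ultimately show ?thesis by blast
next
  case True
  define n where "n = (LEAST n. \<exists>z r. (z, r) \<in> Q n \<and> s < r \<and> r < t)"
  have "\<exists>z r. (z, r) \<in> Q n \<and> s < r \<and> r < t"
    unfolding n_def using True by (rule LeastI_ex)
  then obtain z r where z: "(z, r) \<in> Q n" "s < r" "r < t" by blast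
  have least: "\<not> (s < r' \<and> r' < t)" if "(z', r') \<in> Q n'" "n' < n" for z' r' n'
  proof -
    have "\<not> (\<exists>z r. (z, r) \<in> Q n' \<and> s < r \<and> r < t)"
      using that(2) unfolding n_def by (rule not_less_Least)
    then show ?thesis using that(1) by blast
  qed
  have range: "0 \<le> s" "t \<le> 1" using Q_range[OF x] Q_range[OF y] by simp_all
  obtain n' where n': "n = Suc n'"
  proof (cases n)
    case 0
    then have "r = 0 \<or> r = 1" using z(1) by (auto simp: P_list_0)
    then show thesis using z range by auto
  next
    case (Suc k)
    then show thesis by (rule that)
  qed
  have "(z, r) \<notin> Q n'" using least[of z r n'] z n' by auto
  then obtain a \<alpha> b \<beta> where cell: "cell n' a \<alpha> b \<beta>" "diff a b \<noteq> \<infinity>" and r: "r = (\<alpha> + \<beta>) / 2"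
    using Q_Suc[of z r n'] z(1) n' by blast
  have ab: "\<alpha> < r" "r < \<beta>" using cell_less[OF cell(1)] r by simp_all
  have "\<alpha> \<le> s" "t \<le> \<beta>"
    using least[of a \<alpha> n'] least[of b \<beta> n'] cell_Q[OF cell(1)] n' ab z by auto
  obtain K c where K: "diff a b = enat (Suc K)" and "c = ins a b"
    and cQ: "(c, (\<alpha> + \<beta>) / 2) \<in> Q (Suc n')" and differ: "differ (a K) (b K)"
    and c: "\<forall>i<K. c i \<noteq> Star"
    and left: "\<forall>x s m. (x, s) \<in> Q m \<and> \<alpha> \<le> s \<and> s < (\<alpha> + \<beta>) / 2 \<longrightarrow>
       x K = a K \<and> (\<forall>i<K. \<not> differ (x i) (c i))"
    and right: "\<forall>x s m. (x, s) \<in> Q m \<and> (\<alpha> + \<beta>) / 2 < s \<and> s \<le> \<beta> \<longrightarrow>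
       x K = b K \<and> (\<forall>i<K. \<not> differ (x i) (c i))"
    by (rule cell_halves[OF cell], rule that)
  have xK: "x K = a K" "\<And>i. i < K \<Longrightarrow> \<not> differ (x i) (c i)"
    using left x \<open>\<alpha> \<le> s\<close> z(2) r by blast+
  have yK: "y K = b K" "\<And>i. i < K \<Longrightarrow> \<not> differ (y i) (c i)"
    using right y \<open>t \<le> \<beta>\<close> z(3) r by blast+
  have "diff x y = enat (Suc K)"
  proof (rule diffI)
    show "differ (x K) (y K)" using differ xK yK by simp
    show "\<not> differ (x i) (y i)" if "i < K" for i
      using not_differ_trans[of "x i" "c i" "y i"] xK yK c that by (simp add: differ_commute)
  qed
  then show ?thesis
    using cell K \<open>\<alpha> \<le> s\<close> \<open>t \<le> \<beta>\<close> cQ z unfolding r by (intro disjI2 exI conjI) (assumption | simp)+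
qed

text \<open>No itinerary occurs twice: two occurrences could only be the two ends of a gap, and the ends of
  a cell are distinct.\<close>

lemma Q_value_unique:
  assumes "(x, s) \<in> Q m" "(x, t) \<in> Q n"
  shows "s = t"
proof -
  have False if st: "s < t" "(x, s) \<in> Q k" "(x, t) \<in> Q k" for s t k
  proof -
    have "diff x x = \<infinity>" by (simp add: diff_eq_infinity_iff)
    then obtain n where "cell n x s x t" using Q_between_or_cell[OF st(2,3,1)] by auto
    then have "cell_inv x x" by (rule cell_inv)
    then show False by (simp add: cell_inv_def)
  qed
  moreover have "(x, s) \<in> Q (max m n)" "(x, t) \<in> Q (max m n)"
    using assms Q_mono[of m "max m n"] Q_mono[of n "max m n"] by auto
  ultimately show ?thesis by (metis linorder_neqE)
qed

lemma Q_f: "(x, s) \<in> Q n \<Longrightarrow> x \<in> P \<and> f x = s"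
proof
  assume x: "(x, s) \<in> Q n"
  then show "x \<in> P" by (force simp: P_inf_def)
  show "f x = s" unfolding phi_P_def
    by (rule the_equality) (use x Q_value_unique in blast)+
qed

lemma P_Q: "x \<in> P \<Longrightarrow> \<exists>n. (x, f x) \<in> Q n"
  using Q_f by (fastforce simp: P_inf_def)

lemma P_common_Q: "x \<in> P \<Longrightarrow> y \<in> P \<Longrightarrow> \<exists>n. (x, f x) \<in> Q n \<and> (y, f y) \<in> Q n"
  by (meson P_Q Q_mono subsetD max.cobounded1 max.cobounded2)

lemma f_inj: "x \<in> P \<Longrightarrow> y \<in> P \<Longrightarrow> f x = f y \<Longrightarrow> x = y"
  using P_Q Q_unique by metis

lemma cell_f: "cell n a \<alpha> b \<beta> \<Longrightarrow> a \<in> P \<and> b \<in> P \<and> \<alpha> = f a \<and> \<beta> = f b"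
  using cell_Q Q_f by blast

lemma ends_P: "crit \<in> P" "f (crit) = 0" "\<nu> \<in> P" "f \<nu> = 1"
  using Q_f[of _ _ 0] by (auto simp: P_list_0)

lemma f_range: "x \<in> P \<Longrightarrow> 0 \<le> f x \<and> f x \<le> 1"
  using P_Q Q_range by blast

lemma P_less_iff: "P_less d \<nu> a b \<longleftrightarrow> a \<in> P \<and> b \<in> P \<and> f a < f b"
proof
  assume "P_less d \<nu> a b"
  then obtain n i j where ij: "i < j" "j < length (P_list d \<nu> n)"
    "fst (P_list d \<nu> n ! i) = a" "fst (P_list d \<nu> n ! j) = b"
    by (auto simp: P_less_def)
  have "P_list d \<nu> n ! i \<in> Q n" "P_list d \<nu> n ! j \<in> Q n" using ij by simp_all
  then have "(a, snd (P_list d \<nu> n ! i)) \<in> Q n" "(b, snd (P_list d \<nu> n ! j)) \<in> Q n"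
    using ij by (metis prod.collapse)+
  moreover have "snd (P_list d \<nu> n ! i) < snd (P_list d \<nu> n ! j)"
    using ij value_sorted_less_iff[OF value_sorted_P_list, of i n j] by simp
  ultimately show "a \<in> P \<and> b \<in> P \<and> f a < f b" using Q_f by metis
next
  assume ab: "a \<in> P \<and> b \<in> P \<and> f a < f b"
  then obtain n where "(a, f a) \<in> Q n" "(b, f b) \<in> Q n" using P_common_Q by blast
  then obtain i j where "i < length (P_list d \<nu> n)" "P_list d \<nu> n ! i = (a, f a)"
    "j < length (P_list d \<nu> n)" "P_list d \<nu> n ! j = (b, f b)"
    by (meson in_set_conv_nth)
  moreover from this have "i < j"
    using ab value_sorted_less_iff[OF value_sorted_P_list, of i n j] by simp
  ultimately show "P_less d \<nu> a b" unfolding P_less_def by (metis fst_conv)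
qed

lemma separation:
  assumes "x \<in> P" "y \<in> P" "f x < f y"
  shows "(\<exists>n. cell n x (f x) y (f y)) \<and> diff x y = \<infinity> \<or>
    (\<exists>n a b z. cell n a (f a) b (f b) \<and> diff a b \<noteq> \<infinity> \<and> diff x y = diff a b \<and>
       f a \<le> f x \<and> f y \<le> f b \<and> z \<in> P \<and> f x < f z \<and> f z < f y)"
proof -
  obtain m where "(x, f x) \<in> Q m" "(y, f y) \<in> Q m" using P_common_Q assms by blast
  from Q_between_or_cell[OF this assms(3)] show ?thesis
    using cell_f Q_f by metis
qed

lemma gap_iff: "gap d \<nu> l r \<longleftrightarrow> l \<in> P \<and> r \<in> P \<and> f l < f r \<and> diff l r = \<infinity>"
proof
  assume "gap d \<nu> l r"
  then obtain n i where i: "Suc i < length (P_list d \<nu> n)" "fst (P_list d \<nu> n ! i) = l"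
    "fst (P_list d \<nu> n ! Suc i) = r" and "diff l r = \<infinity>"
    by (auto simp: gap_def)
  moreover have "P_less d \<nu> l r"
    unfolding P_less_def using i by blast
  ultimately show "l \<in> P \<and> r \<in> P \<and> f l < f r \<and> diff l r = \<infinity>" by (simp add: P_less_iff)
next
  assume lr: "l \<in> P \<and> r \<in> P \<and> f l < f r \<and> diff l r = \<infinity>"
  then obtain n where "cell n l (f l) r (f r)" using separation[of l r] by metis
  then show "gap d \<nu> l r"
    unfolding gap_def cell_def consecutive_iff_nth using lr by (metis fst_conv)
qed

lemma gap_cell: "gap d \<nu> l r \<Longrightarrow> \<exists>n. cell n l (f l) r (f r)"
  using separation[of l r] by (auto simp: gap_iff)

lemma gap_no_between:
  assumes "gap d \<nu> l r" "p \<in> P"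
  shows "f p \<le> f l \<or> f r \<le> f p"
proof -
  obtain n where n: "cell n l (f l) r (f r)" using gap_cell assms by blast
  have inf: "diff l r = \<infinity>" using assms by (simp add: gap_iff)
  have cell: "cell (n + k) l (f l) r (f r)" for k
    by (induction k) (use n cell_Suc_gap[OF _ inf] in auto)
  obtain m where "(p, f p) \<in> Q m" using P_Q assms by blast
  then have "(p, f p) \<in> Q (n + m)" using Q_mono[of m "n + m"] by auto
  then show ?thesis using cell_no_between[OF cell] by blast
qed

lemma cell_at_right:
  assumes "0 \<le> t" "t < 1"
  shows "\<exists>a b. cell n a (f a) b (f b) \<and> f a \<le> t \<and> t < f b"
proof -
  obtain p q where "(p, q) \<in> consecutive (P_list d \<nu> n)" "snd p \<le> t" "t < snd q"
    using consecutive_cover[of "P_list d \<nu> n" t] assms P_list_ends[of n] by auto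
  moreover from this have "cell n (fst p) (snd p) (fst q) (snd q)" by (simp add: cell_def)
  ultimately show ?thesis using cell_f by metis
qed

lemma cell_at_left:
  assumes "0 < t" "t \<le> 1"
  shows "\<exists>a b. cell n a (f a) b (f b) \<and> f a < t \<and> t \<le> f b"
proof -
  obtain p q where "(p, q) \<in> consecutive (P_list d \<nu> n)" "snd p < t" "t \<le> snd q"
    using consecutive_cover'[of "P_list d \<nu> n" t] assms P_list_ends[of n] by auto
  moreover from this have "cell n (fst p) (snd p) (fst q) (snd q)" by (simp add: cell_def)
  ultimately show ?thesis using cell_f by metis
qed

lemma small_power: "0 < (\<delta>::real) \<Longrightarrow> \<exists>n. 1 / 2 ^ n < \<delta>"
  using real_arch_pow_inv[of \<delta> "1/2"] by (simp add: power_divide)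

lemma P_dense:
  assumes "0 \<le> t" "t < t'" "t' \<le> 1"
  shows "(\<exists>p\<in>P. t < f p \<and> f p < t') \<or> (\<exists>l r. gap d \<nu> l r \<and> f l \<le> t \<and> t' \<le> f r)"
proof -
  obtain n where n: "1 / 2 ^ n < t' - t" using small_power[of "t' - t"] assms by auto
  obtain a b where ab: "cell n a (f a) b (f b)" "f a \<le> t" "t < f b"
    using cell_at_right[of t n] assms by auto
  show ?thesis
  proof (cases "f b < t'")
    case True
    then show ?thesis using ab cell_f by blast
  next
    case False
    have "diff a b = \<infinity>"
    proof (rule ccontr)
      assume "diff a b \<noteq> \<infinity>"
      then show False using cell_not_gap[OF ab(1)] n ab False by simp
    qed
    then have "gap d \<nu> a b" using ab cell_f[OF ab(1)] by (simp add: gap_iff)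
    moreover have "t' \<le> f b" using False by simp
    ultimately show ?thesis using ab(2) by blast
  qed
qed

text \<open>Two points at distance \<open>\<delta>\<close> that do not bound a gap differ where the ends of some cell of length at
  least \<open>\<delta>\<close> differ, and there are only finitely many such cells.\<close>

lemma finite_diff_bounded:
  assumes "0 < \<delta>"
  shows "\<exists>N. \<forall>x\<in>P. \<forall>y\<in>P. \<delta> \<le> f y - f x \<longrightarrow> diff x y \<noteq> \<infinity> \<longrightarrow> diff x y \<le> enat N"
proof -
  obtain m where m: "1 / 2 ^ m < \<delta>" using small_power assms by blast
  define D where "D = (\<Union>n\<le>m. (\<lambda>(p, q). the_enat (diff (fst p) (fst q))) ` consecutive (P_list d \<nu> n))"
  have "finite D" by (auto simp: D_def consecutive_def)
  have "diff x y \<le> enat (Max D)"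
    if xy: "x \<in> P" "y \<in> P" "\<delta> \<le> f y - f x" "diff x y \<noteq> \<infinity>" for x y
  proof -
    obtain n a b where cell: "cell n a (f a) b (f b)" "diff a b \<noteq> \<infinity>" "diff x y = diff a b"
      "f a \<le> f x" "f y \<le> f b"
      using separation[of x y] xy assms by auto
    have "\<not> m < n"
    proof
      assume "m < n"
      then have "(1::real) / 2 ^ n \<le> 1 / 2 ^ m" by (simp add: frac_le)
      then show False using cell_not_gap[OF cell(1,2)] cell xy m by auto
    qed
    have "the_enat (diff a b) \<in> D"
    proof -
      have "n \<le> m" "((a, f a), (b, f b)) \<in> consecutive (P_list d \<nu> n)"
        using \<open>\<not> m < n\<close> cell(1) by (simp_all add: cell_def)
      then show ?thesis
        unfolding D_def by (intro UN_I[of n] image_eqI[of _ _ "((a, f a), (b, f b))"]) simp_all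
    qed
    then have "the_enat (diff a b) \<le> Max D" using \<open>finite D\<close> by simp
    then show ?thesis using cell(2,3) by (cases "diff a b") auto
  qed
  then show ?thesis by blast
qed

abbreviation L :: "itin set" where "L \<equiv> L_set d \<nu>"

section \<open>Limits of monotone sequences\<close>

lemma tendsto_infinity_enat_iff:
  fixes g :: "nat \<Rightarrow> enat"
  shows "g \<longlonglongrightarrow> \<infinity> \<longleftrightarrow> (\<forall>N. \<forall>\<^sub>F n in sequentially. enat N < g n)"
proof
  assume "g \<longlonglongrightarrow> \<infinity>"
  then show "\<forall>N. \<forall>\<^sub>F n in sequentially. enat N < g n"
    by (auto simp: order_tendsto_iff)
next
  assume *: "\<forall>N. \<forall>\<^sub>F n in sequentially. enat N < g n"
  have "\<forall>\<^sub>F n in sequentially. l < g n" if "l < \<infinity>" for l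
    using * that by (cases l) auto
  then show "g \<longlonglongrightarrow> \<infinity>" by (auto simp: order_tendsto_iff)
qed

abbreviation in_cell :: "(nat \<Rightarrow> itin) \<Rightarrow> itin \<Rightarrow> itin \<Rightarrow> bool" where
  "in_cell s x y \<equiv> \<forall>\<^sub>F m in sequentially. f x < f (s m) \<and> f (s m) < f y"

definition approaches :: "(nat \<Rightarrow> itin) \<Rightarrow> itin \<Rightarrow> bool" where
  "approaches s a \<longleftrightarrow> (\<forall>n. s n \<in> P) \<and> (\<forall>N. \<forall>\<^sub>F n in sequentially. enat N < diff (s n) a)"

lemma increasing_to_iff:
  "increasing_to d \<nu> s a \<longleftrightarrow> approaches s a \<and> (\<forall>n. f (s n) < f (s (Suc n)))"
  by (auto simp: increasing_to_def approaches_def P_less_iff tendsto_infinity_enat_iff)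

lemma decreasing_to_iff:
  "decreasing_to d \<nu> s a \<longleftrightarrow> approaches s a \<and> (\<forall>n. f (s (Suc n)) < f (s n))"
  by (auto simp: decreasing_to_def approaches_def P_less_iff tendsto_infinity_enat_iff)

definition monotone_to :: "(nat \<Rightarrow> itin) \<Rightarrow> itin \<Rightarrow> bool" where
  "monotone_to s a \<longleftrightarrow> increasing_to d \<nu> s a \<or> decreasing_to d \<nu> s a"

lemma increasing_limit:
  assumes "increasing_to d \<nu> s a"
  shows "\<exists>t. (\<lambda>n. f (s n)) \<longlonglongrightarrow> t \<and> (\<forall>n. f (s n) < t)"
proof -
  have less: "f (s n) < f (s (Suc n))" and s: "s n \<in> P" for n
    using assms by (auto simp: increasing_to_iff approaches_def)
  then have "incseq (\<lambda>n. f (s n))" by (intro incseq_SucI) (simp add: less_imp_le)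
  moreover have "\<forall>i. f (s i) \<le> 1" using s f_range by blast
  ultimately obtain t where "(\<lambda>n. f (s n)) \<longlonglongrightarrow> t" "\<forall>i. f (s i) \<le> t"
    by (rule incseq_convergent)
  then show ?thesis using less by (meson less_le_trans)
qed

lemma decreasing_limit:
  assumes "decreasing_to d \<nu> s a"
  shows "\<exists>t. (\<lambda>n. f (s n)) \<longlonglongrightarrow> t \<and> (\<forall>n. t < f (s n))"
proof -
  have less: "f (s (Suc n)) < f (s n)" and s: "s n \<in> P" for n
    using assms by (auto simp: decreasing_to_iff approaches_def)
  then have "decseq (\<lambda>n. f (s n))" by (intro decseq_SucI) (simp add: less_imp_le)
  moreover have "\<forall>i. 0 \<le> f (s i)" using s f_range by blast
  ultimately obtain t where "(\<lambda>n. f (s n)) \<longlonglongrightarrow> t" "\<forall>i. t \<le> f (s i)"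
    by (rule decseq_convergent)
  then show ?thesis using less by (meson le_less_trans)
qed

text \<open>If the limits were different, then the two sequences would eventually stay at a distance bounded
  below while the index of their first difference grows, so that \<open>s n\<close> and \<open>y n\<close> would bound a gap
  for all large \<open>n\<close>.  But \<open>s n\<close> or \<open>s (Suc n)\<close> lies inside the gap bounded by the other.\<close>

lemma close_sequences_same_limit:
  assumes s: "\<And>n. s n \<in> P" "\<And>n. f (s n) \<noteq> f (s (Suc n))" "(\<lambda>n. f (s n)) \<longlonglongrightarrow> t"
    and y: "\<And>n. y n \<in> P" "(\<lambda>n. f (y n)) \<longlonglongrightarrow> t'"
    and close: "\<And>N. \<forall>\<^sub>F n in sequentially. enat N < diff (s n) (y n)"
  shows "t = t'"
proof (rule ccontr)
  assume "t \<noteq> t'"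
  define \<delta> where "\<delta> = \<bar>t - t'\<bar> / 3"
  have \<delta>: "0 < \<delta>" "3 * \<delta> = \<bar>t - t'\<bar>" using \<open>t \<noteq> t'\<close> by (simp_all add: \<delta>_def)
  obtain N where N: "\<And>x y. \<lbrakk>x \<in> P; y \<in> P; \<delta> \<le> f y - f x; diff x y \<noteq> \<infinity>\<rbrakk> \<Longrightarrow> diff x y \<le> enat N"
    using finite_diff_bounded[OF \<delta>(1)] by blast
  have "\<forall>\<^sub>F n in sequentially. \<bar>f (s n) - t\<bar> < \<delta> \<and> \<bar>f (y n) - t'\<bar> < \<delta> \<and> enat N < diff (s n) (y n)"
    using tendstoD[OF s(3) \<delta>(1)] tendstoD[OF y(2) \<delta>(1)] close[of N]
    by eventually_elim (simp add: dist_real_def)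
  then obtain n0 where n0: "\<And>n. n \<ge> n0 \<Longrightarrow> \<bar>f (s n) - t\<bar> < \<delta>" "\<And>n. n \<ge> n0 \<Longrightarrow> \<bar>f (y n) - t'\<bar> < \<delta>"
    "\<And>n. n \<ge> n0 \<Longrightarrow> enat N < diff (s n) (y n)"
    by (auto simp: eventually_sequentially)
  show False
  proof (cases "t < t'")
    case True
    have "gap d \<nu> (s n) (y n)" if "n \<ge> n0" for n
    proof -
      have "\<delta> \<le> f (y n) - f (s n)" using n0(1,2)[OF that] \<delta> True by linarith
      moreover from this have "diff (s n) (y n) = \<infinity>"
        using N[OF s(1) y(1), of n n] n0(3)[OF that] by (meson leD)
      ultimately show ?thesis using s(1) y(1) \<delta>(1) by (simp add: gap_iff)
    qed
    then have "f (s (Suc n0)) \<le> f (s n0) \<or> f (y n0) \<le> f (s (Suc n0))"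
      "f (s n0) \<le> f (s (Suc n0)) \<or> f (y (Suc n0)) \<le> f (s n0)"
      using gap_no_between s(1) by simp_all
    then show False using s(2)[of n0] n0(1,2)[of n0] n0(1,2)[of "Suc n0"] \<delta> True by auto
  next
    case False
    have "gap d \<nu> (y n) (s n)" if "n \<ge> n0" for n
    proof -
      have "\<delta> \<le> f (s n) - f (y n)" using n0(1,2)[OF that] \<delta> False by linarith
      moreover from this have "diff (y n) (s n) = \<infinity>"
        using N[OF y(1) s(1), of n n] n0(3)[OF that] diff_commute[of "s n"] by (metis leD)
      ultimately show ?thesis using s(1) y(1) \<delta>(1) by (simp add: gap_iff)
    qed
    then have "f (s (Suc n0)) \<le> f (y n0) \<or> f (s n0) \<le> f (s (Suc n0))"
      "f (s n0) \<le> f (y (Suc n0)) \<or> f (s (Suc n0)) \<le> f (s n0)"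
      using gap_no_between s(1) by simp_all
    then show False using s(2)[of n0] n0(1,2)[of n0] n0(1,2)[of "Suc n0"] \<delta> False by auto
  qed
qed

lemma approaches_close:
  assumes "approaches s a" "approaches s' a" "\<And>i. a i \<noteq> Star"
  shows "\<forall>\<^sub>F n in sequentially. enat N < diff (s n) (s' n)"
proof -
  have "\<forall>\<^sub>F n in sequentially. enat N < diff (s n) a" "\<forall>\<^sub>F n in sequentially. enat N < diff (s' n) a"
    using assms by (simp_all add: approaches_def)
  then show ?thesis
  proof eventually_elim
    case (elim n)
    then show ?case unfolding less_diff_iff using assms(3) not_differ_trans differ_commute by meson
  qed
qed

lemma approaches_const: "x \<in> P \<Longrightarrow> diff x a = \<infinity> \<Longrightarrow> approaches (\<lambda>_. x) a"
  by (simp add: approaches_def)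

lemma monotone_to_simps:
  assumes "monotone_to s a"
  shows "approaches s a" "s n \<in> P" "f (s n) \<noteq> f (s (Suc n))"
proof -
  show ap: "approaches s a"
    using assms by (auto simp: monotone_to_def increasing_to_iff decreasing_to_iff)
  show "s n \<in> P" using ap by (simp add: approaches_def)
  have "f (s n) < f (s (Suc n)) \<or> f (s (Suc n)) < f (s n)"
    using assms by (auto simp: monotone_to_def increasing_to_iff decreasing_to_iff)
  then show "f (s n) \<noteq> f (s (Suc n))" by auto
qed

lemma monotone_to_limit: "monotone_to s a \<Longrightarrow> \<exists>t. (\<lambda>n. f (s n)) \<longlonglongrightarrow> t"
  unfolding monotone_to_def using increasing_limit decreasing_limit by blast

lemma monotone_to_limit_unique:
  assumes "monotone_to s a" "approaches s' a" "\<And>i. a i \<noteq> Star"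
    "(\<lambda>n. f (s n)) \<longlonglongrightarrow> t" "(\<lambda>n. f (s' n)) \<longlonglongrightarrow> t'"
  shows "t = t'"
proof (rule close_sequences_same_limit[of s t s' t'])
  show "s n \<in> P" "f (s n) \<noteq> f (s (Suc n))" "s' n \<in> P" for n
    using assms(2) monotone_to_simps[OF assms(1)] by (simp_all add: approaches_def)
  show "\<forall>\<^sub>F n in sequentially. enat N < diff (s n) (s' n)" for N
    using approaches_close[OF monotone_to_simps(1)[OF assms(1)] assms(2,3)] .
qed (rule assms)+

lemma L_set_iff: "a \<in> L \<longleftrightarrow> a \<in> itineraries d \<nu> \<and> a \<in> full_seqs d \<and> (\<exists>s. monotone_to s a)"
  by (auto simp: L_set_def monotone_to_def)

lemma phi_P_inf: "x \<in> P \<Longrightarrow> val x = f x"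
  by (simp add: phi_def)

lemma phi_L_set:
  assumes "a \<in> L" "a \<notin> P" "monotone_to s a"
  shows "(\<lambda>n. f (s n)) \<longlonglongrightarrow> val a"
proof -
  obtain t where t: "(\<lambda>n. f (s n)) \<longlonglongrightarrow> t" using monotone_to_limit assms(3) by blast
  have no_star: "a i \<noteq> Star" for i using assms(1) full_seqs_not_Star by (auto simp: L_set_iff)
  have "val a = (THE t. \<exists>s. monotone_to s a \<and> (\<lambda>n. f (s n)) \<longlonglongrightarrow> t)"
    using assms(1,2) by (simp add: phi_def monotone_to_def)
  also have "\<dots> = t"
  proof (rule the_equality)
    show "\<exists>s. monotone_to s a \<and> (\<lambda>n. f (s n)) \<longlonglongrightarrow> t" using assms(3) t by blast
    show "t' = t" if "\<exists>s. monotone_to s a \<and> (\<lambda>n. f (s n)) \<longlonglongrightarrow> t'" for t'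
      using that monotone_to_limit_unique[OF _ monotone_to_simps(1)[OF assms(3)] no_star _ t] by blast
  qed
  finally show ?thesis using t by simp
qed

lemma phi_increasing:
  assumes "a \<in> L" "a \<notin> P" "increasing_to d \<nu> s a"
  shows "f (s n) < val a"
  using phi_L_set[of a s] increasing_limit[OF assms(3)] assms LIMSEQ_unique
  unfolding monotone_to_def by blast

lemma phi_decreasing:
  assumes "a \<in> L" "a \<notin> P" "decreasing_to d \<nu> s a"
  shows "val a < f (s n)"
  using phi_L_set[of a s] decreasing_limit[OF assms(3)] assms LIMSEQ_unique
  unfolding monotone_to_def by blast

text \<open>The constant sequence \<open>x\<close> approaches \<open>a\<close> as well as any monotone sequence does.\<close>

lemma phi_L_set_eq:
  assumes "a \<in> L" "a \<notin> P" "x \<in> P" "diff a x = \<infinity>"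
  shows "val a = f x"
proof -
  obtain s where s: "monotone_to s a" using assms(1) by (auto simp: L_set_iff)
  have "a i \<noteq> Star" for i using assms(1) full_seqs_not_Star by (auto simp: L_set_iff)
  then show ?thesis
    using monotone_to_limit_unique[OF s approaches_const[OF assms(3)] _ phi_L_set[OF assms(1,2) s]]
      assms(4) by (simp add: diff_commute)
qed

lemma L_set_not_in_gap:
  assumes "a \<in> L" "a \<notin> P" "gap d \<nu> l r"
  shows "val a \<le> f l \<or> f r \<le> val a"
    "increasing_to d \<nu> s a \<Longrightarrow> val a \<noteq> f r"
    "decreasing_to d \<nu> s a \<Longrightarrow> val a \<noteq> f l"
proof -
  show "val a \<le> f l \<or> f r \<le> val a"
  proof (rule ccontr)
    assume *: "\<not> ?thesis"
    obtain s where s: "monotone_to s a" using assms(1) by (auto simp: L_set_iff)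
    have "\<forall>\<^sub>F n in sequentially. f l < f (s n) \<and> f (s n) < f r"
      using phi_L_set[OF assms(1,2) s] * by (auto simp: order_tendsto_iff intro: eventually_conj)
    then obtain n where "f l < f (s n)" "f (s n) < f r" by (auto simp: eventually_sequentially)
    then show False
      using gap_no_between[OF assms(3) monotone_to_simps(2)[OF s], of n] by linarith
  qed
  show "val a \<noteq> f r" if s: "increasing_to d \<nu> s a"
  proof
    assume eq: "val a = f r"
    have m: "monotone_to s a" using s by (simp add: monotone_to_def)
    have "\<forall>\<^sub>F n in sequentially. f l < f (s n)"
      using phi_L_set[OF assms(1,2) m] eq assms(3) by (auto simp: order_tendsto_iff gap_iff)
    then obtain n where "f l < f (s n)" by (auto simp: eventually_sequentially)
    then show False
      using gap_no_between[OF assms(3) monotone_to_simps(2)[OF m], of n]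
        phi_increasing[OF assms(1,2) s, of n] eq by linarith
  qed
  show "val a \<noteq> f l" if s: "decreasing_to d \<nu> s a"
  proof
    assume eq: "val a = f l"
    have m: "monotone_to s a" using s by (simp add: monotone_to_def)
    have "\<forall>\<^sub>F n in sequentially. f (s n) < f r"
      using phi_L_set[OF assms(1,2) m] eq assms(3) by (auto simp: order_tendsto_iff gap_iff)
    then obtain n where "f (s n) < f r" by (auto simp: eventually_sequentially)
    then show False
      using gap_no_between[OF assms(3) monotone_to_simps(2)[OF m], of n]
        phi_decreasing[OF assms(1,2) s, of n] eq by linarith
  qed
qed


section \<open>The star-periodic and the non-periodic case\<close>

definition starry :: bool where "starry \<longleftrightarrow> (\<exists>z. \<nu> z = Star)"

lemma starryE:
  assumes starry
  obtains u where "set u \<subseteq> alphabet d" "\<nu> = pre u"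
proof (cases rule: kneading_cases)
  case nonperiodic
  then show thesis using assms full_seqs_not_Star by (auto simp: starry_def)
next
  case (star_periodic u)
  have "\<nu> = (u @ [Star]) \<frown> \<nu>" using star_periodic(2) iter_unroll[of "u @ [Star]"] by simp
  then have "\<nu> = pre u" by (simp add: pre_def)
  then show thesis using that star_periodic(1) by blast
qed

lemma not_starryD:
  assumes "\<not> starry"
  shows "\<nu> \<in> full_seqs d" "0 < k \<Longrightarrow> suffix k \<nu> \<noteq> \<nu>" "\<nu> i \<noteq> Star"
proof -
  have "\<nu> \<in> full_seqs d \<and> (\<forall>k>0. suffix k \<nu> \<noteq> \<nu>)"
  proof (cases rule: kneading_cases)
    case (star_periodic u)
    then have "\<nu> (length u) = Star" by (simp add: nth_append)
    then show ?thesis using assms by (auto simp: starry_def)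
  qed blast
  then show "\<nu> \<in> full_seqs d" "0 < k \<Longrightarrow> suffix k \<nu> \<noteq> \<nu>" by blast+
  show "\<nu> i \<noteq> Star" using assms by (simp add: starry_def)
qed

lemma P_form:
  assumes "x \<in> P"
  shows "x = \<nu> \<or> precritical d \<nu> x"
proof -
  have "x = \<nu> \<or> precritical d \<nu> x" if "(x, s) \<in> Q n" for x s n
    using that
  proof (induction n arbitrary: x s)
    case 0
    then have "x = \<nu> \<or> x = pre []" by (auto simp: P_list_0 pre_Nil)
    then show ?case by (force simp: precritical_iff)
  next
    case (Suc n)
    show ?case
    proof (cases "(x, s) \<in> Q n")
      case False
      then obtain a \<alpha> b \<beta> where ab: "cell n a \<alpha> b \<beta>" "diff a b \<noteq> \<infinity>" "x = ins a b"
        using Q_Suc[OF Suc.prems] by blast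
      obtain w where "set w \<subseteq> alphabet d" "ins a b = pre w"
        using cell_midE[OF ab(1,2)] by metis
      then show ?thesis using ab(3) by (auto simp: precritical_iff)
    qed (rule Suc.IH)
  qed
  then show ?thesis using P_Q[OF assms] by blast
qed

lemma P_precritical: "starry \<Longrightarrow> x \<in> P \<Longrightarrow> precritical d \<nu> x"
  using P_form starryE by (metis precritical_iff)

lemma precritical_not_full: "precritical d \<nu> x \<Longrightarrow> x \<notin> full_seqs d"
  using pre_nth(2) full_seqs_not_Star by (auto simp: precritical_iff)

lemma full_itinerary: "starry \<Longrightarrow> a \<in> full_seqs d \<Longrightarrow> a \<in> itineraries d \<nu>"
proof -
  assume starry and a: "a \<in> full_seqs d"
  then obtain z where z: "\<nu> z = Star" by (auto simp: starry_def)
  have "a \<noteq> w \<frown> \<nu>" for w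
  proof
    assume "a = w \<frown> \<nu>"
    then have "a (length w + z) = Star" using z by simp
    then show False using a full_seqs_not_Star by blast
  qed
  then show ?thesis using a by (auto simp: itineraries_def)
qed

lemma match_precritical:
  assumes "\<not> starry" "\<And>i. x i \<noteq> Star" "diff x (pre w) = \<infinity>"
  shows "suffix (Suc (length w)) x = \<nu>"
proof (rule ext)
  fix n
  have "\<not> differ (x (Suc (length w + n))) (pre w (Suc (length w + n)))"
    using assms(3) by (simp add: diff_eq_infinity_iff)
  then show "suffix (Suc (length w)) x n = \<nu> n"
    using assms(2) not_starryD(3)[OF assms(1)] by (auto simp: pre_nth differ_def)
qed

text \<open>Postcritical points need an argument because \<open>itineraries\<close> lists them separately: a preimage of
  \<open>\<nu>\<close> among them would make \<open>\<nu>\<close> periodic.\<close>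

lemma itinerary_not_preimage:
  assumes "\<not> starry" "a \<in> itineraries d \<nu>" "a \<in> full_seqs d" "0 < k"
  shows "suffix k a \<noteq> \<nu>"
proof
  assume eq: "suffix k a = \<nu>"
  have no_star: "a i \<noteq> Star" for i using assms(3) full_seqs_not_Star by blast
  have aper: "suffix m \<nu> \<noteq> \<nu>" if "0 < m" for m using not_starryD(2)[OF assms(1)] that .
  have aa: "a = prefix k a \<frown> \<nu>" using eq prefix_suffix[of a k] by metis
  consider "a = \<nu>" | "a = crit" | j where "j \<ge> 1" "a = suffix j (crit)"
    | "precritical d \<nu> a" | "\<not> (\<exists>w. w \<noteq> [] \<and> set w \<subseteq> alphabet d \<and> a = w \<frown> \<nu>)"
    using assms(2) by (auto simp: itineraries_def)
  then show False
  proof cases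
    case 1
    then show False using eq aper[OF assms(4)] by simp
  next
    case 2
    then have "a 0 = Star" by simp
    then show False using no_star by blast
  next
    case (3 j)
    then obtain j' where j: "j = Suc j'" by (cases j) auto
    have "a n = \<nu> (j' + n)" for n using 3(2) by (simp add: j)
    then have "\<nu> (j' + k + n) = \<nu> n" for n
      using fun_cong[OF eq, of n] by (simp add: add.assoc)
    then have "suffix (j' + k) \<nu> = \<nu>" by (auto simp: fun_eq_iff)
    then show False using aper[of "j' + k"] assms(4) by simp
  next
    case 4
    then show False using precritical_not_full assms(3) by blast
  next
    case 5
    have "prefix k a \<noteq> []" using assms(4) by simp
    moreover have "set (prefix k a) \<subseteq> alphabet d" using assms(3) by (auto simp: full_seqs_def)
    ultimately show False using 5 aa by blast
  qed
qed

lemma gap_cell_inv: "gap d \<nu> l r \<Longrightarrow> cell_inv l r"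
  using gap_cell cell_inv by blast

text \<open>Two points of \<open>P_inf\<close> that do not differ in any index repeat \<open>\<nu>\<close> with an offset; without stars
  this makes \<open>\<nu>\<close> periodic.\<close>

lemma gap_starry:
  assumes gap: "gap d \<nu> l r"
  shows starry
proof (rule ccontr)
  assume ns: "\<not> starry"
  have inf: "diff l r = \<infinity>" "diff r l = \<infinity>" using gap diff_commute[of l r] by (auto simp: gap_iff)
  have ne: "l \<noteq> r" and nc: "\<And>i. \<not> (l i = Star \<and> r i = Star)"
    using gap_cell_inv[OF gap] by (auto simp: cell_inv_def)
  have one: False if "x = \<nu>" "y = pre w" "diff x y = \<infinity>" for x y w
    using match_precritical[OF ns, of \<nu> w] that not_starryD(2,3)[OF ns] by auto
  have two: False if "x = pre w" "y = pre w'" "diff x y = \<infinity>" "length w < length w'" for x y w w'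
  proof -
    obtain m where m: "length w' = Suc (length w + m)"
      using \<open>length w < length w'\<close> less_imp_Suc_add by blast
    have "\<nu> (Suc m + n) = \<nu> n" for n
    proof -
      have "\<not> differ (x (Suc (length w' + n))) (y (Suc (length w' + n)))"
        using that(3) by (simp add: diff_eq_infinity_iff)
      moreover have "y (Suc (length w' + n)) = \<nu> n" using that(2) by (simp add: pre_nth)
      moreover have "x (Suc (length w' + n)) = \<nu> (Suc m + n)"
        using that(1) m pre_nth(3)[of w "Suc m + n"] by (simp add: add_ac)
      ultimately show ?thesis using not_starryD(3)[OF ns] by (auto simp: differ_def)
    qed
    then have "suffix (Suc m) \<nu> = \<nu>" unfolding suffix_def by blast
    then show False using not_starryD(2)[OF ns] by blast
  qed
  have "l \<in> P" "r \<in> P" using gap by (auto simp: gap_iff)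
  then consider "l = \<nu>" "r = \<nu>" | w where "l = \<nu>" "r = pre w" | w where "l = pre w" "r = \<nu>"
    | w w' where "l = pre w" "r = pre w'"
    using P_form unfolding precritical_iff by metis
  then show False
  proof cases
    case (4 w w')
    consider "length w < length w'" | "length w' < length w" | "length w = length w'" by linarith
    then show False
    proof cases
      case 3
      then show False using nc[of "length w"] 4 pre_nth(2)[of w] pre_nth(2)[of w'] by simp
    qed (use two 4 inf in blast)+
  qed (use ne one inf in blast)+
qed

lemma gap_mid:
  assumes gap: "gap d \<nu> l r"
  shows "gap_mid d \<nu> l r \<in> itineraries d \<nu> \<inter> full_seqs d \<and>
    diff l (gap_mid d \<nu> l r) = \<infinity> \<and> diff (gap_mid d \<nu> l r) r = \<infinity>"
proof -
  have inf: "\<not> differ (l i) (r i)" for i using gap by (simp add: gap_iff diff_eq_infinity_iff)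
  have letter: "l i = Star \<or> l i \<in> alphabet d" "r i = Star \<or> r i \<in> alphabet d"
    and nc: "\<not> (l i = Star \<and> r i = Star)" for i
    using gap_cell_inv[OF gap] early_letter unfolding cell_inv_def by blast+
  define w where "w = (\<lambda>i. if l i = Star then r i else l i)"
  have full: "w \<in> full_seqs d" using letter nc by (fastforce simp: w_def full_seqs_def)
  have w: "diff l w = \<infinity>" "diff w r = \<infinity>"
    using inf by (auto simp: diff_eq_infinity_iff w_def)
  have wI: "w \<in> itineraries d \<nu> \<inter> full_seqs d \<and> diff l w = \<infinity> \<and> diff w r = \<infinity>"
    using full full_itinerary[OF gap_starry[OF gap] full] w by blast
  have "gap_mid d \<nu> l r = w"
    unfolding gap_mid_def
  proof (rule the_equality)
    show "w \<in> itineraries d \<nu> \<inter> full_seqs d \<and> diff l w = \<infinity> \<and> diff w r = \<infinity>" by (rule wI)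
  next
    fix v assume v: "v \<in> itineraries d \<nu> \<inter> full_seqs d \<and> diff l v = \<infinity> \<and> diff v r = \<infinity>"
    show "v = w"
    proof (rule ext)
      fix i
      have "v i \<noteq> Star" using v full_seqs_not_Star by blast
      then show "v i = w i" using v nc[of i] by (auto simp: w_def diff_eq_infinity_iff differ_def)
    qed
  qed
  then show ?thesis using wI by simp
qed

lemma M_setD:
  assumes "a \<in> M_set d \<nu>"
  shows "a \<in> L" "starry" "a \<notin> P" "\<exists>x\<in>P. precritical d \<nu> x \<and> diff a x = \<infinity>"
proof -
  show L: "a \<in> L" and x: "\<exists>x\<in>P. precritical d \<nu> x \<and> diff a x = \<infinity>"
    using assms by (auto simp: M_set_def)
  have a: "a \<in> itineraries d \<nu>" "a \<in> full_seqs d" using L by (auto simp: L_set_iff)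
  show starry
  proof (rule ccontr)
    assume ns: "\<not> starry"
    obtain w where "diff a (pre w) = \<infinity>" using x by (auto simp: precritical_iff)
    then have "suffix (Suc (length w)) a = \<nu>"
      using match_precritical[OF ns] a(2) full_seqs_not_Star by blast
    then show False using itinerary_not_preimage[OF ns a] by blast
  qed
  then show "a \<notin> P" using P_precritical precritical_not_full a(2) by blast
qed

section \<open>Limits are determined by their position\<close>

text \<open>A limit inherits the common word of every cell in which its approximating sequence ends up.\<close>

lemma trapped:
  assumes "approaches s a" "\<And>i. a i \<noteq> Star" and cell: "cell n x (f x) y (f y)"
    and ev: "in_cell s x y"
  shows "diff x y \<noteq> \<infinity>"
    "enat (Suc i) < diff x y \<Longrightarrow> \<not> differ (a i) (x i) \<and> \<not> differ (a i) (y i)"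
proof -
  have sP: "s m \<in> P" for m using assms(1) by (simp add: approaches_def)
  show "diff x y \<noteq> \<infinity>"
  proof
    assume "diff x y = \<infinity>"
    then have "gap d \<nu> x y" using cell_f[OF cell] cell_less[OF cell] by (simp add: gap_iff)
    moreover obtain m where "f x < f (s m)" "f (s m) < f y" using ev
      by (auto simp: eventually_sequentially)
    ultimately show False using gap_no_between[OF _ sP, of x y m] by fastforce
  qed
  assume i: "enat (Suc i) < diff x y"
  have "\<forall>\<^sub>F m in sequentially. enat (Suc i) < diff (s m) a"
    using assms(1) by (simp add: approaches_def)
  from eventually_conj[OF ev this]
  have "\<forall>\<^sub>F m in sequentially. (f x < f (s m) \<and> f (s m) < f y) \<and> enat (Suc i) < diff (s m) a" .
  then obtain m where m: "f x < f (s m)" "f (s m) < f y" "enat (Suc i) < diff (s m) a"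
    by (auto simp: eventually_sequentially)
  obtain k where "(s m, f (s m)) \<in> Q k" using P_Q sP by blast
  then have "s m i \<noteq> Star \<and> \<not> differ (s m i) (x i) \<and> \<not> differ (s m i) (y i)"
    using cell_interior[OF cell _ m(1,2) i] by blast
  moreover have "\<not> differ (s m i) (a i)" using m(3) by (auto simp: less_diff_iff)
  ultimately show "\<not> differ (a i) (x i) \<and> \<not> differ (a i) (y i)"
    by (auto simp: differ_def)
qed

lemma same_cells_same_limit:
  assumes "approaches s a" "\<And>i. a i \<noteq> Star" "approaches s' a'" "\<And>i. a' i \<noteq> Star"
    and cells: "\<And>n. \<exists>x y. cell n x (f x) y (f y) \<and>
        in_cell s x y \<and>
        in_cell s' x y"
  shows "a = a'"
proof (rule ext)
  fix i
  obtain x y where cell: "cell (Suc i) x (f x) y (f y)"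
    and ev: "in_cell s x y"
      "in_cell s' x y"
    using cells by blast
  have "enat (Suc i) < diff x y"
    using cell_not_gap[OF cell] trapped(1)[OF assms(1,2) cell ev(1)] by blast
  then have "\<not> differ (a i) (x i) \<and> \<not> differ (a i) (y i)"
    "\<not> differ (a' i) (x i) \<and> \<not> differ (a' i) (y i)"
    using trapped(2)[OF assms(1,2) cell ev(1)] trapped(2)[OF assms(3,4) cell ev(2)] by blast+
  moreover have "\<not> (x i = Star \<and> y i = Star)" using cell_inv[OF cell] by (simp add: cell_inv_def)
  ultimately show "a i = a' i" using assms(2,4) by (auto simp: differ_def)
qed

lemma L_set_no_Star: "a \<in> L \<Longrightarrow> a i \<noteq> Star"
  using full_seqs_not_Star by (auto simp: L_set_iff)

lemma increasing_monotone: "increasing_to d \<nu> s a \<Longrightarrow> monotone_to s a"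
  and decreasing_monotone: "decreasing_to d \<nu> s a \<Longrightarrow> monotone_to s a"
  by (simp_all add: monotone_to_def)

lemma increasing_in_left_cell:
  assumes "a \<in> L" "a \<notin> P" "increasing_to d \<nu> s a" "f x < val a" "val a \<le> f y"
  shows "in_cell s x y"
proof -
  have "\<forall>\<^sub>F m in sequentially. f x < f (s m)"
    using phi_L_set[OF assms(1,2) increasing_monotone[OF assms(3)]] assms(4)
    by (simp add: order_tendsto_iff)
  then show ?thesis
    using phi_increasing[OF assms(1-3)] assms(5) by (auto elim!: eventually_mono intro: less_le_trans)
qed

lemma decreasing_in_right_cell:
  assumes "a \<in> L" "a \<notin> P" "decreasing_to d \<nu> s a" "f x \<le> val a" "val a < f y"
  shows "in_cell s x y"
proof -
  have "\<forall>\<^sub>F m in sequentially. f (s m) < f y"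
    using phi_L_set[OF assms(1,2) decreasing_monotone[OF assms(3)]] assms(5)
    by (simp add: order_tendsto_iff)
  then show ?thesis
    using phi_decreasing[OF assms(1-3)] assms(4) by (auto elim!: eventually_mono intro: le_less_trans)
qed

lemma phi_L_set_range:
  assumes "a \<in> L" "a \<notin> P"
  shows "0 \<le> val a" "val a \<le> 1"
    "increasing_to d \<nu> s a \<Longrightarrow> 0 < val a" "decreasing_to d \<nu> s a \<Longrightarrow> val a < 1"
proof -
  obtain s where s: "monotone_to s a" using assms(1) by (auto simp: L_set_iff)
  have r: "0 \<le> f (s n)" "f (s n) \<le> 1" for n using monotone_to_simps(2)[OF s] f_range by blast+
  show "0 \<le> val a"
    using phi_L_set[OF assms s] r by (intro LIMSEQ_le_const) blast+
  show "val a \<le> 1"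
    using phi_L_set[OF assms s] r by (intro LIMSEQ_le_const2) blast+
next
  assume s: "increasing_to d \<nu> s a"
  have "0 \<le> f (s 0)" using s f_range by (auto simp: increasing_to_iff approaches_def)
  then show "0 < val a" using phi_increasing[OF assms s, of 0] by simp
next
  assume s: "decreasing_to d \<nu> s a"
  have "f (s 0) \<le> 1" using s f_range by (auto simp: decreasing_to_iff approaches_def)
  then show "val a < 1" using phi_decreasing[OF assms s, of 0] by simp
qed

lemma increasing_unique:
  assumes a: "a \<in> L" "a \<notin> P" "increasing_to d \<nu> s a"
    and b: "b \<in> L" "b \<notin> P" "increasing_to d \<nu> s' b" and eq: "val a = val b"
  shows "a = b"
proof (rule same_cells_same_limit[of s a s' b])
  fix n
  obtain x y where "cell n x (f x) y (f y)" "f x < val a" "val a \<le> f y"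
    using cell_at_left[of "val a" n] phi_L_set_range[OF a(1,2)] a(3) by blast
  then show "\<exists>x y. cell n x (f x) y (f y) \<and>
        in_cell s x y \<and>
        in_cell s' x y"
    using increasing_in_left_cell[OF a, of x y] increasing_in_left_cell[OF b, of x y] eq
    by (intro exI[of _ x] exI[of _ y]) simp
qed (use a b L_set_no_Star monotone_to_simps(1) increasing_monotone in blast)+

lemma decreasing_unique:
  assumes a: "a \<in> L" "a \<notin> P" "decreasing_to d \<nu> s a"
    and b: "b \<in> L" "b \<notin> P" "decreasing_to d \<nu> s' b" and eq: "val a = val b"
  shows "a = b"
proof (rule same_cells_same_limit[of s a s' b])
  fix n
  obtain x y where "cell n x (f x) y (f y)" "f x \<le> val a" "val a < f y"
    using cell_at_right[of "val a" n] phi_L_set_range[OF a(1,2)] a(3) by blast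
  then show "\<exists>x y. cell n x (f x) y (f y) \<and>
        in_cell s x y \<and>
        in_cell s' x y"
    using decreasing_in_right_cell[OF a, of x y] decreasing_in_right_cell[OF b, of x y] eq
    by (intro exI[of _ x] exI[of _ y]) simp
qed (use a b L_set_no_Star monotone_to_simps(1) decreasing_monotone in blast)+

lemma L_set_strict_cell:
  assumes a: "a \<in> L" "a \<notin> P" "monotone_to s a" and xy: "f x < val a" "val a < f y"
  shows "in_cell s x y"
  using phi_L_set[OF a] xy by (auto simp: order_tendsto_iff intro: eventually_conj)

text \<open>At a position not taken by \<open>P_inf\<close> the direction of approach is irrelevant, since every cell
  contains the position in its interior.\<close>

lemma interior_unique:
  assumes a: "a \<in> L" "a \<notin> P" and b: "b \<in> L" "b \<notin> P"
    and eq: "val a = val b" and notP: "val a \<notin> f ` P"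
  shows "a = b"
proof -
  obtain s s' where s: "monotone_to s a" "monotone_to s' b" using a b by (auto simp: L_set_iff)
  have "0 < val a" "val a \<le> 1"
    using phi_L_set_range(1,2)[OF a] notP ends_P by (force simp: order_le_less)+
  show ?thesis
  proof (rule same_cells_same_limit[of s a s' b])
    fix n
    obtain x y where xy: "cell n x (f x) y (f y)" "f x < val a" "val a \<le> f y"
      using cell_at_left[of "val a" n] \<open>0 < val a\<close> \<open>val a \<le> 1\<close> by blast
    moreover have "val a < f y" using xy notP cell_f[OF xy(1)] by (force simp: order_le_less)
    ultimately show "\<exists>x y. cell n x (f x) y (f y) \<and>
        in_cell s x y \<and>
        in_cell s' x y"
      using L_set_strict_cell[OF a s(1), of x y] L_set_strict_cell[OF b s(2), of x y] eq
      by (intro exI[of _ x] exI[of _ y]) simp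
  qed (use a b s L_set_no_Star monotone_to_simps(1) in blast)+
qed

text \<open>At a level where \<open>p\<close> is present, \<open>p\<close> is an end of the cell that traps a sequence converging to its
  position.  Hence the limit does not differ from \<open>p\<close>.\<close>

lemma limit_at_P:
  assumes a: "a \<in> L" "a \<notin> P" and p: "p \<in> P" and eq: "val a = f p"
  shows "a \<in> M_set d \<nu>"
proof -
  obtain k where k: "(p, f p) \<in> Q k" using P_Q p by blast
  obtain s where s: "monotone_to s a" using a by (auto simp: L_set_iff)
  note ap = monotone_to_simps(1)[OF s]
  have no_star: "\<And>i. a i \<noteq> Star" using L_set_no_Star a(1) .
  have "\<not> differ (a i) (p i)" for i
  proof -
    \<comment> \<open>From this level on, \<open>p\<close> is an end of cells and the symbol at \<open>i\<close> is fixed inside non-gaps.\<close>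
    define n where "n = Suc i + k"
    have pn: "(p, f p) \<in> Q n" using k Q_mono[of k n] by (auto simp: n_def)
    have long: "enat (Suc i) < diff x y" if "cell n x (f x) y (f y)" "diff x y \<noteq> \<infinity>" for x y
      using cell_not_gap[OF that] by (auto simp: n_def intro: order_le_less_trans[rotated])
    show ?thesis
    proof (cases "increasing_to d \<nu> s a")
      case True
      obtain x y where xy: "cell n x (f x) y (f y)" "f x < val a" "val a \<le> f y"
        using cell_at_left[of "val a" n] phi_L_set_range[OF a] True by blast
      have "f p = f y" using cell_no_between[OF xy(1) pn] xy eq by auto
      then have "y = p" using f_inj p cell_f[OF xy(1)] by metis
      then show ?thesis
        using trapped[OF ap no_star xy(1) increasing_in_left_cell[OF a True xy(2,3)]] long[OF xy(1)] by blast
    next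
      case False
      then have dec: "decreasing_to d \<nu> s a" using s by (simp add: monotone_to_def)
      obtain x y where xy: "cell n x (f x) y (f y)" "f x \<le> val a" "val a < f y"
        using cell_at_right[of "val a" n] phi_L_set_range[OF a] dec by blast
      have "f p = f x" using cell_no_between[OF xy(1) pn] xy eq by auto
      then have "x = p" using f_inj p cell_f[OF xy(1)] by metis
      then show ?thesis
        using trapped[OF ap no_star xy(1) decreasing_in_right_cell[OF a dec xy(2,3)]] long[OF xy(1)] by blast
    qed
  qed
  then have inf: "diff a p = \<infinity>" by (simp add: diff_eq_infinity_iff)
  have "precritical d \<nu> p"
  proof (rule ccontr)
    assume "\<not> precritical d \<nu> p"
    then have "p = \<nu>" "\<not> starry" using P_form[OF p] P_precritical p by blast+
    then have "a = p"
      using inf no_star not_starryD(3) by (auto simp: fun_eq_iff diff_eq_infinity_iff differ_def)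
    then show False using a(2) p by simp
  qed
  then show ?thesis using a(1) p inf by (auto simp: M_set_def)
qed


section \<open>Every position is taken by a vertex or lies in a gap\<close>

text \<open>Without differences the arm is just shifted.\<close>

lemma arm_follow:
  assumes "arm \<nu> y x0 k = suffix k x" "\<And>i. \<lbrakk>k \<le> i; i < k + m\<rbrakk> \<Longrightarrow> \<not> differ (x i) (y i)"
  shows "arm \<nu> y x0 (k + m) = suffix (k + m) x \<and> (\<forall>i. k \<le> i \<and> i < k + m \<longrightarrow> i \<notin> hits \<nu> y x0)"
  using assms(2)
proof (induction m)
  case 0
  then show ?case using assms(1) by auto
next
  case (Suc m)
  have "arm \<nu> y x0 (k + m) = suffix (k + m) x \<and> (\<forall>i. k \<le> i \<and> i < k + m \<longrightarrow> i \<notin> hits \<nu> y x0)"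
    by (rule Suc.IH) (rule Suc.prems, simp_all)
  then have IH: "arm \<nu> y x0 (k + m) = suffix (k + m) x" "\<forall>i. k \<le> i \<and> i < k + m \<longrightarrow> i \<notin> hits \<nu> y x0"
    by blast+
  have nd: "\<not> differ (arm \<nu> y x0 (k + m) 0) (y (k + m))" using IH(1) Suc.prems[of "k + m"] by simp
  then have "arm \<nu> y x0 (k + Suc m) = suffix (k + Suc m) x" using IH(1) by (simp add: suffix_def)
  moreover have "k + m \<notin> hits \<nu> y x0" using nd by (simp add: hits_def)
  ultimately show ?case using IH(2) by (auto simp: less_Suc_eq)
qed

lemma arm_replaced:
  assumes "arm \<nu> y x0 k = suffix k x" "differ (x k) (y k)" "length w = k"
  shows "k \<in> hits \<nu> y x0 \<and> arm \<nu> y x0 (Suc k) = suffix (Suc k) (pre w)"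
  using assms pre_nth(3)[of w] by (auto simp: hits_def suffix_def)

text \<open>While an end of the cells stays, the arm that it traces is just shifted,
  and when the end is replaced
  by an inserted point, the arm has a hit; both the new end and the arm then continue with \<open>\<nu>\<close>.\<close>

lemma hits_of_cell_ends:
  assumes agree: "\<And>n i. i < K n \<Longrightarrow> \<not> differ (Z n i) (a i)"
    and mono: "strict_mono K" and w: "\<And>n. length (w n) = K n"
    and step: "\<And>n. Z (Suc n) = Z n \<and> \<not> differ (Z n (K n)) (a (K n)) \<or>
                    Z (Suc n) = pre (w n) \<and> differ (Z n (K n)) (a (K n))"
  shows "hits \<nu> a (Z 0) = {K n | n. differ (Z n (K n)) (a (K n))}"
proof -
  have "arm \<nu> a (Z 0) (K n) = suffix (K n) (Z n) \<and>
      (\<forall>j<K n. j \<in> hits \<nu> a (Z 0) \<longleftrightarrow> (\<exists>m. j = K m \<and> differ (Z m (K m)) (a (K m))))" for n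
  proof (induction n)
    case 0
    have "j \<noteq> K m" if "j < K 0" for j m
      using that strict_mono_less_eq[OF mono, of 0 m] by auto
    then show ?case
      using arm_follow[of a "Z 0" 0 "Z 0" "K 0"] agree[of _ 0] by auto
  next
    case (Suc n)
    have arm: "arm \<nu> a (Z 0) (K n) = suffix (K n) (Z n)" using Suc by blast
    have next_arm: "arm \<nu> a (Z 0) (Suc (K n)) = suffix (Suc (K n)) (Z (Suc n)) \<and>
        (K n \<in> hits \<nu> a (Z 0) \<longleftrightarrow> differ (Z n (K n)) (a (K n)))"
      using step[of n]
    proof (elim disjE conjE)
      assume Z: "Z (Suc n) = Z n" and nd: "\<not> differ (Z n (K n)) (a (K n))"
      have "\<not> differ (arm \<nu> a (Z 0) (K n) 0) (a (K n))" unfolding arm using nd by simp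
      moreover from this have "arm \<nu> a (Z 0) (Suc (K n)) = suffix (Suc (K n)) (Z n)"
        using arm by (simp add: suffix_def)
      ultimately show ?thesis unfolding Z using nd by (simp only: hits_def mem_Collect_eq simp_thms)
    next
      assume Z: "Z (Suc n) = pre (w n)" and df: "differ (Z n (K n)) (a (K n))"
      show ?thesis unfolding Z using arm_replaced[OF arm df w] df by blast
    qed
    define m where "m = K (Suc n) - Suc (K n)"
    have m: "Suc (K n) + m = K (Suc n)" using strict_monoD[OF mono, of n "Suc n"] by (simp add: m_def)
    have follow: "arm \<nu> a (Z 0) (K (Suc n)) = suffix (K (Suc n)) (Z (Suc n)) \<and>
        (\<forall>i. Suc (K n) \<le> i \<and> i < K (Suc n) \<longrightarrow> i \<notin> hits \<nu> a (Z 0))"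
      using arm_follow[OF conjunct1[OF next_arm], of m] agree unfolding m by blast
    have "j \<in> hits \<nu> a (Z 0) \<longleftrightarrow> (\<exists>m. j = K m \<and> differ (Z m (K m)) (a (K m)))"
      if j: "j < K (Suc n)" for j
    proof -
      consider "j < K n" | "j = K n" | "Suc (K n) \<le> j" by linarith
      then show ?thesis
      proof cases
        case 1
        then show ?thesis using Suc by blast
      next
        case 2
        then show ?thesis using next_arm strict_mono_eq[OF mono] by auto
      next
        case 3
        have "j \<noteq> K m" for m
          using 3 j strict_mono_less[OF mono, of n m] strict_mono_less[OF mono, of m "Suc n"] by auto
        then show ?thesis using follow 3 j by blast
      qed
    qed
    then show ?case using follow by blast
  qed
  moreover have "j < K (Suc j)" for j using strict_mono_imp_increasing[OF mono, of "Suc j"] by simp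
  ultimately show ?thesis by blast
qed

text \<open>Every replacement of the left end of the cells is a hit of the arm at \<open>a\<close> that starts at the
  critical point, and every replacement of the right end is a hit of the arm that starts at \<open>\<nu>\<close>.
  Only one end is replaced at a time, so the two arms have no hit in common.  If the \<open>k\<close>-th shift of
  \<open>a\<close> were \<open>\<nu>\<close>, then the shifted arms would exhibit \<open>\<nu>\<close> strictly between two points of its orbit.\<close>

lemma nested_limit_not_preimage:
  assumes ns: "\<not> starry"
    and cells: "\<And>n. cell n (X n) (f (X n)) (Y n) (f (Y n))"
    and inside: "\<And>n. f (X n) < t" "\<And>n. t < f (Y n)"
    and step: "\<And>n. X (Suc n) = X n \<and> Y (Suc n) = ins (X n) (Y n) \<or>
                    X (Suc n) = ins (X n) (Y n) \<and> Y (Suc n) = Y n"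
    and fin: "\<And>n. diff (X n) (Y n) \<noteq> \<infinity>"
    and trap: "\<And>n i. enat (Suc i) < diff (X n) (Y n) \<Longrightarrow>
                 \<not> differ (a i) (X n i) \<and> \<not> differ (a i) (Y n i)"
    and no_star: "\<And>i. a i \<noteq> Star"
    and "0 < k"
  shows "suffix k a \<noteq> \<nu>"
proof
  assume suf: "suffix k a = \<nu>"
  interpret nonperiodic_word \<nu>
    using not_starryD(2,3)[OF ns] by unfold_locales
  have "\<exists>K w. diff (X n) (Y n) = enat (Suc K) \<and> differ (X n K) (Y n K) \<and> length w = K \<and>
      ins (X n) (Y n) = pre w \<and> diff (X n) (Y n) < diff (X n) (pre w) \<and>
      diff (X n) (Y n) < diff (pre w) (Y n)" for n
    using cell_midE[OF cells fin, of n] by metis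
  then obtain K w where K: "\<And>n. diff (X n) (Y n) = enat (Suc (K n))"
    "\<And>n. differ (X n (K n)) (Y n (K n))" "\<And>n. length (w n) = K n"
    "\<And>n. ins (X n) (Y n) = pre (w n)"
    "\<And>n. diff (X n) (Y n) < diff (X n) (pre (w n))" "\<And>n. diff (X n) (Y n) < diff (pre (w n)) (Y n)"
    by metis
  have less: "K n < K (Suc n)" for n
  proof -
    have "diff (X n) (Y n) < diff (X (Suc n)) (Y (Suc n))" using step[of n] K(4-6) by metis
    then show ?thesis by (simp add: K(1))
  qed
  then have mono: "strict_mono K" by (simp add: strict_mono_Suc_iff)
  have agree: "\<not> differ (X n i) (a i)" "\<not> differ (Y n i) (a i)" if "i < K n" for n i
    using trap[of i n] that by (simp_all add: K(1) differ_commute)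
  \<comment> \<open>The kept end has the symbol of \<open>a\<close> where the ends differ, and the replaced one does not.\<close>
  have moves: "X (Suc n) = X n \<and> Y (Suc n) = pre (w n) \<and>
        \<not> differ (X n (K n)) (a (K n)) \<and> differ (Y n (K n)) (a (K n)) \<or>
      X (Suc n) = pre (w n) \<and> Y (Suc n) = Y n \<and>
        differ (X n (K n)) (a (K n)) \<and> \<not> differ (Y n (K n)) (a (K n))" for n
    using step[of n] agree[OF less] K(2)[of n] no_star[of "K n"] unfolding K(4) differ_def by metis
  have start: "X 0 = crit" "Y 0 = \<nu>" using cells[of 0] by (auto simp: cell_0)
  have hX: "hits \<nu> a (crit) = {K n | n. differ (X n (K n)) (a (K n))}"
  proof -
    have "hits \<nu> a (X 0) = {K n | n. differ (X n (K n)) (a (K n))}"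
      by (rule hits_of_cell_ends[OF agree(1) mono K(3)]) (use moves in blast)+
    then show ?thesis by (simp only: start)
  qed
  have hY: "hits \<nu> a \<nu> = {K n | n. differ (Y n (K n)) (a (K n))}"
  proof -
    have "hits \<nu> a (Y 0) = {K n | n. differ (Y n (K n)) (a (K n))}"
      by (rule hits_of_cell_ends[OF agree(2) mono K(3)]) (use moves in blast)+
    then show ?thesis by (simp only: start)
  qed
  have disjoint: "hits \<nu> a (crit) \<inter> hits \<nu> a \<nu> = {}"
  proof (rule ccontr)
    assume "\<not> ?thesis"
    then obtain n m where nm: "K n = K m" "differ (X n (K n)) (a (K n))" "differ (Y m (K m)) (a (K m))"
      unfolding hX hY by auto
    then have "n = m" using strict_mono_eq[OF mono] by simp
    then show False using nm(2,3) moves[of n] by simp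
  qed
  \<comment> \<open>The cells shrink to a position different from all their ends, so both ends move infinitely
    often.\<close>
  have length: "f (Y n) - f (X n) = 1 / 2 ^ n" for n
    using cell_not_gap[OF cells fin] by blast
  have moving: "\<exists>n\<ge>m. Z (Suc n) \<noteq> Z n"
    if Z: "\<And>n. f (Z n) \<noteq> t" "\<And>n. \<bar>f (Z n) - t\<bar> < 1 / 2 ^ n" for Z m
  proof (rule ccontr)
    assume "\<not> ?thesis"
    then have const: "Z (m + i) = Z m" for i by (induction i) auto
    obtain i where i: "1 / 2 ^ i < \<bar>f (Z m) - t\<bar>" using small_power[of "\<bar>f (Z m) - t\<bar>"] Z(1)[of m]
      by auto
    have "(1::real) / 2 ^ (m + i) \<le> 1 / 2 ^ i" by (simp add: frac_le)
    then show False using Z(2)[of "m + i"] const[of i] i by simp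
  qed
  have far: "\<exists>i. k + i = K n" if "k \<le> n" for n
    using that strict_mono_imp_increasing[OF mono, of n] by (metis le_Suc_ex order_trans)
  have near: "\<bar>f (X n) - t\<bar> < 1 / 2 ^ n" "\<bar>f (Y n) - t\<bar> < 1 / 2 ^ n" for n
    using length[of n] inside(1)[of n] inside(2)[of n] by linarith+
  have hitX: "\<exists>i. k + i \<in> hits \<nu> a (crit)"
  proof -
    obtain n where n: "n \<ge> k" "X (Suc n) \<noteq> X n"
      using moving[OF less_imp_neq[OF inside(1)] near(1)] by blast
    have "differ (X n (K n)) (a (K n))" using moves[of n] n(2) by simp
    moreover obtain i where "k + i = K n" using far[OF n(1)] by blast
    ultimately show ?thesis unfolding hX by auto
  qed
  have hitY: "\<exists>i. k + i \<in> hits \<nu> a \<nu>"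
  proof -
    obtain n where n: "n \<ge> k" "Y (Suc n) \<noteq> Y n"
      using moving[OF not_sym[OF less_imp_neq[OF inside(2)]] near(2)] by blast
    have "differ (Y n (K n)) (a (K n))" using moves[of n] n(2) by simp
    moreover obtain i where "k + i = K n" using far[OF n(1)] by blast
    ultimately show ?thesis unfolding hY by auto
  qed
  have c0: "\<nu> = suffix 0 \<nu>" by simp
  obtain j where j: "arm \<nu> a \<nu> k = suffix j \<nu>" using arm_c[of a 0 k] c0 by metis
  have L1: "arm \<nu> a (crit) 1 = suffix 0 \<nu>" by (simp add: suffix_def fun_eq_iff)
  have "arm \<nu> a (crit) (1 + (k - 1)) = arm \<nu> (suffix 1 a) (arm \<nu> a (crit) 1) (k - 1)" by (rule arm_add)
  then have "arm \<nu> a (crit) k = arm \<nu> (suffix 1 a) (suffix 0 \<nu>) (k - 1)" using \<open>0 < k\<close>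
    unfolding L1 by simp
  then obtain i where i: "arm \<nu> a (crit) k = suffix i \<nu>" using arm_c[of "suffix 1 a" 0 "k - 1"] by metis
  have hL': "n \<in> hits \<nu> \<nu> (suffix i \<nu>) \<longleftrightarrow> k + n \<in> hits \<nu> a (crit)" for n
    using hits_add[of k n \<nu> a "crit"] unfolding suf i by blast
  have hR': "n \<in> hits \<nu> \<nu> (suffix j \<nu>) \<longleftrightarrow> k + n \<in> hits \<nu> a \<nu>" for n
    using hits_add[of k n \<nu> a \<nu>] unfolding suf j by blast
  have none: "n \<notin> hits \<nu> \<nu> \<nu>" for n
    using arm_follow[of \<nu> \<nu> 0 \<nu> "Suc n"] by simp
  have "suffix i \<nu> \<noteq> \<nu>" using hitX hL' none by metis
  moreover have "suffix j \<nu> \<noteq> \<nu>" using hitY hR' none by metis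
  moreover have "\<not> same_arm \<nu> \<nu> (suffix i \<nu>) (suffix j \<nu>)"
    unfolding same_arm_def using disjoint hL' hR' by blast
  ultimately have "strictly_between \<nu> \<nu> (suffix i \<nu>) (suffix j \<nu>)"
    by (simp only: strictly_between_def simp_thms)
  then show False using critical_value_endpoint by blast
qed

text \<open>A position strictly inside a cell that is neither a gap nor bisected exactly there lies strictly
  inside one of the halves.\<close>

lemma nested_cells:
  assumes t: "0 < t" "t < 1" "t \<notin> f ` P" and no_gap: "\<And>l r. gap d \<nu> l r \<Longrightarrow> \<not> (f l < t \<and> t < f r)"
  shows "\<exists>X Y. \<forall>n. cell n (X n) (f (X n)) (Y n) (f (Y n)) \<and> f (X n) < t \<and> t < f (Y n) \<and>
    (X (Suc n) = X n \<and> Y (Suc n) = ins (X n) (Y n) \<or>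
     X (Suc n) = ins (X n) (Y n) \<and> Y (Suc n) = Y n) \<and>
    diff (X n) (Y n) \<noteq> \<infinity>"
proof -
  have fin: "diff x y \<noteq> \<infinity>" if "cell n x (f x) y (f y)" "f x < t" "t < f y" for n x y
  proof
    assume "diff x y = \<infinity>"
    then have "gap d \<nu> x y" using cell_f[OF that(1)] that by (simp add: gap_iff)
    then show False using no_gap that by blast
  qed
  define In where
    "In n p \<longleftrightarrow> cell n (fst p) (f (fst p)) (snd p) (f (snd p)) \<and> f (fst p) < t \<and> t < f (snd p)"
    for n p
  define Half where "Half p q \<longleftrightarrow> fst q = fst p \<and> snd q = ins (fst p) (snd p) \<or>
      fst q = ins (fst p) (snd p) \<and> snd q = snd p" for p q
  have "\<exists>F. \<forall>n. In n (F n) \<and> Half (F n) (F (Suc n))"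
  proof (rule dependent_nat_choice)
    have "In 0 (crit, \<nu>)"
      using ends_P t by (simp add: In_def cell_0)
    then show "\<exists>p. In 0 p" by blast
  next
    fix p n assume p: "In n p"
    then have cell: "cell n (fst p) (f (fst p)) (snd p) (f (snd p))" by (simp add: In_def)
    let ?c = "ins (fst p) (snd p)"
    have "diff (fst p) (snd p) \<noteq> \<infinity>" using fin p unfolding In_def by blast
    note halves = cell_Suc_split[OF cell this]
    have c: "?c \<in> P" "f ?c = (f (fst p) + f (snd p)) / 2" using cell_f[OF halves(1)] by simp_all
    have cells: "cell (Suc n) (fst p) (f (fst p)) ?c (f ?c)"
      "cell (Suc n) ?c (f ?c) (snd p) (f (snd p))"
      unfolding c(2) by (rule halves)+
    show "\<exists>q. In (Suc n) q \<and> Half p q"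
    proof (cases "t < f ?c")
      case True
      then have "In (Suc n) (fst p, ?c)" using p cells(1) by (simp add: In_def)
      then show ?thesis by (auto simp: Half_def)
    next
      case False
      moreover have "t \<noteq> f ?c" using t(3) c(1) by blast
      ultimately have "In (Suc n) (?c, snd p)" using p cells(2) by (simp add: In_def)
      then show ?thesis by (auto simp: Half_def)
    qed
  qed
  then obtain F where F: "\<And>n. In n (F n)" "\<And>n. Half (F n) (F (Suc n))" by blast
  show ?thesis
  proof (rule exI[of _ "\<lambda>n. fst (F n)"], rule exI[of _ "\<lambda>n. snd (F n)"], intro allI conjI)
    fix n
    show cell: "cell n (fst (F n)) (f (fst (F n))) (snd (F n)) (f (snd (F n)))"
      and less: "f (fst (F n)) < t" "t < f (snd (F n))"
      using F(1)[of n] by (simp_all add: In_def)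
    show "diff (fst (F n)) (snd (F n)) \<noteq> \<infinity>" using fin cell less by blast
    show "fst (F (Suc n)) = fst (F n) \<and> snd (F (Suc n)) = ins (fst (F n)) (snd (F n)) \<or>
        fst (F (Suc n)) = ins (fst (F n)) (snd (F n)) \<and> snd (F (Suc n)) = snd (F n)"
      using F(2)[of n] by (simp add: Half_def)
  qed
qed

lemma P_letter: "x \<in> P \<Longrightarrow> x i = Star \<or> x i \<in> alphabet d"
  using P_form[of x] \<nu>_letter pre_letter by (auto simp: precritical_iff)

text \<open>The approximating sequence is chosen increasing, with its \<open>n\<close>-th member inside the cell of level
  \<open>n\<close> and below \<open>t\<close>; from then on it stays in that cell, so that its symbols stabilise.\<close>

lemma interior_limit_exists:
  assumes t: "0 < t" "t < 1" "t \<notin> f ` P" and no_gap: "\<And>l r. gap d \<nu> l r \<Longrightarrow> \<not> (f l < t \<and> t < f r)"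
  shows "\<exists>a \<in> L. a \<notin> P \<and> val a = t"
proof -
  obtain X Y where cells: "\<And>n. cell n (X n) (f (X n)) (Y n) (f (Y n))"
    and inside: "\<And>n. f (X n) < t" "\<And>n. t < f (Y n)"
    and step: "\<And>n. X (Suc n) = X n \<and> Y (Suc n) = ins (X n) (Y n) \<or>
          X (Suc n) = ins (X n) (Y n) \<and> Y (Suc n) = Y n"
    and fin: "\<And>n. diff (X n) (Y n) \<noteq> \<infinity>"
    using nested_cells[OF assms] by blast
  have length: "f (Y n) - f (X n) = 1 / 2 ^ n" and long: "enat n < diff (X n) (Y n)" for n
    using cell_not_gap[OF cells fin] by blast+
  have dense: "\<exists>p\<in>P. u < f p \<and> f p < t" if "0 \<le> u" "u < t" for u
  proof -
    have "\<not> (\<exists>l r. gap d \<nu> l r \<and> f l \<le> u \<and> t \<le> f r)"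
    proof
      assume "\<exists>l r. gap d \<nu> l r \<and> f l \<le> u \<and> t \<le> f r"
      then obtain l r where lr: "gap d \<nu> l r" "f l \<le> u" "t \<le> f r" by blast
      then have "r \<in> P" by (simp add: gap_iff)
      then have "t < f r" using lr(3) t(3) by (metis image_eqI order_le_less)
      then show False using no_gap[OF lr(1)] lr(2) \<open>u < t\<close> by simp
    qed
    then show ?thesis using P_dense[of u t] that t by auto
  qed
  have XP: "X n \<in> P" for n using cell_f[OF cells] by blast
  have "\<exists>s. \<forall>n. (s n \<in> P \<and> f (X n) < f (s n) \<and> f (s n) < t) \<and> f (s n) < f (s (Suc n))"
  proof (rule dependent_nat_choice)
    show "\<exists>x. x \<in> P \<and> f (X 0) < f x \<and> f x < t"
      using dense[OF _ inside(1)[of 0]] f_range[OF XP[of 0]] by blast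
    fix x n assume x: "x \<in> P \<and> f (X n) < f x \<and> f x < t"
    have "0 \<le> max (f x) (f (X (Suc n)))" "max (f x) (f (X (Suc n))) < t"
      using x inside f_range XP by (auto simp: le_max_iff_disj)
    then show "\<exists>y. (y \<in> P \<and> f (X (Suc n)) < f y \<and> f y < t) \<and> f x < f y"
      using dense[of "max (f x) (f (X (Suc n)))"] by auto
  qed
  then obtain s where s: "\<And>n. s n \<in> P" "\<And>n. f (X n) < f (s n)" "\<And>n. f (s n) < t"
    "\<And>n. f (s n) < f (s (Suc n))" by blast
  have s_mono: "f (s n) \<le> f (s m)" if "n \<le> m" for n m
    by (rule lift_Suc_mono_le[of "\<lambda>n. f (s n)"]) (use s(4) that less_imp_le in blast)+
  have s_in: "f (X n) < f (s m)" "f (s m) < f (Y n)" if "n \<le> m" for n m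
    using s_mono[OF that] s(2)[of n] s(3)[of m] inside(2)[of n] by linarith+
  have s_entry: "s m i \<noteq> Star \<and> \<not> differ (s m i) (X n i) \<and> \<not> differ (s m i) (Y n i)"
    if "n \<le> m" "i < n" for n m i
  proof -
    obtain q where "(s m, f (s m)) \<in> Q q" using P_Q s(1) by blast
    moreover have "enat (Suc i) < diff (X n) (Y n)"
      using long[of n] that(2) by (meson Suc_leI enat_ord_simps(1) order_le_less_trans)
    ultimately show ?thesis using cell_interior[OF cells _ s_in[OF that(1)]] by blast
  qed
  define a where "a i = s (Suc i) i" for i
  have sa: "s m i = a i" if "i < m" for m i
  proof -
    have "\<not> (X (Suc i) i = Star \<and> Y (Suc i) i = Star)"
      using cell_inv[OF cells] by (simp add: cell_inv_def)
    then show ?thesis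
      using s_entry[of "Suc i" m i] s_entry[of "Suc i" "Suc i" i] that by (auto simp: a_def differ_def)
  qed
  have no_star: "a i \<noteq> Star" for i using s_entry[of "Suc i" "Suc i" i] by (simp add: a_def)
  have full: "a \<in> full_seqs d"
    using P_letter[OF s(1)] no_star by (auto simp: full_seqs_def a_def) 
  have "enat N < diff (s m) a" if "N \<le> m" for N m
    using sa that by (auto simp: less_diff_iff)
  then have "\<forall>\<^sub>F m in sequentially. enat N < diff (s m) a" for N
    by (auto simp: eventually_sequentially)
  then have inc: "increasing_to d \<nu> s a"
    using s by (simp add: increasing_to_iff approaches_def)
  have lim: "(\<lambda>n. f (s n)) \<longlonglongrightarrow> t"
  proof (rule tendsto_sandwich[of "\<lambda>n. t - 1 / 2 ^ n"])
    show "\<forall>\<^sub>F n in sequentially. t - 1 / 2 ^ n \<le> f (s n)"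
    proof (rule always_eventually, rule allI)
      fix n show "t - 1 / 2 ^ n \<le> f (s n)"
        using length[of n] s(2)[of n] inside(2)[of n] by linarith
    qed
    show "\<forall>\<^sub>F n in sequentially. f (s n) \<le> t"
      using s(3) by (intro always_eventually allI less_imp_le)
    have "(\<lambda>n. 1 / 2 ^ n :: real) \<longlonglongrightarrow> 0"
      using LIMSEQ_power_zero[of "1/2::real"] by (simp add: power_divide)
    then show "(\<lambda>n. t - 1 / 2 ^ n) \<longlonglongrightarrow> t" using tendsto_diff[OF tendsto_const, of _ 0 _ t] by simp
  qed simp
  have ap: "approaches s a" using inc by (simp add: increasing_to_iff)
  have ev: "\<forall>\<^sub>F m in sequentially. f (X n) < f (s m) \<and> f (s m) < f (Y n)" for n
    using s_in[of n] unfolding eventually_sequentially by (intro exI[of _ n]) auto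
  have "a \<in> itineraries d \<nu>"
  proof (cases starry)
    case True
    then show ?thesis using full_itinerary full by blast
  next
    case False
    have not_pre: "suffix k a \<noteq> \<nu>" if k: "0 < k" for k
    proof (rule nested_limit_not_preimage[OF False cells inside step fin _ no_star k])
      show "\<not> differ (a i) (X n i) \<and> \<not> differ (a i) (Y n i)" if
        "enat (Suc i) < diff (X n) (Y n)" for n i
        using that by (rule trapped(2)[OF ap no_star cells ev])
    qed
    have "a \<noteq> w \<frown> \<nu>" if "w \<noteq> []" for w
    proof
      assume "a = w \<frown> \<nu>"
      then have "suffix (length w) a = \<nu>" by (simp only: suffix_conc_length)
      moreover have "0 < length w" using that by simp
      ultimately show False using not_pre by blast
    qed
    then show ?thesis using full by (auto simp: itineraries_def)
  qed
  then have L: "a \<in> L" using full increasing_monotone[OF inc] by (auto simp: L_set_iff)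
  have "a \<notin> P"
  proof
    assume "a \<in> P"
    then have "approaches (\<lambda>_. a) a" by (intro approaches_const) (simp_all add: diff_eq_infinity_iff)
    then have "t = f a"
      using monotone_to_limit_unique[OF increasing_monotone[OF inc] _ no_star lim, of "\<lambda>_. a"] by simp
    then show False using t(3) \<open>a \<in> P\<close> by blast
  qed
  then have "val a = t"
    using phi_L_set[OF L _ increasing_monotone[OF inc]] lim LIMSEQ_unique by blast
  then show ?thesis using L \<open>a \<notin> P\<close> by blast
qed


abbreviation mid :: "itin \<Rightarrow> itin \<Rightarrow> itin" where "mid \<equiv> gap_mid d \<nu>"

section \<open>The order of the vertices\<close>

lemma gap_mid_not_P: "gap d \<nu> l r \<Longrightarrow> mid l r \<notin> P"
  using gap_mid[of l r] gap_starry P_precritical precritical_not_full by blast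

lemma gap_mid_not_L: 
  assumes gap: "gap d \<nu> l r"
  shows "mid l r \<notin> L"
proof
  let ?w = "mid l r"
  assume L: "?w \<in> L"
  have "val ?w = f l"
    using phi_L_set_eq[OF L gap_mid_not_P[OF gap]] gap gap_mid[OF gap]
    by (simp add: gap_iff diff_commute[of _ l])
  moreover have "val ?w = f r"
    using phi_L_set_eq[OF L gap_mid_not_P[OF gap]] gap gap_mid[OF gap] by (simp add: gap_iff)
  ultimately show False using gap by (simp add: gap_iff)
qed

lemma gap_overlap:
  assumes "gap d \<nu> l r" "gap d \<nu> l' r'" "f l < t" "t < f r" "f l' < t" "t < f r'"
  shows "l = l' \<and> r = r'"
proof -
  have P: "l \<in> P" "r \<in> P" "l' \<in> P" "r' \<in> P" using assms(1,2) by (auto simp: gap_iff)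
  have "f l = f l'" "f r = f r'"
    using gap_no_between[OF assms(1) P(3)] gap_no_between[OF assms(1) P(4)]
      gap_no_between[OF assms(2) P(1)] gap_no_between[OF assms(2) P(2)] assms(3-6) by linarith+
  then show ?thesis using f_inj P by blast
qed

text \<open>The ends of gaps with a common middle itinerary do not differ pairwise, whereas three distinct points
  of \<open>P_inf\<close> always contain a pair with a point in between, which therefore differs.\<close>

lemma gap_mid_inj:
  assumes g: "gap d \<nu> l r" "gap d \<nu> l' r'" and eq: "mid l r = mid l' r'"
  shows "l = l' \<and> r = r'"
proof -
  have le: "f l' \<le> f l" if g: "gap d \<nu> l r" "gap d \<nu> l' r'" "mid l r = mid l' r'"
    for l r l' r'
  proof (rule ccontr)
    assume "\<not> f l' \<le> f l"
    then have less: "f l < f l'" by simp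
    let ?w = "mid l r"
    have w: "diff l ?w = \<infinity>" "diff ?w r = \<infinity>" "diff l' ?w = \<infinity>" "diff ?w r' = \<infinity>" "?w \<in> full_seqs d"
      using gap_mid[OF g(1)] gap_mid[OF g(2)] g(3) by auto
    have inf: "diff l l' = \<infinity>" "diff l r' = \<infinity>"
      using w not_differ_trans full_seqs_not_Star[OF w(5)] differ_commute
      unfolding diff_eq_infinity_iff by meson+
    have P: "l \<in> P" "r \<in> P" "l' \<in> P" "r' \<in> P" and lr: "f l < f r" "f l' < f r'"
      using g(1,2) by (auto simp: gap_iff)
    have gaps: "gap d \<nu> l l'" "gap d \<nu> l r'" using inf P less lr(2) by (auto simp: gap_iff)
    have "f l' = f r"
      using gap_no_between[OF gaps(1) P(2)] gap_no_between[OF g(1) P(3)] less lr by linarith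
    then show False using gap_no_between[OF gaps(2) P(2)] lr by linarith
  qed
  have "f l = f l'" using le[OF g eq] le[OF g(2,1) eq[symmetric]] by simp
  then have "l = l'" using f_inj g by (simp add: gap_iff)
  have P: "r \<in> P" "r' \<in> P" using g by (auto simp: gap_iff)
  have "f r = f r'"
    using gap_no_between[OF g(1) P(2)] gap_no_between[OF g(2) P(1)] g \<open>l = l'\<close> by (auto simp: gap_iff)
  then show ?thesis using f_inj P \<open>l = l'\<close> by blast
qed

lemma phi_gap_mid:
  assumes gap: "gap d \<nu> l r"
  shows "val (mid l r) = (f l + f r) / 2"
proof -
  let ?w = "mid l r"
  have "val ?w = (THE t. \<exists>l' r'. gap d \<nu> l' r' \<and> ?w = mid l' r' \<and> t = (f l' + f r') / 2)"
    using gap_mid_not_P[OF gap] gap_mid_not_L[OF gap] by (simp add: phi_def)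
  also have "\<dots> = (f l + f r) / 2"
    by (rule the_equality) (use gap gap_mid_inj[OF gap] in blast)+
  finally show ?thesis .
qed

lemma gap_mid_inside:
  "gap d \<nu> l r \<Longrightarrow> f l < val (mid l r) \<and> val (mid l r) < f r"
  by (simp add: phi_gap_mid) (simp add: gap_iff)

abbreviation V :: "itin set" where "V \<equiv> vertices d \<nu>"
abbreviation M :: "itin set" where "M \<equiv> M_set d \<nu>"

lemma vertex_cases:
  assumes "x \<in> V"
  obtains (P) "x \<in> P" | (L) "x \<in> L" "x \<notin> P" | (mid) l r where "gap d \<nu> l r" "x = mid l r"
  using assms by (auto simp: vertices_def gap_mids_def)

lemma vertexI: "x \<in> P \<Longrightarrow> x \<in> V" "x \<in> L \<Longrightarrow> x \<in> V" "gap d \<nu> l r \<Longrightarrow> mid l r \<in> V"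
  by (auto simp: vertices_def gap_mids_def)

lemma M_V: "a \<in> M \<Longrightarrow> a \<in> V"
  using M_setD(1) vertexI(2) by blast

lemma M_position: "a \<in> M \<Longrightarrow> x \<in> P \<Longrightarrow> diff a x = \<infinity> \<longleftrightarrow> f x = val a"
  using M_setD[of a] phi_L_set_eq f_inj by metis

lemma M_pointE:
  assumes "a \<in> M"
  obtains x where "x \<in> P" "precritical d \<nu> x" "diff a x = \<infinity>" "f x = val a"
  using M_setD(4)[OF assms] M_position[OF assms] by blast

lemma vertex_at_P:
  assumes "x \<in> V" "p \<in> P" "val x = f p"
  shows "x = p \<or> x \<in> M"
  using assms(1)
proof (cases rule: vertex_cases)
  case P
  then show ?thesis using f_inj[OF P assms(2)] phi_P_inf[OF P] assms(3) by simp
next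
  case L
  then show ?thesis using limit_at_P assms by blast
next
  case (mid l r)
  then show ?thesis
    using gap_mid_inside[OF mid(1)] gap_no_between[OF mid(1) assms(2)] assms(3) by auto
qed

text \<open>Several vertices may share their value under \<open>phi\<close>: a point of \<open>P_inf\<close> and the limits adjacent
  to it.  The side tells them apart.\<close>

definition side :: "itin \<Rightarrow> int" where
  "side x = (if x \<notin> M then 0 else if \<exists>s. decreasing_to d \<nu> s x then 1 else -1)"

lemma side_M: "x \<in> M \<Longrightarrow> side x = 1 \<or> side x = -1"
  and side_not_M: "x \<notin> M \<Longrightarrow> side x = 0"
  by (auto simp: side_def)

lemma side_P: "x \<in> P \<Longrightarrow> side x = 0"
  using M_setD(3) side_not_M by blast

lemma side_mid: "gap d \<nu> l r \<Longrightarrow> side (mid l r) = 0"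
  using M_setD(1) gap_mid_not_L side_not_M by blast

lemma side_decreasing: "side x = 1 \<Longrightarrow> \<exists>s. decreasing_to d \<nu> s x"
  by (auto simp: side_def split: if_splits)

lemma side_increasing: "side x = -1 \<Longrightarrow> \<exists>s. increasing_to d \<nu> s x"
  using M_setD(1)[of x] by (auto simp: side_def L_set_iff monotone_to_def split: if_splits)

definition key_less :: "itin \<Rightarrow> itin \<Rightarrow> bool" where
  "key_less x y \<longleftrightarrow> val x < val y \<or> val x = val y \<and> side x < side y"

lemma key_less_trans: "key_less x y \<Longrightarrow> key_less y z \<Longrightarrow> key_less x z"
  by (auto simp: key_less_def)

lemma key_less_irrefl: "\<not> key_less x x"
  by (simp add: key_less_def)

lemma gap_vertices:
  assumes gap: "gap d \<nu> l r" and y: "y \<in> V"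
  shows "f l < val y \<Longrightarrow> val y < f r \<Longrightarrow> y = mid l r"
    "val y = f l \<Longrightarrow> side y \<le> 0" "val y = f r \<Longrightarrow> 0 \<le> side y"
proof -
  assume in_gap: "f l < val y" "val y < f r"
  from y show "y = mid l r"
  proof (cases rule: vertex_cases)
    case P
    then show ?thesis using gap_no_between[OF gap P] in_gap phi_P_inf by auto
  next
    case L
    then show ?thesis using L_set_not_in_gap(1)[OF L gap] in_gap by auto
  next
    case (mid l' r')
    then show ?thesis using gap_overlap[OF gap mid(1) in_gap] gap_mid_inside[OF mid(1)] by auto
  qed
next
  assume eq: "val y = f l"
  show "side y \<le> 0"
  proof (rule ccontr)
    assume "\<not> side y \<le> 0"
    then have "y \<in> M" "side y = 1" using side_M[of y] side_not_M[of y] by force+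
    then show False
      using L_set_not_in_gap(3)[OF M_setD(1,3) gap] side_decreasing[of y] eq by blast
  qed
next
  assume eq: "val y = f r"
  show "0 \<le> side y"
  proof (rule ccontr)
    assume "\<not> 0 \<le> side y"
    then have "y \<in> M" "side y = -1" using side_M[of y] side_not_M[of y] by force+
    then show False
      using L_set_not_in_gap(2)[OF M_setD(1,3) gap] side_increasing[of y] eq by blast
  qed
qed

lemma key_inj:
  assumes x: "x \<in> V" and y: "y \<in> V" and eq: "val x = val y" "side x = side y"
  shows "x = y"
proof (cases "val x \<in> f ` P")
  case True
  then obtain p where p: "p \<in> P" "val x = f p" by auto
  show ?thesis
  proof (cases "x \<in> M")
    case xM: True
    have yM: "y \<in> M"
    proof (rule ccontr)
      assume "y \<notin> M"
      then show False using side_not_M[of y] side_M[OF xM] eq(2) by simp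
    qed
    show ?thesis
    proof (cases "side x = 1")
      case True
      moreover from this have "side y = 1" using eq(2) by simp
      ultimately obtain s s' where "decreasing_to d \<nu> s x" "decreasing_to d \<nu> s' y"
        using side_decreasing by blast
      then show ?thesis
        using decreasing_unique[OF M_setD(1,3)[OF xM] _ M_setD(1,3)[OF yM] _ eq(1)] by blast
    next
      case False
      then have "side x = -1" using side_M[OF xM] by simp
      moreover from this have "side y = -1" using eq(2) by simp
      ultimately obtain s s' where "increasing_to d \<nu> s x" "increasing_to d \<nu> s' y"
        using side_increasing by blast
      then show ?thesis
        using increasing_unique[OF M_setD(1,3)[OF xM] _ M_setD(1,3)[OF yM] _ eq(1)] by blast
    qed
  next
    case False
    have "y \<notin> M"
    proof
      assume "y \<in> M"
      then show False using side_M[of y] side_not_M[OF False] eq(2) by simp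
    qed
    have "val y = f p" using p(2) eq(1) by simp
    then have "y = p" using vertex_at_P[OF y p(1)] \<open>y \<notin> M\<close> by blast
    moreover have "x = p" using vertex_at_P[OF x p] False by blast
    ultimately show ?thesis by simp
  qed
next
  case notP: False
  from x show ?thesis
  proof (cases rule: vertex_cases)
    case P
    then have "val x \<in> f ` P" by (simp add: phi_P_inf)
    then show ?thesis using notP by contradiction
  next
    case xL: L
    from y show ?thesis
    proof (cases rule: vertex_cases)
      case P
      then have "val x \<in> f ` P" by (simp add: phi_P_inf eq(1))
      then show ?thesis using notP by contradiction
    next
      case L
      then show ?thesis using interior_unique[OF xL L eq(1) notP] by simp
    next
      case (mid l r)
      have "f l < val x" "val x < f r"
        unfolding eq(1) mid(2) using gap_mid_inside[OF mid(1)] by blast+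
      then have "x = mid l r" by (rule gap_vertices(1)[OF mid(1) x])
      then show ?thesis using mid(2) by blast
    qed
  next
    case (mid l r)
    have "f l < val y" "val y < f r"
      unfolding eq(1)[symmetric] mid(2) using gap_mid_inside[OF mid(1)] by blast+
    then have "y = mid l r" by (rule gap_vertices(1)[OF mid(1) y])
    then show ?thesis using mid(2) by blast
  qed
qed

lemma key_total: "x \<in> V \<Longrightarrow> y \<in> V \<Longrightarrow> x \<noteq> y \<Longrightarrow> key_less x y \<or> key_less y x"
  using key_inj by (force simp: key_less_def)

text \<open>A decreasing sequence places its limit just above its value and an increasing one just below; at
  a value not taken on \<open>P_inf\<close> the two amount to the same.\<close>

lemma P_below_iff:
  assumes p: "p \<in> P" and x: "x \<in> V"
  shows "P_below d \<nu> p x \<longleftrightarrow> key_less p x"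
  using x
proof (cases rule: vertex_cases)
  case P
  then show ?thesis using p by (simp add: P_below_def P_less_iff key_less_def phi_P_inf side_P)
next
  case L
  have below: "P_below d \<nu> p x \<longleftrightarrow>
      (\<exists>s. increasing_to d \<nu> s x \<and> (\<exists>n. f p < f (s n))) \<or>
      (\<exists>s. decreasing_to d \<nu> s x \<and> (\<forall>n. f p < f (s n)))"
    using L p by (auto simp: P_below_def P_less_iff increasing_to_iff decreasing_to_iff approaches_def)
  have inc: "(\<exists>n. f p < f (s n)) \<longleftrightarrow> f p < val x" if s: "increasing_to d \<nu> s x" for s
  proof
    assume "\<exists>n. f p < f (s n)"
    then show "f p < val x" using phi_increasing[OF L s] by (meson less_trans)
  next
    assume "f p < val x"
    then have "\<forall>\<^sub>F n in sequentially. f p < f (s n)"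
      using phi_L_set[OF L increasing_monotone[OF s]] by (simp add: order_tendsto_iff)
    then show "\<exists>n. f p < f (s n)" by (auto simp: eventually_sequentially)
  qed
  have dec: "(\<forall>n. f p < f (s n)) \<longleftrightarrow> f p \<le> val x" if s: "decreasing_to d \<nu> s x" for s
  proof
    assume "\<forall>n. f p < f (s n)"
    then show "f p \<le> val x"
      using phi_L_set[OF L decreasing_monotone[OF s]] by (meson LIMSEQ_le_const less_imp_le)
  next
    assume "f p \<le> val x"
    then show "\<forall>n. f p < f (s n)" using phi_decreasing[OF L s] by (meson le_less_trans)
  qed
  have kl: "key_less p x \<longleftrightarrow> f p < val x \<or> f p = val x \<and> 0 < side x"
    using p by (simp add: key_less_def phi_P_inf side_P)
  show ?thesis
  proof (cases "\<exists>s. decreasing_to d \<nu> s x")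
    case True
    then obtain s where s: "decreasing_to d \<nu> s x" by blast
    have "P_below d \<nu> p x \<longleftrightarrow> f p \<le> val x"
    proof
      assume "P_below d \<nu> p x"
      then show "f p \<le> val x"
        unfolding below
      proof (elim disjE exE conjE)
        fix s n assume "increasing_to d \<nu> s x" "f p < f (s n)"
        then have "f p < val x" using phi_increasing[OF L, of s n] by linarith
        then show "f p \<le> val x" by simp
      next
        fix s assume "decreasing_to d \<nu> s x" "\<forall>n. f p < f (s n)"
        then show "f p \<le> val x" using iffD1[OF dec] by blast
      qed
    next
      assume "f p \<le> val x"
      then have "\<forall>n. f p < f (s n)" using dec[OF s] by simp
      then show "P_below d \<nu> p x" unfolding below using s by blast
    qed
    moreover have "0 < side x" if "f p = val x"
      using limit_at_P[OF L p] that True by (simp add: side_def)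
    ultimately show ?thesis using kl by auto
  next
    case False
    then obtain s where s: "increasing_to d \<nu> s x" using L by (auto simp: L_set_iff monotone_to_def)
    have "P_below d \<nu> p x \<longleftrightarrow> f p < val x"
    proof
      assume "P_below d \<nu> p x"
      then show "f p < val x"
        unfolding below
      proof (elim disjE exE conjE)
        fix s n assume "increasing_to d \<nu> s x" "f p < f (s n)"
        then show "f p < val x" using phi_increasing[OF L, of s n] by linarith
      qed (use False in blast)
    next
      assume "f p < val x"
      then have "\<exists>n. f p < f (s n)" using inc[OF s] by simp
      then show "P_below d \<nu> p x" unfolding below using s by blast
    qed
    moreover have "side x \<le> 0" using False by (simp add: side_def)
    ultimately show ?thesis using kl by auto
  qed
next
  case (mid l r)
  have "P_below d \<nu> p x \<longleftrightarrow> (\<exists>l' r'. gap d \<nu> l' r' \<and> x = mid l' r' \<and> (p = l' \<or> P_less d \<nu> p l'))"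
    using gap_mid_not_P[OF mid(1)] gap_mid_not_L[OF mid(1)] mid(2) by (simp add: P_below_def)
  also have "\<dots> \<longleftrightarrow> p = l \<or> P_less d \<nu> p l"
  proof
    assume "\<exists>l' r'. gap d \<nu> l' r' \<and> x = mid l' r' \<and> (p = l' \<or> P_less d \<nu> p l')"
    then obtain l' r' where "gap d \<nu> l' r'" "mid l r = mid l' r'" "p = l' \<or> P_less d \<nu> p l'"
      unfolding mid(2) by blast
    then show "p = l \<or> P_less d \<nu> p l" using gap_mid_inj[OF mid(1)] by blast
  qed (use mid in blast)
  also have "\<dots> \<longleftrightarrow> f p \<le> f l"
  proof -
    have "l \<in> P" using mid(1) by (simp add: gap_iff)
    then have "p = l \<longleftrightarrow> f p = f l" "P_less d \<nu> p l \<longleftrightarrow> f p < f l"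
      using f_inj[OF p] p by (auto simp: P_less_iff)
    then show ?thesis by linarith
  qed
  also have "\<dots> \<longleftrightarrow> f p < val x"
    unfolding mid(2) using gap_no_between[OF mid(1) p] gap_mid_inside[OF mid(1)] by linarith
  also have "\<dots> \<longleftrightarrow> key_less p x"
    unfolding mid(2) using p side_mid[OF mid(1)] by (simp add: key_less_def phi_P_inf side_P)
  finally show ?thesis .
qed

lemma phi_range:
  assumes "x \<in> V"
  shows "0 \<le> val x \<and> val x \<le> 1"
  using assms
proof (cases rule: vertex_cases)
  case (mid l r)
  then have "l \<in> P" "r \<in> P" by (simp_all add: gap_iff)
  then show ?thesis
    unfolding mid(2) using gap_mid_inside[OF mid(1)] f_range[of l] f_range[of r] by linarith
next
  case P
  then show ?thesis using f_range[OF P] phi_P_inf[OF P] by simp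
next
  case L
  then show ?thesis using phi_L_set_range(1,2)[OF L] by simp
qed

text \<open>If no point of \<open>P_inf\<close> has a value strictly in between, then either the values coincide, and the
  point of \<open>P_inf\<close> at this value separates its two adjacent limits, or both values belong to one
  closed gap, and an end of the gap separates.\<close>

lemma vertices_separated:
  assumes x: "x \<in> V" "x \<notin> P" and y: "y \<in> V" "y \<notin> P" and less: "key_less x y"
  shows "\<exists>p\<in>P. key_less x p \<and> key_less p y"
proof -
  have xp: "key_less x p \<longleftrightarrow> val x < f p \<or> val x = f p \<and> side x < 0"
    and py: "key_less p y \<longleftrightarrow> f p < val y \<or> f p = val y \<and> 0 < side y" if "p \<in> P" for p
    using that by (simp_all add: key_less_def phi_P_inf side_P)
  have M_side: "side z \<noteq> 0" if "z \<in> V" "z \<notin> P" "p \<in> P" "val z = f p" for z p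
    using vertex_at_P[OF that(1,3,4)] that(2,3) side_M[of z] by auto
  show ?thesis
  proof (cases "val x < val y")
    case lt: True
    show ?thesis
    proof (cases "\<exists>p\<in>P. val x < f p \<and> f p < val y")
      case True
      then show ?thesis using xp py by blast
    next
      case False
      then obtain l r where gap: "gap d \<nu> l r" and lr: "f l \<le> val x" "val y \<le> f r"
        using P_dense[of "val x" "val y"] lt phi_range[OF x(1)] phi_range[OF y(1)] by blast
      have P: "l \<in> P" "r \<in> P" using gap by (auto simp: gap_iff)
      show ?thesis
      proof (cases "f l = val x")
        case True
        then have "side x < 0" using gap_vertices(2)[OF gap x(1)] M_side[OF x P(1)] by simp
        then show ?thesis using xp[OF P(1)] py[OF P(1)] True lt P(1) by auto
      next
        case False
        then have xm: "x = mid l r" using gap_vertices(1)[OF gap x(1)] lr lt by simp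
        have "val y = f r"
          using gap_vertices(1)[OF gap y(1)] lr lt xm by (force simp: order_le_less)
        then have "0 < side y" using gap_vertices(3)[OF gap y(1)] M_side[OF y P(2)] by simp
        then show ?thesis using xp[OF P(2)] py[OF P(2)] \<open>val y = f r\<close> lt P(2) by auto
      qed
    qed
  next
    case False
    then have eq: "val x = val y" "side x < side y" using less by (auto simp: key_less_def)
    then have "x \<in> M \<or> y \<in> M" using side_not_M by fastforce
    then obtain p where p: "p \<in> P" "f p = val x" using M_pointE eq(1) by metis
    have "x \<in> M" "y \<in> M"
      using vertex_at_P[OF x(1) p(1)] vertex_at_P[OF y(1) p(1)] p x(2) y(2) eq(1) by auto
    then have "side x = -1" "side y = 1" using side_M[of x] side_M[of y] eq(2) by auto
    then show ?thesis using xp[OF p(1)] py[OF p(1)] p eq(1) by auto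
  qed
qed

lemma V_less_iff:
  assumes x: "x \<in> V" and y: "y \<in> V"
  shows "V_less d \<nu> x y \<longleftrightarrow> key_less x y"
proof -
  consider "x \<in> P" | "x \<notin> P" "y \<in> P" | "x \<notin> P" "y \<notin> P" by blast
  then show ?thesis
  proof cases
    case 1
    then show ?thesis using P_below_iff[OF 1 y] by (simp add: V_less_def)
  next
    case 2
    then have "V_less d \<nu> x y \<longleftrightarrow> \<not> key_less y x" using P_below_iff[OF 2(2) x] by (simp add: V_less_def)
    moreover have "x \<noteq> y" using 2 by blast
    ultimately show ?thesis using key_total[OF x y] key_less_trans key_less_irrefl by blast
  next
    case 3
    then have "V_less d \<nu> x y \<longleftrightarrow> (\<exists>p\<in>P. \<not> key_less p x \<and> key_less p y)"
      using P_below_iff x y by (simp add: V_less_def)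
    also have "\<dots> \<longleftrightarrow> key_less x y"
    proof
      assume "\<exists>p\<in>P. \<not> key_less p x \<and> key_less p y"
      then obtain p where p: "p \<in> P" "\<not> key_less p x" "key_less p y" by blast
      then have "key_less x p" using key_total[OF x vertexI(1)[OF p(1)]] 3 by blast
      then show "key_less x y" using p(3) key_less_trans by blast
    next
      assume "key_less x y"
      then show "\<exists>p\<in>P. \<not> key_less p x \<and> key_less p y"
        using vertices_separated[OF x 3(1) y 3(2)] key_less_trans key_less_irrefl by blast
    qed
    finally show ?thesis .
  qed
qed

section \<open>Fatou intervals\<close>

text \<open>No vertex fits between a limit and the adjacent point of \<open>P_inf\<close>, because their values coincide
  and their sides are consecutive integers.\<close>

lemma M_interval_iff:
  "M_interval d \<nu> a p q \<longleftrightarrow>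
     a \<in> M \<and> (\<exists>x\<in>P. f x = val a \<and> (side a = -1 \<and> p = a \<and> q = x \<or> side a = 1 \<and> p = x \<and> q = a))"
proof
  assume I: "M_interval d \<nu> a p q"
  then have a: "a \<in> M" by (simp add: M_interval_def)
  obtain x where x: "x \<in> P" "diff a x = \<infinity>" "p = a \<and> q = x \<or> p = x \<and> q = a" and less: "V_less d \<nu> p q"
    using I by (auto simp: M_interval_def)
  have eq: "f x = val a" using M_position[OF a x(1)] x(2) by blast
  have x_key: "val x = val a" "side x = 0" using eq phi_P_inf side_P x(1) by simp_all
  have "side a = -1 \<and> p = a \<and> q = x \<or> side a = 1 \<and> p = x \<and> q = a"
    using x(3)
  proof
    assume pq: "p = a \<and> q = x"
    then have "key_less a x" using less V_less_iff[OF M_V[OF a] vertexI(1)[OF x(1)]] by blast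
    then have "side a < 0" using x_key by (simp add: key_less_def)
    then show ?thesis using side_M[OF a] pq by auto
  next
    assume pq: "p = x \<and> q = a"
    then have "key_less x a" using less V_less_iff[OF vertexI(1)[OF x(1)] M_V[OF a]] by blast
    then have "0 < side a" using x_key by (simp add: key_less_def)
    then show ?thesis using side_M[OF a] pq by auto
  qed
  then show "a \<in> M \<and> (\<exists>x\<in>P. f x = val a \<and> (side a = -1 \<and> p = a \<and> q = x \<or> side a = 1 \<and> p = x \<and> q = a))"
    by (intro conjI a bexI[of _ x]) (rule eq, assumption, rule x(1))
next
  assume "a \<in> M \<and> (\<exists>x\<in>P. f x = val a \<and> (side a = -1 \<and> p = a \<and> q = x \<or> side a = 1 \<and> p = x \<and> q = a))"
  then obtain x where a: "a \<in> M" and x: "x \<in> P" "f x = val a"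
    and pq: "side a = -1 \<and> p = a \<and> q = x \<or> side a = 1 \<and> p = x \<and> q = a" by blast
  obtain x' where x': "x' \<in> P" "precritical d \<nu> x'" "diff a x' = \<infinity>" "f x' = val a"
    using M_pointE[OF a] .
  have "x' = x" using f_inj[OF x'(1) x(1)] x'(4) x(2) by simp
  have x_key: "val x = val a" "side x = 0" using x phi_P_inf side_P by simp_all
  have "(p \<in> V \<and> q \<in> V) \<and> val p = val q \<and> side q = side p + 1"
    using pq
  proof (elim disjE conjE)
    assume "side a = -1" "p = a" "q = x"
    then show ?thesis using x_key M_V[OF a] vertexI(1)[OF x(1)] by simp
  next
    assume "side a = 1" "p = x" "q = a"
    then show ?thesis using x_key M_V[OF a] vertexI(1)[OF x(1)] by simp
  qed
  then have V: "p \<in> V" "q \<in> V" and keys: "val p = val q" "side q = side p + 1"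
    by blast+
  have less: "V_less d \<nu> p q" unfolding V_less_iff[OF V] key_less_def using keys by simp
  have none: "\<not> (\<exists>y\<in>V. V_less d \<nu> p y \<and> V_less d \<nu> y q)"
  proof
    assume "\<exists>y\<in>V. V_less d \<nu> p y \<and> V_less d \<nu> y q"
    then obtain y where y: "y \<in> V" "V_less d \<nu> p y" "V_less d \<nu> y q" by blast
    have "key_less p y" "key_less y q" using y V_less_iff[OF V(1) y(1)] V_less_iff[OF y(1) V(2)]
      by blast+
    then show False unfolding key_less_def using keys by linarith
  qed
  show "M_interval d \<nu> a p q"
    unfolding M_interval_def
  proof (intro conjI)
    show "\<exists>x\<in>P. precritical d \<nu> x \<and> diff a x = \<infinity> \<and> (p = a \<and> q = x \<or> p = x \<and> q = a)"
      using x'(1-3) pq unfolding \<open>x' = x\<close> by blast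
  qed (fact a less none)+
qed

lemma fatou_adjacent:
  assumes "fatou_interval d \<nu> p q"
  shows "p \<in> V" "q \<in> V" "key_less p q" "y \<in> V \<Longrightarrow> \<not> (key_less p y \<and> key_less y q)"
proof -
  have "p \<in> V \<and> q \<in> V \<and> key_less p q \<and> (\<forall>y\<in>V. \<not> (key_less p y \<and> key_less y q))"
  proof (cases "gap_interval d \<nu> p q")
    case True
    then obtain l r where gap: "gap d \<nu> l r"
      and pq: "p = l \<and> q = mid l r \<or> p = mid l r \<and> q = r"
      by (auto simp: gap_interval_def)
    have P: "l \<in> P" "r \<in> P" using gap by (auto simp: gap_iff)
    note V = vertexI(1)[OF P(1)] vertexI(1)[OF P(2)] vertexI(3)[OF gap]
    note val = phi_P_inf[OF P(1)] phi_P_inf[OF P(2)] side_P[OF P(1)] side_P[OF P(2)] side_mid[OF gap]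
    note inside = gap_mid_inside[OF gap]
    have "\<not> (key_less p y \<and> key_less y q)" if y: "y \<in> V" for y
    proof
      assume *: "key_less p y \<and> key_less y q"
      have "key_less l y \<and> key_less y r \<and> y \<noteq> mid l r"
      proof -
        have "key_less l (mid l r)" "key_less (mid l r) r"
          using inside val by (auto simp: key_less_def)
        then show ?thesis using * pq key_less_trans key_less_irrefl by blast
      qed
      then show False
        using gap_vertices[OF gap y] val by (auto simp: key_less_def)
    qed
    then show ?thesis using pq V inside val by (auto simp: key_less_def)
  next
    case False
    then obtain a where I: "M_interval d \<nu> a p q" using assms by (auto simp: fatou_interval_def)
    then have a: "a \<in> M" by (simp add: M_interval_def)
    have V: "p \<in> V" "q \<in> V" using I M_V[OF a] vertexI(1) by (auto simp: M_interval_iff)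
    have "V_less d \<nu> p q" "\<not> (\<exists>y\<in>V. V_less d \<nu> p y \<and> V_less d \<nu> y q)"
      using I by (auto simp: M_interval_def)
    then show ?thesis using V V_less_iff by metis
  qed
  then show "p \<in> V" "q \<in> V" "key_less p q" "y \<in> V \<Longrightarrow> \<not> (key_less p y \<and> key_less y q)" by blast+
qed

abbreviation fatou :: "itin \<Rightarrow> itin \<Rightarrow> bool" where "fatou \<equiv> fatou_interval d \<nu>"

lemma V_le_iff:
  assumes "x \<in> V" "y \<in> V"
  shows "V_le d \<nu> x y \<longleftrightarrow> \<not> key_less y x"
  unfolding V_less_iff[OF assms]
  using key_total[OF assms] key_less_trans[of x y x] key_less_irrefl[of x] by metis

lemma fatou_disjoint:
  assumes "fatou p q" "fatou p' q'"
  shows "V_le d \<nu> q p' \<or> V_le d \<nu> q' p \<or> p = p' \<and> q = q'"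
proof -
  note A = fatou_adjacent[OF assms(1)] and B = fatou_adjacent[OF assms(2)]
  show ?thesis
  proof (rule ccontr)
    assume "\<not> ?thesis"
    then have ne: "key_less p' q" "key_less p q'" "\<not> (p = p' \<and> q = q')"
      unfolding V_le_iff[OF A(2) B(1)] V_le_iff[OF B(2) A(1)] by simp_all
    have "\<not> key_less p p'" "\<not> key_less p' p" using A(4)[OF B(1)] B(4)[OF A(1)] ne(1,2) by simp_all
    then have "p = p'" using key_total[OF A(1) B(1)] by metis
    have "\<not> key_less q q'" "\<not> key_less q' q"
      using B(4)[OF A(2)] A(4)[OF B(2)] A(3) B(3) unfolding \<open>p = p'\<close> by simp_all
    then have "q = q'" using key_total[OF A(2) B(2)] by metis
    then show False using ne(3) \<open>p = p'\<close> by simp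
  qed
qed

lemma M_countable: "countable M"
proof -
  have "P \<subseteq> (\<Union>n. fst ` Q n)" by (auto simp: P_inf_def)
  moreover have "countable (\<Union>n. fst ` Q n)" by (rule countable_UN) (simp_all add: countable_finite)
  ultimately have "countable P" by (rule countable_subset)
  then have "countable ((f ` P) \<times> {-1, 1 :: int})" by (intro countable_SIGMA countable_image) auto
  moreover have "(\<lambda>a. (val a, side a)) ` M \<subseteq> (f ` P) \<times> {-1, 1}"
  proof (rule image_subsetI)
    fix a assume a: "a \<in> M"
    obtain x where "x \<in> P" "f x = val a" using M_pointE[OF a] .
    then have "val a \<in> f ` P" by (intro image_eqI[of _ _ x]) simp_all
    then show "(val a, side a) \<in> f ` P \<times> {-1, 1}" using side_M[OF a] by auto
  qed
  ultimately have "countable ((\<lambda>a. (val a, side a)) ` M)" using countable_subset by blast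
  moreover have "inj_on (\<lambda>a. (val a, side a)) M"
  proof (rule inj_onI)
    fix a b assume "a \<in> M" "b \<in> M" "(val a, side a) = (val b, side b)"
    then show "a = b" using key_inj[OF M_V M_V, of a b] by simp
  qed
  ultimately show ?thesis by (rule countable_image_inj_on)
qed

text \<open>A limit in \<open>M\<close> is determined by a value taken on the countable set \<open>P_inf\<close> and one of two sides,
  so that \<open>M\<close> is countable and a geometric series supplies the lengths.\<close>

lemma interval_lengths_exist: "\<exists>len. interval_lengths d \<nu> len"
proof -
  let ?len = "\<lambda>a. (1/2::real) ^ to_nat_on M a"
  have "(\<lambda>n. (1/2::real) ^ n) summable_on UNIV"
    by (rule norm_summable_imp_summable_on) (simp add: summable_geometric)
  then have "(\<lambda>n. (1/2::real) ^ n) summable_on to_nat_on M ` M"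
    by (rule summable_on_subset_banach) simp
  then have "?len summable_on M"
    using summable_on_reindex[OF inj_on_to_nat_on[OF M_countable], of "\<lambda>n. (1/2::real) ^ n"]
    by (simp add: o_def)
  then show ?thesis by (intro exI[of _ ?len]) (simp add: interval_lengths_def)
qed

end

section \<open>The shifted map\<close>

locale shifted_path = kneading_path +
  fixes len :: "itin \<Rightarrow> real"
  assumes lengths: "interval_lengths d \<nu> len"
begin

text \<open>The side of the upper end of the interval inserted at a limit \<open>a\<close> in \<open>M\<close>: the upper end is \<open>a\<close>
  itself if \<open>a\<close> lies above the adjacent point of \<open>P_inf\<close>, and this point otherwise.\<close>

definition upper_side :: "itin \<Rightarrow> int" where
  "upper_side a = (if side a = 1 then 1 else 0)"

definition inserted_before :: "itin \<Rightarrow> itin set" where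
  "inserted_before x = {a \<in> M. val a < val x \<or> val a = val x \<and> upper_side a \<le> side x}"

definition shifted :: "itin \<Rightarrow> real" where
  "shifted x = val x + infsum len (inserted_before x)"

definition total_length :: real where
  "total_length = 1 + infsum len M"

lemma len_pos: "a \<in> M \<Longrightarrow> 0 < len a" and len_summable: "len summable_on M"
  using lengths by (simp_all add: interval_lengths_def)

lemma len_summable_subset: "A \<subseteq> M \<Longrightarrow> len summable_on A"
  using len_summable by (rule summable_on_subset_banach)

lemma infsum_len_mono: "A \<subseteq> B \<Longrightarrow> B \<subseteq> M \<Longrightarrow> infsum len A \<le> infsum len B"
  using len_pos by (intro infsum_mono2 len_summable_subset) (auto intro: less_imp_le)

lemma infsum_len_nonneg: "A \<subseteq> M \<Longrightarrow> 0 \<le> infsum len A"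
  using infsum_len_mono[of "{}" A] by simp

lemma total_length_pos: "0 < total_length"
  using infsum_len_nonneg[of M] by (simp add: total_length_def)

lemma inserted_before_M: "inserted_before x \<subseteq> M"
  by (auto simp: inserted_before_def)

lemma inserted_before_eq:
  assumes x: "x \<in> V"
  shows "{a. \<exists>p q. M_interval d \<nu> a p q \<and> V_le d \<nu> q x} = inserted_before x"
proof (rule set_eqI)
  fix a
  show "a \<in> {a. \<exists>p q. M_interval d \<nu> a p q \<and> V_le d \<nu> q x} \<longleftrightarrow> a \<in> inserted_before x"
  proof (cases "a \<in> M")
    case False
    then show ?thesis by (auto simp: M_interval_def inserted_before_def)
  next
    case a: True
    obtain y where y: "y \<in> P" "f y = val a" using M_pointE[OF a] by metis
    have y_key: "val y = val a" "side y = 0" "y \<in> V"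
      using y phi_P_inf side_P vertexI(1) by simp_all
    have unique: "z = y" if "z \<in> P" "f z = val a" for z
      using f_inj[OF that(1) y(1)] that(2) y(2) by simp
    define q0 where "q0 = (if side a = 1 then a else y)"
    have I: "(\<exists>p. M_interval d \<nu> a p q) \<longleftrightarrow> q = q0" for q
    proof
      assume "\<exists>p. M_interval d \<nu> a p q"
      then obtain z where "z \<in> P" "f z = val a" "side a = -1 \<and> q = z \<or> side a = 1 \<and> q = a"
        unfolding M_interval_iff by blast
      then show "q = q0" using unique by (auto simp: q0_def)
    next
      assume q: "q = q0"
      have "M_interval d \<nu> a (if side a = 1 then y else a) q0"
        unfolding M_interval_iff q0_def using a y side_M[OF a] by auto
      then show "\<exists>p. M_interval d \<nu> a p q" using q by blast
    qed
    have q0: "q0 \<in> V" "val q0 = val a" "side q0 = upper_side a"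
      using y_key M_V[OF a] by (simp_all add: q0_def upper_side_def)
    have "a \<in> {a. \<exists>p q. M_interval d \<nu> a p q \<and> V_le d \<nu> q x} \<longleftrightarrow>
        (\<exists>q. (\<exists>p. M_interval d \<nu> a p q) \<and> V_le d \<nu> q x)" by blast
    also have "\<dots> \<longleftrightarrow> V_le d \<nu> q0 x" unfolding I by simp
    also have "\<dots> \<longleftrightarrow> \<not> key_less x q0" by (rule V_le_iff[OF q0(1) x])
    also have "\<dots> \<longleftrightarrow> a \<in> inserted_before x"
      unfolding key_less_def inserted_before_def mem_Collect_eq q0(2,3) using a
      by (cases "val x" "val a" rule: linorder_cases) (simp_all add: not_less)
    finally show ?thesis .
  qed
qed

lemma phi_tilde_vertex_eq: "x \<in> V \<Longrightarrow> phi_tilde_vertex d \<nu> len x = shifted x / total_length"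
  by (simp add: phi_tilde_vertex_def inserted_before_eq shifted_def total_length_def)

lemma shifted_strict_mono:
  assumes x: "x \<in> V" and y: "y \<in> V" and less: "key_less x y"
  shows "shifted x < shifted y"
proof -
  have sub: "inserted_before x \<subseteq> inserted_before y"
    using less by (auto simp: inserted_before_def key_less_def)
  show ?thesis
  proof (cases "val x < val y")
    case True
    then show ?thesis
      using infsum_len_mono[OF sub inserted_before_M] by (simp add: shifted_def)
  next
    case False
    then have eq: "val x = val y" "side x < side y" using less by (auto simp: key_less_def)
    \<comment> \<open>The interval inserted between the two vertices belongs to the one of them that is a limit.\<close>
    obtain a where a: "a \<in> M" "val a = val x" "side x < upper_side a" "upper_side a \<le> side y"
    proof (cases "x \<in> M \<and> side x = -1")
      case True
      moreover have "0 \<le> side y" using eq(2) True by simp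
      ultimately show thesis using that[of x] by (simp add: upper_side_def)
    next
      case False
      then have "0 \<le> side x" using side_M[of x] side_not_M[of x] by fastforce
      then have "0 < side y" using eq(2) by simp
      then have "y \<in> M" "side y = 1" using side_M[of y] side_not_M[of y] by fastforce+
      then show thesis using that[of y] eq by (simp add: upper_side_def)
    qed
    have notin: "a \<notin> inserted_before x" using a by (simp add: inserted_before_def)
    have "insert a (inserted_before x) \<subseteq> inserted_before y"
      using a eq(1) sub by (simp add: inserted_before_def)
    then have "infsum len (insert a (inserted_before x)) \<le> infsum len (inserted_before y)"
      by (rule infsum_len_mono[OF _ inserted_before_M])
    then have "len a + infsum len (inserted_before x) \<le> infsum len (inserted_before y)"
      using infsum_insert[OF len_summable_subset[OF inserted_before_M] notin] by simp
    then show ?thesis using len_pos[OF a(1)] eq(1) by (simp add: shifted_def)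
  qed
qed

lemma shifted_range:
  assumes x: "x \<in> V"
  shows "0 \<le> shifted x \<and> shifted x \<le> total_length"
  using phi_range[OF x] infsum_len_nonneg[OF inserted_before_M[of x]]
    infsum_len_mono[OF inserted_before_M[of x] order_refl]
  by (simp add: shifted_def total_length_def)

lemma M_side_cases: "a \<in> M \<Longrightarrow> side a = -1 \<and> upper_side a = 0 \<or> side a = 1 \<and> upper_side a = 1"
  using side_M[of a] by (auto simp: upper_side_def)

text \<open>The intermediate value \<open>t\<close> is a value on \<open>P_inf\<close>, the value of a limit, or inside a gap.  In
  the first case \<open>T\<close> may fall into the jump on either side of the point, which is filled by the interval
  inserted there.\<close>

lemma shifted_cover:
  assumes T: "0 \<le> T" "T \<le> total_length"
  shows "(\<exists>x\<in>V. shifted x = T) \<or> (\<exists>p q. fatou p q \<and> shifted p \<le> T \<and> T \<le> shifted q)"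
proof -
  have nonneg: "0 \<le> len a" if "a \<in> M" for a using len_pos[OF that] by simp
  have range: "val a \<in> {0..1}" if "a \<in> M" for a using phi_range[OF M_V[OF that]] by simp
  obtain t where t: "t \<in> {0..1}" and low: "t + infsum len {a \<in> M. val a < t} \<le> T"
    and high: "T \<le> t + infsum len {a \<in> M. val a \<le> t}"
    using shifted_value_exists[of M len "val" T, OF nonneg len_summable range T(1)] T(2)
    unfolding total_length_def by blast
  have M_at_P: "val a \<in> f ` P" if a: "a \<in> M" for a
  proof -
    obtain x where "x \<in> P" "f x = val a" using M_pointE[OF a] by metis
    then show ?thesis by (intro image_eqI[of _ _ x]) simp_all
  qed
  consider (P) p where "p \<in> P" "t = f p" | (gap) l r where "gap d \<nu> l r" "f l < t" "t < f r"
    | (interior) "t \<notin> f ` P" "\<And>l r. gap d \<nu> l r \<Longrightarrow> \<not> (f l < t \<and> t < f r)" by blast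
  then show ?thesis
  proof cases
    case (P p)
    have p: "p \<in> V" "val p = t" "side p = 0"
      using P phi_P_inf side_P vertexI(1) by simp_all
    show ?thesis
    proof (cases "T \<le> shifted p")
      case le: True
      show ?thesis
      proof (cases "\<exists>a\<in>M. val a = t \<and> side a = -1")
        case True
        then obtain a where a: "a \<in> M" "val a = t" "side a = -1" by blast
        have "inserted_before a = {a \<in> M. val a < t}"
          using a by (auto simp: inserted_before_def dest: M_side_cases)
        then have "shifted a \<le> T" using low a(2) by (simp add: shifted_def)
        moreover have "M_interval d \<nu> a a p" unfolding M_interval_iff using a P by auto
        then have "fatou a p" by (auto simp: fatou_interval_def)
        ultimately show ?thesis using le by blast
      next
        case False
        then have "inserted_before p = {a \<in> M. val a < t}"
          using p M_side_cases by (fastforce simp: inserted_before_def)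
        then have "shifted p = T" using low le p(2) by (simp add: shifted_def)
        then show ?thesis using p(1) by blast
      qed
    next
      case gt: False
      show ?thesis
      proof (cases "\<exists>a\<in>M. val a = t \<and> side a = 1")
        case True
        then obtain a where a: "a \<in> M" "val a = t" "side a = 1" by blast
        have "inserted_before a = {a \<in> M. val a \<le> t}"
          using a by (auto simp: inserted_before_def dest: M_side_cases)
        then have "T \<le> shifted a" using high a(2) by (simp add: shifted_def)
        moreover have "M_interval d \<nu> a p a" unfolding M_interval_iff using a P by auto
        then have "fatou p a" by (auto simp: fatou_interval_def)
        ultimately show ?thesis using gt by (meson le_cases)
      next
        case False
        then have "inserted_before p = {a \<in> M. val a \<le> t}"
          using p M_side_cases by (fastforce simp: inserted_before_def)
        then have "T \<le> shifted p" using high p(2) by (simp add: shifted_def)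
        then show ?thesis using gt by simp
      qed
    qed
  next
    case (gap l r)
    have lr: "l \<in> P" "r \<in> P" using gap(1) by (auto simp: gap_iff)
    have l: "l \<in> V" "val l = f l" "side l = 0" and r: "val r = f r" "side r = 0"
      using lr phi_P_inf side_P vertexI(1) by simp_all
    have before: "a \<in> inserted_before l \<longleftrightarrow> val a < t" "a \<in> inserted_before l \<longleftrightarrow> val a \<le> t"
      if a: "a \<in> M" for a
    proof -
      obtain x where x: "x \<in> P" "f x = val a" using M_pointE[OF a] by metis
      have "val a \<le> f l \<or> f r \<le> val a" using gap_no_between[OF gap(1) x(1)] x(2) by simp
      moreover have "upper_side a = 0" if "val a = f l"
        using gap_vertices(2)[OF gap(1) M_V[OF a] that] M_side_cases[OF a] by auto
      ultimately show "a \<in> inserted_before l \<longleftrightarrow> val a < t" "a \<in> inserted_before l \<longleftrightarrow> val a \<le> t"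
        using a l(2,3) gap(2,3) by (auto simp: inserted_before_def)
    qed
    have eq: "inserted_before l = {a \<in> M. val a < t}" "inserted_before l = {a \<in> M. val a \<le> t}"
      using before inserted_before_M[of l] by blast+
    have T_eq: "T = t + infsum len (inserted_before l)"
      using low high unfolding eq(1)[symmetric] eq(2)[symmetric] by simp
    have "key_less l r" using l r gap(2,3) by (simp add: key_less_def)
    then have "inserted_before l \<subseteq> inserted_before r" by (auto simp: inserted_before_def key_less_def)
    then have "infsum len (inserted_before l) \<le> infsum len (inserted_before r)"
      by (rule infsum_len_mono[OF _ inserted_before_M])
    then have "shifted l \<le> T" "T \<le> shifted r"
      using T_eq gap(2,3) l(2) r(1) by (simp_all add: shifted_def)
    moreover have "fatou l (mid l r)" "fatou (mid l r) r"
      using gap(1) by (auto simp: fatou_interval_def gap_interval_def)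
    ultimately show ?thesis by (meson le_cases)
  next
    case interior
    have "t \<noteq> 0" "t \<noteq> 1" using interior(1) ends_P by force+
    then have "0 < t" "t < 1" using t by simp_all
    then obtain x where x: "x \<in> L" "x \<notin> P" "val x = t"
      using interior_limit_exists[OF _ _ interior] by blast
    have ne: "val a \<noteq> t" if "a \<in> M" for a using M_at_P[OF that] interior(1) by blast
    then have "inserted_before x = {a \<in> M. val a < t}" "{a \<in> M. val a \<le> t} = {a \<in> M. val a < t}"
      using x(3) by (auto simp: inserted_before_def order_le_less)
    then have "shifted x = T" using low high x(3) by (simp add: shifted_def)
    then show ?thesis using vertexI(2)[OF x(1)] by blast
  qed
qed

section \<open>The homeomorphism\<close>

context
  fixes h :: "itin \<Rightarrow> itin \<Rightarrow> real \<Rightarrow> real"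
  assumes maps: "interval_maps d \<nu> h"
begin

lemma interval_map:
  assumes "fatou p q"
  shows "strict_mono_on {0..1} (h p q)" "h p q ` {0..1} = {0..1}" "h p q 0 = 0" "h p q 1 = 1"
proof -
  show mono: "strict_mono_on {0..1} (h p q)" and image: "h p q ` {0..1} = {0..1}"
    using maps assms by (simp_all add: interval_maps_def)
  have less: "h p q s < h p q t" if "0 \<le> s" "s < t" "t \<le> 1" for s t
    using mono that by (simp add: strict_mono_on_def)
  have "0 \<in> h p q ` {0..1}" "1 \<in> h p q ` {0..1}" using image by simp_all
  then obtain s t where st: "s \<in> {0..1}" "h p q s = 0" "t \<in> {0..1}" "h p q t = 1" by (metis imageE)
  have in01: "h p q 0 \<in> {0..1}" "h p q 1 \<in> {0..1}" using image by force+
  show "h p q 0 = 0" using less[of 0 s] st in01 by (cases "s = 0") auto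
  show "h p q 1 = 1" using less[of t 1] st in01 by (cases "t = 1") auto
qed

lemma interval_map_less:
  "fatou p q \<Longrightarrow> 0 \<le> s \<Longrightarrow> s < t \<Longrightarrow> t \<le> 1 \<Longrightarrow> h p q s < h p q t"
  using interval_map(1) by (simp add: strict_mono_on_def)

lemma interval_map_inside:
  "fatou p q \<Longrightarrow> 0 < t \<Longrightarrow> t < 1 \<Longrightarrow> 0 < h p q t \<and> h p q t < 1"
  using interval_map_less[of p q 0 t] interval_map_less[of p q t 1] interval_map(3,4)[of p q] by simp

abbreviation g :: "path_point \<Rightarrow> real" where "g \<equiv> phi_tilde d \<nu> len h"

lemma g_Vertex: "x \<in> V \<Longrightarrow> g (Vertex x) = shifted x / total_length"
  by (simp add: phi_tilde_vertex_eq)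

lemma g_less:
  assumes "x \<in> V" "y \<in> V" "key_less x y"
  shows "g (Vertex x) < g (Vertex y)"
  unfolding g_Vertex[OF assms(1)] g_Vertex[OF assms(2)]
  by (rule divide_strict_right_mono[OF shifted_strict_mono[OF assms] total_length_pos])

lemma g_le: "x \<in> V \<Longrightarrow> y \<in> V \<Longrightarrow> V_le d \<nu> x y \<Longrightarrow> g (Vertex x) \<le> g (Vertex y)"
  using g_less V_less_iff less_imp_le by blast

lemma g_Fatou:
  "g (Fatou p q t) = g (Vertex p) + (g (Vertex q) - g (Vertex p)) * h p q t"
  by simp

lemma g_Fatou_inside:
  assumes "fatou p q" "0 < t" "t < 1"
  shows "g (Vertex p) < g (Fatou p q t)" "g (Fatou p q t) < g (Vertex q)"
proof -
  have less: "g (Vertex p) < g (Vertex q)" using fatou_adjacent(1-3)[OF assms(1)] g_less by blast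
  have h: "0 < h p q t" "h p q t < 1" using interval_map_inside[OF assms] by simp_all
  have "0 < (g (Vertex q) - g (Vertex p)) * h p q t" using less h(1) by (intro mult_pos_pos) simp_all
  then show "g (Vertex p) < g (Fatou p q t)" unfolding g_Fatou by linarith
  have "(g (Vertex q) - g (Vertex p)) * h p q t < (g (Vertex q) - g (Vertex p)) * 1"
    using less h(2) by (intro mult_strict_left_mono) simp_all
  then show "g (Fatou p q t) < g (Vertex q)" unfolding g_Fatou mult_1_right by linarith
qed

lemma path_point_cases:
  assumes "x \<in> path_points d \<nu>"
  obtains (Vertex) v where "v \<in> V" "x = Vertex v"
  | (Fatou) p q t where "fatou p q" "0 < t" "t < 1" "x = Fatou p q t"
  using assms by (auto simp: path_points_def)

lemma path_less_imp:
  assumes "x \<in> path_points d \<nu>" "y \<in> path_points d \<nu>" "path_less d \<nu> x y"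
  shows "g x < g y"
  using assms(1)
proof (cases rule: path_point_cases)
  case x: (Vertex v)
  from assms(2) show ?thesis
  proof (cases rule: path_point_cases)
    case (Vertex w)
    then have "V_less d \<nu> v w" using assms(3) x by simp
    then show ?thesis using g_less V_less_iff x Vertex by blast
  next
    case (Fatou p q t)
    note F = fatou_adjacent(1)[OF Fatou(1)]
    have "V_le d \<nu> v p" using assms(3) x Fatou by simp
    then have "g (Vertex v) \<le> g (Vertex p)" by (rule g_le[OF x(1) F])
    also have "\<dots> < g (Fatou p q t)" by (rule g_Fatou_inside(1)[OF Fatou(1-3)])
    finally show ?thesis unfolding x(2) Fatou(4) .
  qed
next
  case x: (Fatou p q t)
  note F = fatou_adjacent(1,2)[OF x(1)]
  from assms(2) show ?thesis
  proof (cases rule: path_point_cases)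
    case (Vertex w)
    have "g (Fatou p q t) < g (Vertex q)" by (rule g_Fatou_inside(2)[OF x(1-3)])
    also have "V_le d \<nu> q w" using assms(3) x Vertex by simp
    then have "g (Vertex q) \<le> g (Vertex w)" by (rule g_le[OF F(2) Vertex(1)])
    finally show ?thesis unfolding x(4) Vertex(2) .
  next
    case (Fatou p' q' t')
    note F' = fatou_adjacent(1,2)[OF Fatou(1)]
    have "p = p' \<and> q = q' \<and> t < t' \<or> V_le d \<nu> q p'" using assms(3) x Fatou by simp
    then show ?thesis
    proof
      assume same: "p = p' \<and> q = q' \<and> t < t'"
      have "h p q t < h p q t'" using interval_map_less[OF x(1), of t t'] x(2) Fatou(3) same by simp
      moreover have "g (Vertex p) < g (Vertex q)" using fatou_adjacent(1-3)[OF x(1)] g_less by blast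
      ultimately have
        "(g (Vertex q) - g (Vertex p)) * h p q t < (g (Vertex q) - g (Vertex p)) * h p q t'"
        by (intro mult_strict_left_mono) simp_all
      then show ?thesis using same unfolding x(4) Fatou(4) g_Fatou by simp
    next
      assume "V_le d \<nu> q p'"
      then have "g (Vertex q) \<le> g (Vertex p')" by (rule g_le[OF F(2) F'(1)])
      then show ?thesis
        using g_Fatou_inside(2)[OF x(1-3)] g_Fatou_inside(1)[OF Fatou(1-3)]
        unfolding x(4) Fatou(4) by linarith
    qed
  qed
qed

lemma vertex_fatou: 
  assumes "fatou p q" "v \<in> V"
  shows "V_le d \<nu> v p \<or> V_le d \<nu> q v"
proof -
  note A = fatou_adjacent[OF assms(1)]
  show ?thesis
    unfolding V_le_iff[OF assms(2) A(1)] V_le_iff[OF A(2) assms(2)] using A(4)[OF assms(2)] by blast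
qed

text \<open>No vertex lies between the ends of a Fatou interval, so a Fatou interval and a vertex, or two
  different Fatou intervals, never overlap.\<close>

lemma path_total:
  assumes "x \<in> path_points d \<nu>" "y \<in> path_points d \<nu>" "x \<noteq> y"
  shows "path_less d \<nu> x y \<or> path_less d \<nu> y x"
  using assms(1)
proof (cases rule: path_point_cases)
  case x: (Vertex v)
  from assms(2) show ?thesis
  proof (cases rule: path_point_cases)
    case (Vertex w)
    then show ?thesis using key_total[OF x(1) Vertex(1)] V_less_iff x assms(3) by auto
  next
    case (Fatou p q t)
    then show ?thesis using vertex_fatou[OF Fatou(1) x(1)] x by simp
  qed
next
  case x: (Fatou p q t)
  from assms(2) show ?thesis
  proof (cases rule: path_point_cases)
    case (Vertex w)
    then show ?thesis using vertex_fatou[OF x(1) Vertex(1)] x by auto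
  next
    case (Fatou p' q' t')
    then show ?thesis using fatou_disjoint[OF x(1) Fatou(1)] x assms(3) by auto
  qed
qed

lemma path_less_iff:
  assumes "x \<in> path_points d \<nu>" "y \<in> path_points d \<nu>"
  shows "path_less d \<nu> x y \<longleftrightarrow> g x < g y"
  using path_less_imp[OF assms] path_less_imp[OF assms(2,1)] path_total[OF assms]
  by (metis less_asym less_irrefl)

lemma g_inj: "inj_on g (path_points d \<nu>)"
  using path_total path_less_imp by (intro inj_onI) (metis less_irrefl)

lemma g_range:
  assumes "x \<in> path_points d \<nu>"
  shows "g x \<in> {0..1}"
proof -
  have V: "0 \<le> g (Vertex v) \<and> g (Vertex v) \<le> 1" if "v \<in> V" for v
    unfolding g_Vertex[OF that] using shifted_range[OF that] total_length_pos by simp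
  from assms show ?thesis
  proof (cases rule: path_point_cases)
    case (Vertex v)
    then show ?thesis using V by simp
  next
    case (Fatou p q t)
    then show ?thesis
      using V[OF fatou_adjacent(1)[OF Fatou(1)]] V[OF fatou_adjacent(2)[OF Fatou(1)]]
        g_Fatou_inside[OF Fatou(1-3)] unfolding Fatou(4)
          by (meson atLeastAtMost_iff less_imp_le order_trans)
  qed
qed

lemma g_surj:
  assumes "\<tau> \<in> {0..1}"
  shows "\<exists>x\<in>path_points d \<nu>. g x = \<tau>"
proof -
  have "0 \<le> \<tau> * total_length" "\<tau> * total_length \<le> total_length"
    using assms total_length_pos by (simp_all add: mult_left_le_one_le)
  then consider x where "x \<in> V" "shifted x = \<tau> * total_length"
    | p q where "fatou p q" "shifted p \<le> \<tau> * total_length" "\<tau> * total_length \<le> shifted q"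
    using shifted_cover by blast
  then show ?thesis
  proof cases
    case (1 x)
    then have "g (Vertex x) = \<tau>" using total_length_pos by (simp only: g_Vertex) simp
    then show ?thesis using 1(1) by (intro bexI[of _ "Vertex x"]) (simp_all add: path_points_def)
  next
    case (2 p q)
    note A = fatou_adjacent(1-3)[OF 2(1)]
    define a b where "a = g (Vertex p)" and "b = g (Vertex q)"
    have "a < b" using g_less A by (simp only: a_def b_def)
    have ab: "a \<le> \<tau>" "\<tau> \<le> b"
      unfolding a_def b_def g_Vertex[OF A(1)] g_Vertex[OF A(2)] using 2(2,3) total_length_pos
      by (simp_all add: pos_divide_le_eq pos_le_divide_eq)
    have "(\<tau> - a) / (b - a) \<in> {0..1}" using ab \<open>a < b\<close> by (simp add: pos_divide_le_eq)
    then obtain t where t: "t \<in> {0..1}" "h p q t = (\<tau> - a) / (b - a)"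
      using interval_map(2)[OF 2(1)] by (metis imageE)
    have eq: "a + (b - a) * h p q t = \<tau>" using t(2) \<open>a < b\<close> by simp
    consider "t = 0" | "t = 1" | "0 < t" "t < 1" using t(1) by fastforce
    then show ?thesis
    proof cases
      case 1
      then have "g (Vertex p) = \<tau>" using eq interval_map(3)[OF 2(1)] by (simp add: a_def)
      then show ?thesis using A(1) by (intro bexI[of _ "Vertex p"]) (simp_all add: path_points_def)
    next
      case 2
      then have "g (Vertex q) = \<tau>" using eq interval_map(4)[OF \<open>fatou p q\<close>] by (simp add: b_def)
      then show ?thesis using A(2) by (intro bexI[of _ "Vertex q"]) (simp_all add: path_points_def)
    next
      case 3
      then have "g (Fatou p q t) = \<tau>" using eq by (simp only: g_Fatou a_def b_def)
      moreover have "Fatou p q t \<in> path_points d \<nu>" using 3 2(1) by (auto simp: path_points_def)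
      ultimately show ?thesis by blast
    qed
  qed
qed

lemma homeomorphic_map_phi_tilde:
  "homeomorphic_map (critical_path d \<nu>) (top_of_set {0..1}) (phi_tilde d \<nu> len h)"
  unfolding critical_path_def
proof (rule homeomorphic_map_order_topology_on)
  show "bij_betw g (path_points d \<nu>) {0..1}"
    unfolding bij_betw_def using g_inj g_range g_surj by blast
qed (rule path_less_iff)

end

end

theorem lemma2p10:
  fixes d :: enat and \<nu> :: itin
  assumes "2 \<le> d" and "kneading_sequence d \<nu>"
  shows "critical_path d \<nu> homeomorphic_space top_of_set {0..1::real} \<and>
    (\<exists>len. interval_lengths d \<nu> len) \<and>
    (\<forall>len h. interval_lengths d \<nu> len \<and> interval_maps d \<nu> h \<longrightarrow>
       homeomorphic_map (critical_path d \<nu>) (top_of_set {0..1::real}) (phi_tilde d \<nu> len h))"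
proof (intro conjI allI impI)
  interpret kneading_path d \<nu> using assms(2) by unfold_locales
  show ex: "\<exists>len. interval_lengths d \<nu> len" by (rule interval_lengths_exist)
  have homeo: "homeomorphic_map (critical_path d \<nu>) (top_of_set {0..1}) (phi_tilde d \<nu> len h)"
    if "interval_lengths d \<nu> len" "interval_maps d \<nu> h" for len h
  proof -
    interpret shifted_path d \<nu> len using that(1) by unfold_locales
    show ?thesis using that(2) by (rule homeomorphic_map_phi_tilde)
  qed
  then show "homeomorphic_map (critical_path d \<nu>) (top_of_set {0..1}) (phi_tilde d \<nu> len h)"
    if "interval_lengths d \<nu> len \<and> interval_maps d \<nu> h" for len h using that by blast
  have "interval_maps d \<nu> (\<lambda>p q t. t)"
    by (auto simp: interval_maps_def strict_mono_on_def)
  then show "critical_path d \<nu> homeomorphic_space top_of_set {0..1::real}"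
    using ex homeo homeomorphic_map_imp_homeomorphic_space by blast
qed

end
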